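(* Let $\alpha>0$, $1<p<2$, $1\leq q\leq2$, $w\in A^{\mathrm{restricted}}_p$, and let $\mu$ be a positive Borel measure on $\mathbb{C}$. Let $\hat w(z):=\int_{Q_1(z)}w\,dA$. The following assertions are equivalent. (a) $I_d:F^p_{\alpha,w}\to L^q_{\alpha}(\mu)$ is $2$-summing. (b) $I_d:F^p_{\alpha,\hat{w}}\to L^q_{\alpha}(\mu)$ is $2$-summing. (c) $I_d:F^p_{\alpha,w}\to L^q_{\alpha}(\mu)$ is $r$-summing for any $r\geq1$. (d) $B_{\alpha}:L^{\frac{p}{2-p}}(\hat{w}^{2/(2-p)}dA)\to L^{q/2}(\mu)$ is bounded. (e) The sequence $$\lambda:=\left\{\frac{\mu(Q_1(\nu))}{w(Q_1(\nu))^{q/p}}\right\}_{\nu\in\mathbb{Z}^2}$$ belongs to $l^s(\mathbb{Z}^2)$, where $s=2p/(2p-2q+pq)$. Moreover, if one of these conditions holds, then $$\pi_2\big(I_d:F^p_{\alpha,w}\to L^q_{\alpha}(\mu)\big)\asymp\|\lambda\|^{1/q}_{l^s(\mathbb{Z}^2)}.$$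
   Context: $dA$ is Lebesgue measure on $\mathbb{C}$, $A(E)$ is the area of $E$, $w(E):=\int_E w\,dA$, $p'$ is the conjugate exponent of $p$. $\mathbb{Z}^2$ is viewed as a subset of $\mathbb{C}$. $Q_t(z)$ is the square centered at $z$ with side length $t$ and sides parallel to the axes; the unit squares $Q_1(\nu)$, $\nu\in\mathbb{Z}^2$, are taken half-open so that they partition $\mathbb{C}$. A weight is a nonnegative locally integrable function on $\mathbb{C}$. For $1<p<\infty$, $w\in A^{\mathrm{restricted}}_p$ means: $w>0$ a.e. and for some $t>0$, $$\sup_{z\in\mathbb{C}}\left(\frac{1}{A(Q_t(z))}\int_{Q_t(z)}w\,dA\right)\left(\frac{1}{A(Q_t(z))}\int_{Q_t(z)}w^{-p'/p}dA\right)^{p/p'}<\infty$$ (this is independent of $t$). For a weight $v$, $F^p_{\alpha,v}$ is the space of entire functions $f$ with $\|f\|^p_{F^p_{\alpha,v}}:=\int_{\mathbb{C}}|f(z)|^pe^{-\frac{p\alpha}{2}|z|^2}v(z)dA(z)<\infty$. $L^q_\alpha(\mu)$ is the space of measurable $f$ with $\|f\|^q_{L^q_{\alpha}(\mu)}:=\int_{\mathbb{C}}|f(z)|^qe^{-\frac{q\alpha}{2}|z|^2}d\mu(z)<\infty$. $I_d$ denotes the natural embedding $f\mapsto f$; saying that it is $r$-summing includes that it maps into the target space. $L^{k}(v\,dA)$ and $L^{q/2}(\mu)$ are the usual (quasi-)normed Lebesgue spaces for the measures $v\,dA$ and $\mu$. The Berezin transform is $B_{\alpha}f(z):=\int_{\mathbb{C}}f(u)e^{-\alpha|z-u|^2}dA(u)$,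 $z\in\mathbb{C}$, for $f\in L^1_{\mathrm{loc}}(\mathbb{C},dA)$. For $r\ge1$, a linear operator $T:X\to Y$ between Banach spaces is $r$-summing if there is $C\ge0$ such that $\left(\sum_{j=1}^n\|Tx_j\|_Y^r\right)^{1/r}\le C\sup_{x^*\in B_{X^*}}\left(\sum_{j=1}^n|x^*(x_j)|^r\right)^{1/r}$ for every finite sequence $x_1,\dots,x_n\in X$ ($B_{X^*}$ the unit ball of $X^*$); the least such $C$ is $\pi_r(T)$. $A\asymp B$ means $c^{-1}A\le B\le cA$ with a constant $c>0$ not depending on $\mu$ (it may depend on $\alpha,p,q,w$). *)

theory Defs
  imports "HOL-Analysis.Analysis"
begin

text \<open>
  All squares are half-open, so that the unit squares centred at lattice points partition the plane;
  the boundary is a Lebesgue null set.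
\<close>

definition square :: "real \<Rightarrow> complex \<Rightarrow> complex set" where
  "square t z = {u. Re z - t / 2 \<le> Re u \<and> Re u < Re z + t / 2 \<and>
                    Im z - t / 2 \<le> Im u \<and> Im u < Im z + t / 2}"

definition lattice :: "complex set" where
  "lattice = {z. Re z \<in> \<int> \<and> Im z \<in> \<int>}"

definition conj_exponent :: "real \<Rightarrow> real" where
  "conj_exponent p = p / (p - 1)"

text \<open>Real powers on \<open>[0, \<infinity>]\<close>, for exponents \<open>a > 0\<close> only.\<close>

definition enn_powr :: "ennreal \<Rightarrow> real \<Rightarrow> ennreal" where
  "enn_powr x a = (if x = \<infinity> then \<infinity> else ennreal (enn2real x powr a))"

definition weight :: "(complex \<Rightarrow> real) \<Rightarrow> bool" where
  "weight w \<longleftrightarrow> (\<forall>z. 0 \<le> w z) \<and> (\<forall>K. compact K \<longrightarrow> set_integrable lebesgue K w)"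

definition weight_mass :: "(complex \<Rightarrow> real) \<Rightarrow> complex set \<Rightarrow> real" where
  "weight_mass w E = (LINT u:E|lebesgue. w u)"

definition weight_hat :: "(complex \<Rightarrow> real) \<Rightarrow> complex \<Rightarrow> real" where
  "weight_hat w z = weight_mass w (square 1 z)"

definition average :: "(complex \<Rightarrow> real) \<Rightarrow> complex set \<Rightarrow> ennreal" where
  "average w E = (\<integral>\<^sup>+u\<in>E. ennreal (w u) \<partial>lebesgue) / emeasure lebesgue E"

text \<open>
  The supremum is taken in \<open>[0, \<infinity>]\<close>. The convention \<open>0 powr a = 0\<close> is harmless here, since \<open>w\<close>
  vanishes only on a null set.
\<close>

definition Ap_restricted :: "real \<Rightarrow> (complex \<Rightarrow> real) \<Rightarrow> bool" where
  "Ap_restricted p w \<longleftrightarrow> weight w \<and> (AE z in lebesgue. 0 < w z) \<and>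
     (\<exists>t>0. (SUP z. average w (square t z) *
                    enn_powr (average (\<lambda>u. w u powr (- (conj_exponent p / p))) (square t z))
                      (p / conj_exponent p)) < \<infinity>)"

text \<open>
  A space of complex-valued functions is a pair of a carrier, which is a linear subspace for the
  pointwise operations, and a (quasi-)norm on it. Functions that agree almost everywhere are not
  identified, so on Lebesgue spaces the second component vanishes on null functions; this
  affects none of the notions below. The value of the norm outside the carrier is irrelevant.
\<close>

type_synonym 'a fspace = "('a \<Rightarrow> complex) set \<times> (('a \<Rightarrow> complex) \<Rightarrow> real)"

abbreviation carrier_of :: "'a fspace \<Rightarrow> ('a \<Rightarrow> complex) set" where
  "carrier_of X \<equiv> fst X"

abbreviation norm_of :: "'a fspace \<Rightarrow> ('a \<Rightarrow> complex) \<Rightarrow> real" where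
  "norm_of X \<equiv> snd X"

definition Lebesgue_space :: "real \<Rightarrow> 'a measure \<Rightarrow> 'a fspace" where
  "Lebesgue_space k M =
    ({f \<in> borel_measurable M. (\<integral>\<^sup>+x. ennreal (cmod (f x) powr k) \<partial>M) < \<infinity>},
     \<lambda>f. enn2real (\<integral>\<^sup>+x. ennreal (cmod (f x) powr k) \<partial>M) powr (1 / k))"

definition gauss_Lebesgue_space :: "real \<Rightarrow> real \<Rightarrow> complex measure \<Rightarrow> complex fspace" where
  "gauss_Lebesgue_space \<alpha> q \<mu> =
    (let I = \<lambda>f. \<integral>\<^sup>+z. ennreal (cmod (f z) powr q * exp (- (q * \<alpha> / 2) * (cmod z)\<^sup>2)) \<partial>\<mu>
     in ({f \<in> borel_measurable \<mu>. I f < \<infinity>}, \<lambda>f. enn2real (I f) powr (1 / q)))"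

definition Fock_space :: "real \<Rightarrow> real \<Rightarrow> (complex \<Rightarrow> real) \<Rightarrow> complex fspace" where
  "Fock_space \<alpha> p v =
    (let I = \<lambda>f. \<integral>\<^sup>+z. ennreal (cmod (f z) powr p * exp (- (p * \<alpha> / 2) * (cmod z)\<^sup>2) * v z) \<partial>lebesgue
     in ({f. f holomorphic_on UNIV \<and> I f < \<infinity>}, \<lambda>f. enn2real (I f) powr (1 / p)))"

text \<open>
  The index set is the lattice; terms may a priori be infinite, and membership excludes this.
\<close>

definition ell_space :: "real \<Rightarrow> (complex \<Rightarrow> ennreal) set" where
  "ell_space s = {a. (\<integral>\<^sup>+\<nu>. enn_powr (a \<nu>) s \<partial>count_space lattice) < \<infinity>}"

definition ell_norm :: "real \<Rightarrow> (complex \<Rightarrow> ennreal) \<Rightarrow> real" where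
  "ell_norm s a = enn2real (\<integral>\<^sup>+\<nu>. enn_powr (a \<nu>) s \<partial>count_space lattice) powr (1 / s)"

definition linear_map :: "'a fspace \<Rightarrow> 'b fspace \<Rightarrow> (('a \<Rightarrow> complex) \<Rightarrow> ('b \<Rightarrow> complex)) \<Rightarrow> bool" where
  "linear_map X Y T \<longleftrightarrow>
     (\<forall>f\<in>carrier_of X. T f \<in> carrier_of Y) \<and>
     (\<forall>f\<in>carrier_of X. \<forall>g\<in>carrier_of X. T (\<lambda>x. f x + g x) = (\<lambda>y. T f y + T g y)) \<and>
     (\<forall>c. \<forall>f\<in>carrier_of X. T (\<lambda>x. c * f x) = (\<lambda>y. c * T f y))"

text \<open>
  The closed unit ball of the dual space; functionals are only constrained on the carrier.
\<close>

definition dual_ball :: "'a fspace \<Rightarrow> (('a \<Rightarrow> complex) \<Rightarrow> complex) set" where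
  "dual_ball X = {\<phi>.
     (\<forall>f\<in>carrier_of X. \<forall>g\<in>carrier_of X. \<phi> (\<lambda>x. f x + g x) = \<phi> f + \<phi> g) \<and>
     (\<forall>c. \<forall>f\<in>carrier_of X. \<phi> (\<lambda>x. c * f x) = c * \<phi> f) \<and>
     (\<forall>f\<in>carrier_of X. cmod (\<phi> f) \<le> norm_of X f)}"

text \<open>
  The real supremum below is a genuine one: the dual ball contains \<open>0\<close>, and the values are bounded by
  \<open>(\<Sum>j<n. norm_of X (x j) powr r) powr (1 / r)\<close>.
\<close>

definition summing_bound ::
  "real \<Rightarrow> 'a fspace \<Rightarrow> 'b fspace \<Rightarrow> (('a \<Rightarrow> complex) \<Rightarrow> ('b \<Rightarrow> complex)) \<Rightarrow> real \<Rightarrow> bool" where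
  "summing_bound r X Y T C \<longleftrightarrow> 0 \<le> C \<and>
     (\<forall>(n::nat) x. (\<forall>j<n. x j \<in> carrier_of X) \<longrightarrow>
        (\<Sum>j<n. norm_of Y (T (x j)) powr r) powr (1 / r)
          \<le> C * (SUP \<phi>\<in>dual_ball X. (\<Sum>j<n. cmod (\<phi> (x j)) powr r) powr (1 / r)))"

definition summing ::
  "real \<Rightarrow> 'a fspace \<Rightarrow> 'b fspace \<Rightarrow> (('a \<Rightarrow> complex) \<Rightarrow> ('b \<Rightarrow> complex)) \<Rightarrow> bool" where
  "summing r X Y T \<longleftrightarrow> linear_map X Y T \<and> (\<exists>C. summing_bound r X Y T C)"

definition summing_norm ::
  "real \<Rightarrow> 'a fspace \<Rightarrow> 'b fspace \<Rightarrow> (('a \<Rightarrow> complex) \<Rightarrow> ('b \<Rightarrow> complex)) \<Rightarrow> real" where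
  "summing_norm r X Y T = Inf {C. summing_bound r X Y T C}"

definition bounded_map :: "'a fspace \<Rightarrow> 'b fspace \<Rightarrow> (('a \<Rightarrow> complex) \<Rightarrow> ('b \<Rightarrow> complex)) \<Rightarrow> bool" where
  "bounded_map X Y T \<longleftrightarrow> linear_map X Y T \<and>
     (\<exists>C\<ge>0. \<forall>f\<in>carrier_of X. norm_of Y (T f) \<le> C * norm_of X f)"

definition berezin :: "real \<Rightarrow> (complex \<Rightarrow> complex) \<Rightarrow> complex \<Rightarrow> complex" where
  "berezin \<alpha> f z = (LINT u|lebesgue. f u * of_real (exp (- \<alpha> * (cmod (z - u))\<^sup>2)))"

text \<open>
  Boundedness of the Berezin transform includes its being well defined: the integral converges
  absolutely at every point, so the junk value of a divergent Bochner integral never enters.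
\<close>

definition berezin_bounded :: "real \<Rightarrow> complex fspace \<Rightarrow> complex fspace \<Rightarrow> bool" where
  "berezin_bounded \<alpha> X Y \<longleftrightarrow>
     (\<forall>f\<in>carrier_of X. \<forall>z. integrable lebesgue (\<lambda>u. f u * of_real (exp (- \<alpha> * (cmod (z - u))\<^sup>2)))) \<and>
     bounded_map X Y (berezin \<alpha>)"

definition lattice_ratio ::
  "real \<Rightarrow> real \<Rightarrow> (complex \<Rightarrow> real) \<Rightarrow> complex measure \<Rightarrow> complex \<Rightarrow> ennreal" where
  "lattice_ratio p q w \<mu> \<nu> =
     emeasure \<mu> (square 1 \<nu>) / ennreal (weight_mass w (square 1 \<nu>) powr (q / p))"

end

theory Submission
  imports Defs "HOL-Complex_Analysis.Cauchy_Integral_Formula"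
begin

text \<open>
  The restricted \<open>A\<^sub>p\<close> condition makes the masses \<open>H z = weight_hat w z\<close> of unit squares grow at
  most exponentially in the distance and gives the local estimate
  \<open>|f z|\<^sup>p e\<^bsup>-p\<alpha>|z|\<^sup>2/2\<^esup> H z \<le> C \<integral> |f|\<^sup>p e\<^bsup>-p\<alpha>|u|\<^sup>2/2\<^esup> w dA\<close>, the integral being over the unit disc at \<open>z\<close>.
  Every assertion is shown to be equivalent to (e). As (e) sees \<open>w\<close> only through \<open>H\<close>, and \<open>H\<close> as a
  weight satisfies the same estimates, (b) is covered by the argument for (a).

  If \<open>\<lambda> \<in> \<ell>\<^sup>s\<close>, let \<open>g\<^sub>\<nu>\<close> be \<open>f\<close> recentred at \<open>\<nu>\<close> by the Weyl shift. On \<open>Q\<^sub>1(\<nu>)\<close> the Gaussian-weighted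
  modulus of \<open>f\<close> is controlled by the mean of \<open>|g\<^sub>\<nu>|\<close> over the unit circle. Hoelder's inequality passes
  from \<open>\<ell>\<^sup>q\<close> to a weighted \<open>\<ell>\<^sup>2\<close> norm, and Khinchin's inequality in \<open>L\<^sup>1\<close> turns this \<open>\<ell>\<^sup>2\<close> norm into an
  average of \<open>|\<phi> f|\<close> over explicit functionals \<open>\<phi>\<close> of bounded norm, namely signed sums of the values of
  the \<open>g\<^sub>\<nu>\<close> at a point of the circle. Such a domination gives \<open>r\<close>-summability for all \<open>r \<ge> 1\<close> at once.

  Conversely, the \<open>2\<close>-summing inequality is tested on the Rademacher sums of the atoms
  \<open>\<beta>\<^sub>\<nu> H(\<nu>)\<^bsup>-1/p\<^esup> k\<^sub>\<nu>\<close> with coherent states \<open>k\<^sub>\<nu>\<close>. Their weak \<open>2\<close>-norm is at most a multiple of the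
  \<open>\<ell>\<^sup>r\<close> norm of \<open>\<beta>\<close>, where \<open>r = 2p/(2-p)\<close>, and their strong norm is bounded below by Khinchin's inequality; duality
  between \<open>\<ell>\<^bsup>r/q\<^esup>\<close> and \<open>\<ell>\<^sup>s\<close> gives (e). The same duality, tested on step functions, derives (e) from (d).
\<close>

section \<open>Inequalities for finite sums and integrals\<close>

text \<open>The supremum of |f| over a square is not linear in f, whereas summing inequalities only
  see linear functionals. Cauchy's formula on a fixed circle replaces it by an average of values of
  f at points chosen before f, each of them a linear functional; hence circle means instead of
  suprema.

  In the converse, testing 2-summability on the scaled atoms one by one would control only the sum
  of \<beta>^2 \<lambda>^(2/q), that is, \<lambda> in l^(p'/q) with p' conjugate to p, which is
  weaker than l^s when q < 2. Sums with random signs keep all atoms inside one L^q norm, and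
  averaging over the signs prevents cancellation between them.

  The recurring conflict is between the exponential growth of H and the Gaussian decay of kernels.
  Completing the square trades the Gaussian for any exponential rate, so that the sum of exp(-2|z -
  \<nu>|) over the lattice is the common source of convergence, including for the overlap of
  discs.\<close>

lemma nn_integral_Hoelder:
  fixes f g :: "'a \<Rightarrow> real"
  assumes [measurable]: "f \<in> borel_measurable M" "g \<in> borel_measurable M"
    and nonneg: "\<And>x. 0 \<le> f x" "\<And>x. 0 \<le> g x"
    and \<theta>: "0 \<le> \<theta>" "\<theta> \<le> 1" and XY: "0 \<le> X" "0 \<le> Y"
    and fX: "(\<integral>\<^sup>+x. ennreal (f x) \<partial>M) \<le> ennreal X" and gY: "(\<integral>\<^sup>+x. ennreal (g x) \<partial>M) \<le> ennreal Y"
  shows "(\<integral>\<^sup>+x. ennreal (f x powr \<theta> * g x powr (1 - \<theta>)) \<partial>M) \<le> ennreal (X powr \<theta> * Y powr (1 - \<theta>))"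
\<comment> \<open>The normalisation below divides by \<open>X\<close> and \<open>Y\<close>. If one
  of them vanishes, so does a factor almost everywhere, and the integrand with it even for \<theta>
  = 0 or 1, because \<open>0 powr a = 0\<close> for every \<open>a\<close>.\<close>
proof (cases "X = 0 \<or> Y = 0")
  case True
  then have "(AE x in M. f x = 0) \<or> (AE x in M. g x = 0)"
  proof
    assume "X = 0"
    then have "(\<integral>\<^sup>+x. ennreal (f x) \<partial>M) = 0" using fX by simp
    then have "AE x in M. ennreal (f x) = 0" by (subst (asm) nn_integral_0_iff_AE) auto
    then have "AE x in M. f x = 0" by eventually_elim (use nonneg in \<open>auto simp: ennreal_eq_0_iff order_antisym\<close>)
    then show ?thesis ..
  next
    assume "Y = 0"
    then have "(\<integral>\<^sup>+x. ennreal (g x) \<partial>M) = 0" using gY by simp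
    then have "AE x in M. ennreal (g x) = 0" by (subst (asm) nn_integral_0_iff_AE) auto
    then have "AE x in M. g x = 0" by eventually_elim (use nonneg in \<open>auto simp: ennreal_eq_0_iff order_antisym\<close>)
    then show ?thesis ..
  qed
  then have "AE x in M. ennreal (f x powr \<theta> * g x powr (1 - \<theta>)) = 0" by auto
  then have "(\<integral>\<^sup>+x. ennreal (f x powr \<theta> * g x powr (1 - \<theta>)) \<partial>M) = 0"
    by (subst nn_integral_0_iff_AE) auto
  then show ?thesis by simp
next
  case False
  then have pos: "X > 0" "Y > 0" using XY by auto
  let ?c = "X powr \<theta> * Y powr (1 - \<theta>)"
  \<comment> \<open>Young's inequality for \<open>f x / X\<close> and \<open>g x / Y\<close>,
    rescaled by \<open>?c\<close>. The right side is linear in \<open>f\<close> and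
    \<open>g\<close>, so upper bounds of their integrals suffice.\<close>
  have pw: "f x powr \<theta> * g x powr (1 - \<theta>) \<le> ?c * (\<theta> / X) * f x + ?c * ((1 - \<theta>) / Y) * g x" for x
  proof (cases "f x = 0 \<or> g x = 0")
    case True
    then show ?thesis using nonneg \<theta> pos by auto
  next
    case False
    then have "f x > 0" "g x > 0" using nonneg[of x] by (auto simp: less_le)
    then have "(f x / X) powr \<theta> * (g x / Y) powr (1 - \<theta>) \<le> \<theta> * (f x / X) + (1 - \<theta>) * (g x / Y)"
      using \<theta> pos by (intro Youngs_inequality_0) auto
    then have "?c * ((f x / X) powr \<theta> * (g x / Y) powr (1 - \<theta>))
        \<le> ?c * (\<theta> * (f x / X) + (1 - \<theta>) * (g x / Y))"
      by (intro mult_left_mono) auto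
    moreover have "?c * ((f x / X) powr \<theta> * (g x / Y) powr (1 - \<theta>)) = f x powr \<theta> * g x powr (1 - \<theta>)"
      using pos nonneg[of x] by (simp add: powr_divide)
    ultimately show ?thesis by (simp add: algebra_simps)
  qed
  have "(\<integral>\<^sup>+x. ennreal (f x powr \<theta> * g x powr (1 - \<theta>)) \<partial>M)
     \<le> (\<integral>\<^sup>+x. ennreal (?c * (\<theta> / X)) * ennreal (f x) + ennreal (?c * ((1 - \<theta>) / Y)) * ennreal (g x) \<partial>M)"
    using pw nonneg \<theta> pos
    by (intro nn_integral_mono) (auto simp flip: ennreal_mult ennreal_plus intro!: ennreal_leI)
  also have "\<dots> = ennreal (?c * (\<theta> / X)) * (\<integral>\<^sup>+x. ennreal (f x) \<partial>M)
      + ennreal (?c * ((1 - \<theta>) / Y)) * (\<integral>\<^sup>+x. ennreal (g x) \<partial>M)"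
    by (simp add: nn_integral_add nn_integral_cmult)
  also have "\<dots> \<le> ennreal (?c * (\<theta> / X)) * ennreal X + ennreal (?c * ((1 - \<theta>) / Y)) * ennreal Y"
    using fX gY by (intro add_mono mult_left_mono) auto
  also have "\<dots> = ennreal (?c * \<theta> + ?c * (1 - \<theta>))"
    using \<theta> pos by (simp flip: ennreal_mult ennreal_plus)
  also have "?c * \<theta> + ?c * (1 - \<theta>) = ?c" by algebra
  finally show ?thesis .
qed

lemma sum_Hoelder:
  fixes f g :: "'a \<Rightarrow> real"
  assumes F: "finite F" and nonneg: "\<And>x. x \<in> F \<Longrightarrow> 0 \<le> f x" "\<And>x. x \<in> F \<Longrightarrow> 0 \<le> g x"
    and \<theta>: "0 \<le> \<theta>" "\<theta> \<le> 1"
  shows "(\<Sum>x\<in>F. f x powr \<theta> * g x powr (1 - \<theta>)) \<le> (\<Sum>x\<in>F. f x) powr \<theta> * (\<Sum>x\<in>F. g x) powr (1 - \<theta>)"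
proof -
  have eq: "(\<integral>\<^sup>+x. ennreal (h x) \<partial>count_space F) = ennreal (\<Sum>x\<in>F. h x)"
    if "\<And>x. x \<in> F \<Longrightarrow> 0 \<le> h x" for h
    using F that by (simp add: nn_integral_count_space_finite)
  \<comment> \<open>Nonnegativity is known only on \<open>F\<close>, but the integral form asks for
    it everywhere; absolute values supply it and change nothing on \<open>F\<close>.\<close>
  have eq': "(\<integral>\<^sup>+x. ennreal \<bar>h x\<bar> \<partial>count_space F) = ennreal (\<Sum>x\<in>F. h x)"
    if "\<And>x. x \<in> F \<Longrightarrow> 0 \<le> h x" for h
    using eq[of h] that by (auto intro!: nn_integral_cong simp flip: eq)
  have "(\<integral>\<^sup>+x. ennreal (\<bar>f x\<bar> powr \<theta> * \<bar>g x\<bar> powr (1 - \<theta>)) \<partial>count_space F)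
     \<le> ennreal ((\<Sum>x\<in>F. f x) powr \<theta> * (\<Sum>x\<in>F. g x) powr (1 - \<theta>))"
    using nonneg \<theta> by (intro nn_integral_Hoelder) (auto intro!: sum_nonneg simp: eq')
  also have "(\<integral>\<^sup>+x. ennreal (\<bar>f x\<bar> powr \<theta> * \<bar>g x\<bar> powr (1 - \<theta>)) \<partial>count_space F)
     = ennreal (\<Sum>x\<in>F. f x powr \<theta> * g x powr (1 - \<theta>))"
    using nonneg by (subst eq[symmetric]) (auto intro!: nn_integral_cong)
  finally show ?thesis by (subst (asm) ennreal_le_iff) auto
qed

lemma power_mean_le:
  fixes x :: "'a \<Rightarrow> real"
  assumes F: "finite F" and nonneg: "\<And>i. i \<in> F \<Longrightarrow> 0 \<le> x i" and r: "1 \<le> r"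
  shows "(\<Sum>i\<in>F. x i) powr r \<le> real (card F) powr (r - 1) * (\<Sum>i\<in>F. x i powr r)"
proof -
  have "(\<Sum>i\<in>F. x i) = (\<Sum>i\<in>F. (x i powr r) powr (1 / r) * 1 powr (1 - 1 / r))"
    using r nonneg by (intro sum.cong) (auto simp: powr_powr)
  also have "\<dots> \<le> (\<Sum>i\<in>F. x i powr r) powr (1 / r) * (\<Sum>i\<in>F. 1) powr (1 - 1 / r)"
    using r F by (intro sum_Hoelder) auto
  finally have "(\<Sum>i\<in>F. x i) powr r \<le> ((\<Sum>i\<in>F. x i powr r) powr (1 / r) * real (card F) powr (1 - 1 / r)) powr r"
    using nonneg r by (intro powr_mono2) (auto intro!: sum_nonneg)
  also have "\<dots> = (\<Sum>i\<in>F. x i powr r) powr (1 / r * r) * real (card F) powr ((1 - 1 / r) * r)"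
    by (subst powr_mult) (auto simp: powr_powr intro!: sum_nonneg)
  also have "(1 - 1 / r) * r = r - 1" using r by (simp add: field_simps)
  also have "1 / r * r = 1" using r by simp
  finally show ?thesis by (simp add: sum_nonneg mult.commute)
qed

text \<open>A choice of signs on \<open>F\<close> is encoded by the subset where the sign is +1, so
  that expectations over independent signs become sums over \<open>Pow F\<close> divided by
  \<open>2 ^ card F\<close>.\<close>

definition sgn_of :: "'a set \<Rightarrow> 'a \<Rightarrow> real" where
  "sgn_of A x = (if x \<in> A then 1 else -1)"

lemma abs_sgn_of [simp]: "\<bar>sgn_of A x\<bar> = 1"
  by (simp add: sgn_of_def)

lemma sum_Pow_insert:
  fixes h :: "'a set \<Rightarrow> 'b::comm_monoid_add"
  assumes "finite F" "x \<notin> F"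
  shows "(\<Sum>A\<in>Pow (insert x F). h A) = (\<Sum>A\<in>Pow F. h A + h (insert x A))"
proof -
  have "inj_on (insert x) (Pow F)" using assms by (auto simp: inj_on_def)
  moreover have "Pow F \<inter> insert x ` Pow F = {}" using assms by auto
  ultimately show ?thesis
    using assms by (simp add: Pow_insert sum.union_disjoint sum.reindex sum.distrib)
qed

lemma sgn_sum_insert:
  fixes c :: "'a \<Rightarrow> 'b::real_vector"
  assumes "finite F" "x \<notin> F" "A \<subseteq> F"
  shows "(\<Sum>y\<in>insert x F. sgn_of A y *\<^sub>R c y) = (\<Sum>y\<in>F. sgn_of A y *\<^sub>R c y) - c x"
    "(\<Sum>y\<in>insert x F. sgn_of (insert x A) y *\<^sub>R c y) = (\<Sum>y\<in>F. sgn_of A y *\<^sub>R c y) + c x"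
proof -
  have "(\<Sum>y\<in>F. sgn_of (insert x A) y *\<^sub>R c y) = (\<Sum>y\<in>F. sgn_of A y *\<^sub>R c y)"
    using assms by (intro sum.cong) (auto simp: sgn_of_def)
  moreover have "sgn_of A x = -1" "sgn_of (insert x A) x = 1" using assms by (auto simp: sgn_of_def)
  ultimately show "(\<Sum>y\<in>insert x F. sgn_of A y *\<^sub>R c y) = (\<Sum>y\<in>F. sgn_of A y *\<^sub>R c y) - c x"
    "(\<Sum>y\<in>insert x F. sgn_of (insert x A) y *\<^sub>R c y) = (\<Sum>y\<in>F. sgn_of A y *\<^sub>R c y) + c x"
    using assms by simp_all
qed

lemma square_powr_half:
  fixes y :: real
  assumes "0 \<le> y"
  shows "(y\<^sup>2) powr (a / 2) = y powr a"
  using assms by (cases "y = 0") (auto simp: powr_powr simp flip: powr_numeral)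

lemma parallelogram:
  fixes a b :: "'a::real_inner"
  shows "(norm (a - b))\<^sup>2 + (norm (a + b))\<^sup>2 = 2 * (norm a)\<^sup>2 + 2 * (norm b)\<^sup>2"
  by (simp add: power2_norm_eq_inner inner_simps inner_commute)

text \<open>Patterns that differ only at the new element come in pairs, and the parallelogram law
  cancels the cross terms of each pair. Besides feeding Khinchin's inequality, the identity reduces
  the weak 2-norm of random sums of atoms to that of the atoms.\<close>

lemma rademacher_second_moment:
  fixes c :: "'a \<Rightarrow> 'b::real_inner"
  assumes "finite F"
  shows "(\<Sum>A\<in>Pow F. (norm (\<Sum>x\<in>F. sgn_of A x *\<^sub>R c x))\<^sup>2) = 2 ^ card F * (\<Sum>x\<in>F. (norm (c x))\<^sup>2)"
  using assms
proof (induction F rule: finite_induct)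
  case (insert x F)
  have "(\<Sum>A\<in>Pow (insert x F). (norm (\<Sum>y\<in>insert x F. sgn_of A y *\<^sub>R c y))\<^sup>2)
     = (\<Sum>A\<in>Pow F. (norm ((\<Sum>y\<in>F. sgn_of A y *\<^sub>R c y) - c x))\<^sup>2 + (norm ((\<Sum>y\<in>F. sgn_of A y *\<^sub>R c y) + c x))\<^sup>2)"
    using insert.hyps by (subst sum_Pow_insert) (auto intro!: sum.cong simp: sgn_sum_insert simp del: sum.insert)
  also have "\<dots> = 2 * (\<Sum>A\<in>Pow F. (norm (\<Sum>y\<in>F. sgn_of A y *\<^sub>R c y))\<^sup>2) + 2 * (2 ^ card F * (norm (c x))\<^sup>2)"
    using insert.hyps by (simp add: parallelogram sum.distrib sum_distrib_left card_Pow)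
  finally show ?case using insert by (simp add: algebra_simps)
qed simp

text \<open>The fourth powers add up to \<open>2 * S\<^sup>2 + 8 * t\<^sup>2\<close>. The constant
  12 consists of 4 from the square of \<open>S\<close> and 8 from the Cauchy-Schwarz bound for
  \<open>t\<close>.\<close>

lemma parallelogram_fourth:
  fixes a b :: "'a::real_inner"
  shows "(norm (a - b)) ^ 4 + (norm (a + b)) ^ 4 \<le> 2 * (norm a) ^ 4 + 12 * (norm a)\<^sup>2 * (norm b)\<^sup>2 + 2 * (norm b) ^ 4"
proof -
  define S where "S = (norm a)\<^sup>2 + (norm b)\<^sup>2"
  define t where "t = inner a b"
  have m: "(norm (a - b))\<^sup>2 = S - 2 * t" "(norm (a + b))\<^sup>2 = S + 2 * t"
    unfolding S_def t_def by (simp_all add: power2_norm_eq_inner inner_simps inner_commute)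
  have "\<bar>t\<bar> \<le> norm a * norm b" unfolding t_def by (rule Cauchy_Schwarz_ineq2)
  then have "\<bar>t\<bar>\<^sup>2 \<le> (norm a * norm b)\<^sup>2" by (rule power_mono) simp
  then have t: "t\<^sup>2 \<le> (norm a)\<^sup>2 * (norm b)\<^sup>2" by (simp add: power_mult_distrib)
  have p4: "y ^ 4 = (y\<^sup>2)\<^sup>2" for y :: real by simp
  have "(norm (a - b)) ^ 4 + (norm (a + b)) ^ 4 = 2 * S\<^sup>2 + 8 * t\<^sup>2"
    unfolding p4 m by (simp add: power2_eq_square algebra_simps)
  also have "\<dots> \<le> 2 * S\<^sup>2 + 8 * ((norm a)\<^sup>2 * (norm b)\<^sup>2)" using t by simp
  also have "\<dots> = 2 * (norm a) ^ 4 + 12 * (norm a)\<^sup>2 * (norm b)\<^sup>2 + 2 * (norm b) ^ 4"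
    unfolding S_def p4 by (simp add: power2_eq_square algebra_simps)
  finally show ?thesis .
qed

lemma rademacher_fourth_moment:
  fixes c :: "'a \<Rightarrow> 'b::real_inner"
  assumes "finite F"
  shows "(\<Sum>A\<in>Pow F. (norm (\<Sum>x\<in>F. sgn_of A x *\<^sub>R c x)) ^ 4) \<le> 3 * 2 ^ card F * (\<Sum>x\<in>F. (norm (c x))\<^sup>2)\<^sup>2"
  using assms
proof (induction F rule: finite_induct)
  case (insert x F)
  let ?X = "\<lambda>A. \<Sum>y\<in>F. sgn_of A y *\<^sub>R c y"
  let ?s = "\<Sum>y\<in>F. (norm (c y))\<^sup>2"
  have "(\<Sum>A\<in>Pow (insert x F). (norm (\<Sum>y\<in>insert x F. sgn_of A y *\<^sub>R c y)) ^ 4)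
     = (\<Sum>A\<in>Pow F. (norm (?X A - c x)) ^ 4 + (norm (?X A + c x)) ^ 4)"
    using insert.hyps by (subst sum_Pow_insert) (auto intro!: sum.cong simp: sgn_sum_insert simp del: sum.insert)
  also have "\<dots> \<le> (\<Sum>A\<in>Pow F. 2 * (norm (?X A)) ^ 4 + 12 * (norm (?X A))\<^sup>2 * (norm (c x))\<^sup>2 + 2 * (norm (c x)) ^ 4)"
    by (intro sum_mono parallelogram_fourth)
  also have "\<dots> = 2 * (\<Sum>A\<in>Pow F. (norm (?X A)) ^ 4) + 12 * (\<Sum>A\<in>Pow F. (norm (?X A))\<^sup>2) * (norm (c x))\<^sup>2
      + 2 ^ card F * (2 * (norm (c x)) ^ 4)"
    using insert.hyps by (simp add: sum.distrib card_Pow flip: sum_distrib_left sum_distrib_right)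
  \<comment> \<open>Enlarging the last coefficient from 2 to 6 completes the square: the three terms
    become 6 times the square of \<open>?s\<close> plus the new squared norm. So the constant 3
    reproduces itself.\<close>
  also have "\<dots> \<le> 2 * (3 * 2 ^ card F * ?s\<^sup>2) + 12 * (2 ^ card F * ?s) * (norm (c x))\<^sup>2 + 2 ^ card F * (6 * (norm (c x)) ^ 4)"
    using insert by (intro add_mono mult_left_mono mult_right_mono) (simp_all add: rademacher_second_moment)
  also have "\<dots> = 3 * 2 ^ card (insert x F) * (\<Sum>y\<in>insert x F. (norm (c y))\<^sup>2)\<^sup>2"
    using insert.hyps by (simp add: power2_eq_square algebra_simps power4_eq_xxxx)
  finally show ?case .
qed simp

text \<open>A pointwise inequality bounds y from below by a combination of y^2 and y^4. For norms
  normalised by \<sigma> and averaged over the signs, the second moment contributes 1 and the fourth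
  costs at most 3 times 4/27, which is 4/9; this leaves 5/9.\<close>

lemma Khinchin_L1:
  fixes c :: "'a \<Rightarrow> 'b::real_inner"
  assumes F: "finite F"
  shows "2 ^ card F * sqrt (\<Sum>x\<in>F. (norm (c x))\<^sup>2) \<le> 9 / 5 * (\<Sum>A\<in>Pow F. norm (\<Sum>x\<in>F. sgn_of A x *\<^sub>R c x))"
proof (cases "(\<Sum>x\<in>F. (norm (c x))\<^sup>2) = 0")
  case True
  then show ?thesis by (simp add: sum_nonneg)
next
  case False
  define \<sigma> where "\<sigma> = sqrt (\<Sum>x\<in>F. (norm (c x))\<^sup>2)"
  have \<sigma>: "\<sigma> > 0" using False unfolding \<sigma>_def by (simp add: sum_nonneg less_le)
  have \<sigma>2: "(\<Sum>x\<in>F. (norm (c x))\<^sup>2) = \<sigma>\<^sup>2" unfolding \<sigma>_def by (simp add: sum_nonneg)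
  let ?N = "\<lambda>A. norm (\<Sum>x\<in>F. sgn_of A x *\<^sub>R c x)"
  \<comment> \<open>the constant \<open>4/27\<close> makes \<open>1 - y + 4/27 y\<^sup>3\<close> a nonnegative function with a double zero at \<open>3/2\<close>\<close>
  have y: "y\<^sup>2 - 4 / 27 * y ^ 4 \<le> y" if "y \<ge> 0" for y :: real
  proof -
    have "y - (y\<^sup>2 - 4 / 27 * y ^ 4) = y * ((y - 3 / 2)\<^sup>2 * (y + 3) * (4 / 27))"
      by (simp add: power2_eq_square power4_eq_xxxx field_simps)
    also have "\<dots> \<ge> 0" using that by simp
    finally show ?thesis by simp
  qed
  have t: "t\<^sup>2 * \<sigma>\<^sup>2 - 4 / 27 * t ^ 4 \<le> \<sigma> ^ 3 * t" if "t \<ge> 0" for t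
  proof -
    have "\<sigma> ^ 4 * ((t / \<sigma>)\<^sup>2 - 4 / 27 * (t / \<sigma>) ^ 4) \<le> \<sigma> ^ 4 * (t / \<sigma>)"
      using that \<sigma> by (intro mult_left_mono y) auto
    moreover have "\<sigma> ^ 4 * ((t / \<sigma>)\<^sup>2 - 4 / 27 * (t / \<sigma>) ^ 4) = t\<^sup>2 * \<sigma>\<^sup>2 - 4 / 27 * t ^ 4"
      using \<sigma> by (simp add: field_simps power2_eq_square power4_eq_xxxx)
    moreover have "\<sigma> ^ 4 * (t / \<sigma>) = \<sigma> ^ 3 * t"
      using \<sigma> by (simp add: field_simps power3_eq_cube power4_eq_xxxx)
    ultimately show ?thesis by simp
  qed
  have "(5 / 9 * 2 ^ card F) * \<sigma> ^ 4 = (2 ^ card F * \<sigma>\<^sup>2) * \<sigma>\<^sup>2 - 4 / 27 * (3 * 2 ^ card F * (\<sigma>\<^sup>2)\<^sup>2)"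
    by (simp add: power2_eq_square power4_eq_xxxx)
  also have "\<dots> \<le> (\<Sum>A\<in>Pow F. (?N A)\<^sup>2) * \<sigma>\<^sup>2 - 4 / 27 * (\<Sum>A\<in>Pow F. ?N A ^ 4)"
    using rademacher_second_moment[OF F, of c] rademacher_fourth_moment[OF F, of c] unfolding \<sigma>2
    by (intro diff_mono mult_left_mono mult_right_mono) auto
  also have "\<dots> = (\<Sum>A\<in>Pow F. (?N A)\<^sup>2 * \<sigma>\<^sup>2 - 4 / 27 * ?N A ^ 4)"
    by (simp add: sum_subtractf sum_distrib_left sum_distrib_right)
  also have "\<dots> \<le> (\<Sum>A\<in>Pow F. \<sigma> ^ 3 * ?N A)"
    by (intro sum_mono t) simp
  also have "\<dots> = \<sigma> ^ 3 * (\<Sum>A\<in>Pow F. ?N A)" by (simp add: sum_distrib_left)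
  finally have "\<sigma> ^ 3 * (5 / 9 * 2 ^ card F * \<sigma>) \<le> \<sigma> ^ 3 * (\<Sum>A\<in>Pow F. ?N A)"
    by (simp add: power3_eq_cube power4_eq_xxxx algebra_simps)
  then have "5 / 9 * 2 ^ card F * \<sigma> \<le> (\<Sum>A\<in>Pow F. ?N A)"
    using \<sigma> by (simp only: mult_le_cancel_left_pos zero_less_power)
  then show ?thesis by (simp add: \<sigma>_def)
qed

section \<open>Exponential sums over the lattice\<close>

lemma exp_int_sum_le:
  fixes G :: "int set"
  assumes "finite G"
  shows "(\<Sum>m\<in>G. exp (- \<bar>real_of_int m\<bar>)) \<le> 2 * (\<Sum>n. exp (-1) ^ n)"
proof -
  have sm: "summable (\<lambda>n. exp (-1 :: real) ^ n)" by (intro summable_geometric) auto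
  have b: "(\<Sum>m\<in>G'. exp (- \<bar>real_of_int m\<bar>)) \<le> (\<Sum>n. exp (-1) ^ n)"
    if "G' \<subseteq> G" "inj_on (\<lambda>m. nat \<bar>m\<bar>) G'" for G'
  proof -
    have "exp (- \<bar>real_of_int m\<bar>) = exp (-1) ^ nat \<bar>m\<bar>" for m :: int
    proof -
      have "exp (-1 :: real) ^ nat \<bar>m\<bar> = exp (real (nat \<bar>m\<bar>) * (-1))" by (rule exp_of_nat_mult[symmetric])
      then show ?thesis by simp
    qed
    then have "(\<Sum>m\<in>G'. exp (- \<bar>real_of_int m\<bar>)) = (\<Sum>n\<in>(\<lambda>m. nat \<bar>m\<bar>) ` G'. exp (-1 :: real) ^ n)"
      using that by (simp add: sum.reindex)
    also have "\<dots> \<le> (\<Sum>n. exp (-1) ^ n)"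
      using that assms sm by (intro sum_le_suminf) (auto intro: finite_subset)
    finally show ?thesis .
  qed
  have "(\<Sum>m\<in>G. exp (- \<bar>real_of_int m\<bar>))
     = (\<Sum>m\<in>{m\<in>G. m \<ge> 0}. exp (- \<bar>real_of_int m\<bar>)) + (\<Sum>m\<in>{m\<in>G. m < 0}. exp (- \<bar>real_of_int m\<bar>))"
    using assms by (subst sum.union_disjoint[symmetric]) (auto intro!: sum.cong)
  also have "\<dots> \<le> (\<Sum>n. exp (-1) ^ n) + (\<Sum>n. exp (-1) ^ n)"
    by (intro add_mono b) (auto simp: inj_on_def)
  finally show ?thesis by simp
qed

lemma exp_shifted_int_sum_le:
  fixes G :: "int set"
  assumes "finite G"
  shows "(\<Sum>m\<in>G. exp (- \<bar>x - real_of_int m\<bar>)) \<le> exp 1 * (2 * (\<Sum>n. exp (-1) ^ n))"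
proof -
  \<comment> \<open>Replacing \<open>x\<close> by its integer part moves it by less than 1, which
    costs the factor \<open>exp 1\<close>.\<close>
  have "(\<Sum>m\<in>G. exp (- \<bar>x - real_of_int m\<bar>)) \<le> (\<Sum>m\<in>G. exp 1 * exp (- \<bar>real_of_int (m - \<lfloor>x\<rfloor>)\<bar>))"
    unfolding mult_exp_exp by (intro sum_mono) (simp, linarith)
  also have "\<dots> = exp 1 * (\<Sum>m\<in>(\<lambda>m. m - \<lfloor>x\<rfloor>) ` G. exp (- \<bar>real_of_int m\<bar>))"
    by (subst sum.reindex) (auto simp: inj_on_def sum_distrib_left)
  also have "\<dots> \<le> exp 1 * (2 * (\<Sum>n. exp (-1) ^ n))"
    using assms by (intro mult_left_mono exp_int_sum_le) auto
  finally show ?thesis .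
qed

text \<open>The rate 2 makes the sum factor: the absolute values of real and imaginary part add up
  to at most twice the modulus, so each term is at most a product of one-dimensional terms.
  Uniformity in \<open>z\<close> lets the same bound count overlaps of discs and sum kernel
  tails.\<close>

lemma lattice_exp_sum:
  obtains S where "S > 0" "\<And>F z. finite F \<Longrightarrow> F \<subseteq> lattice \<Longrightarrow> (\<Sum>\<nu>\<in>F. exp (- 2 * cmod (z - \<nu>))) \<le> S"
proof -
  define T where "T = exp 1 * (2 * (\<Sum>n. exp (-1 :: real) ^ n))"
  have "T \<ge> 0" unfolding T_def using exp_shifted_int_sum_le[of "{}" 0] by simp
  have main: "(\<Sum>\<nu>\<in>F. exp (- 2 * cmod (z - \<nu>))) \<le> T * T" if F: "finite F" "F \<subseteq> lattice" for F z
  proof -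
    let ?G = "(\<lambda>\<nu>. \<lfloor>Re \<nu>\<rfloor>) ` F" and ?G' = "(\<lambda>\<nu>. \<lfloor>Im \<nu>\<rfloor>) ` F"
    let ?h = "\<lambda>(m, n). exp (- \<bar>Re z - real_of_int m\<bar>) * exp (- \<bar>Im z - real_of_int n\<bar>)"
    have lat: "real_of_int \<lfloor>Re \<nu>\<rfloor> = Re \<nu>" "real_of_int \<lfloor>Im \<nu>\<rfloor> = Im \<nu>" if "\<nu> \<in> F" for \<nu>
      using that F(2) by (auto simp: lattice_def elim!: Ints_cases)
    have "(\<Sum>\<nu>\<in>F. exp (- 2 * cmod (z - \<nu>))) \<le> (\<Sum>\<nu>\<in>F. ?h (\<lfloor>Re \<nu>\<rfloor>, \<lfloor>Im \<nu>\<rfloor>))"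
    proof (intro sum_mono)
      fix \<nu> assume "\<nu> \<in> F"
      then show "exp (- 2 * cmod (z - \<nu>)) \<le> ?h (\<lfloor>Re \<nu>\<rfloor>, \<lfloor>Im \<nu>\<rfloor>)"
        using abs_Re_le_cmod[of "z - \<nu>"] abs_Im_le_cmod[of "z - \<nu>"] by (simp add: lat mult_exp_exp)
    qed
    also have "\<dots> = (\<Sum>k\<in>(\<lambda>\<nu>. (\<lfloor>Re \<nu>\<rfloor>, \<lfloor>Im \<nu>\<rfloor>)) ` F. ?h k)"
    proof (subst sum.reindex)
      show "inj_on (\<lambda>\<nu>. (\<lfloor>Re \<nu>\<rfloor>, \<lfloor>Im \<nu>\<rfloor>)) F"
        by (rule inj_onI, rule complex_eqI) (metis lat Pair_inject)+
    qed simp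
    also have "\<dots> \<le> (\<Sum>k\<in>?G \<times> ?G'. ?h k)"
      using F by (intro sum_mono2) auto
    also have "\<dots> = (\<Sum>m\<in>?G. exp (- \<bar>Re z - real_of_int m\<bar>)) * (\<Sum>n\<in>?G'. exp (- \<bar>Im z - real_of_int n\<bar>))"
      by (simp add: sum_product sum.cartesian_product)
    also have "\<dots> \<le> T * T"
      using F \<open>T \<ge> 0\<close> unfolding T_def by (intro mult_mono exp_shifted_int_sum_le sum_nonneg) auto
    finally show ?thesis .
  qed
  show ?thesis
  proof
    show "T * T + 1 > 0" using \<open>T \<ge> 0\<close> by (simp add: add_nonneg_pos)
    show "\<And>F z. finite F \<Longrightarrow> F \<subseteq> lattice \<Longrightarrow> (\<Sum>\<nu>\<in>F. exp (- 2 * cmod (z - \<nu>))) \<le> T * T + 1"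
      using main by (simp add: add_increasing2)
  qed
qed

section \<open>Mean value estimates for entire functions\<close>

lemma lborel_complex_eq_distr:
  "(lborel :: complex measure) = distr (lborel \<Otimes>\<^sub>M lborel) borel (\<lambda>(x, y). Complex x y)"
proof (rule lborel_eqI)
  have [measurable]: "(\<lambda>(x, y). Complex x y) \<in> borel_measurable (lborel \<Otimes>\<^sub>M lborel)"
    unfolding Complex_eq by measurable
  fix l u :: complex
  assume *: "\<And>b. b \<in> Basis \<Longrightarrow> l \<bullet> b \<le> u \<bullet> b"
  have le: "Re l \<le> Re u" "Im l \<le> Im u"
    using *[of 1] *[of \<i>] by (auto simp: Basis_complex_def inner_complex_def)
  have "box l u \<in> sets borel" by simp
  then have "emeasure (distr (lborel \<Otimes>\<^sub>M lborel) borel (\<lambda>(x, y). Complex x y)) (box l u)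
      = emeasure (lborel \<Otimes>\<^sub>M lborel) ((\<lambda>(x, y). Complex x y) -` box l u \<inter> space (lborel \<Otimes>\<^sub>M lborel))"
    by (intro emeasure_distr) auto
  also have "(\<lambda>(x, y). Complex x y) -` box l u \<inter> space (lborel \<Otimes>\<^sub>M lborel)
      = {Re l<..<Re u} \<times> {Im l<..<Im u}"
    by (auto simp: box_def Basis_complex_def inner_complex_def space_pair_measure)
  also have "emeasure (lborel \<Otimes>\<^sub>M lborel) \<dots> = ennreal (Re u - Re l) * ennreal (Im u - Im l)"
    using le by (subst lborel.emeasure_pair_measure_Times) auto
  also have "\<dots> = (\<Prod>b\<in>Basis. (u - l) \<bullet> b)"
    using le by (simp add: Basis_complex_def inner_complex_def flip: ennreal_mult)
  finally show "emeasure (distr (lborel \<Otimes>\<^sub>M lborel) borel (\<lambda>(x, y). Complex x y)) (box l u) = \<dots>" .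
qed simp

lemma nn_integral_lborel_complex:
  fixes h :: "complex \<Rightarrow> ennreal"
  assumes [measurable]: "h \<in> borel_measurable borel"
  shows "(\<integral>\<^sup>+z. h z \<partial>lborel) = (\<integral>\<^sup>+y. \<integral>\<^sup>+x. h (Complex x y) \<partial>lborel \<partial>lborel)"
    and "(\<integral>\<^sup>+z. h z \<partial>lborel) = (\<integral>\<^sup>+x. \<integral>\<^sup>+y. h (Complex x y) \<partial>lborel \<partial>lborel)"
proof -
  have [measurable]: "(\<lambda>(x, y). Complex x y) \<in> borel_measurable (lborel \<Otimes>\<^sub>M lborel)"
    unfolding Complex_eq by measurable
  have eq: "(\<integral>\<^sup>+z. h z \<partial>lborel) = (\<integral>\<^sup>+k. h (case k of (x, y) \<Rightarrow> Complex x y) \<partial>(lborel \<Otimes>\<^sub>M lborel))"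
    by (subst lborel_complex_eq_distr, subst nn_integral_distr) auto
  show "(\<integral>\<^sup>+z. h z \<partial>lborel) = (\<integral>\<^sup>+y. \<integral>\<^sup>+x. h (Complex x y) \<partial>lborel \<partial>lborel)"
    unfolding eq by (subst lborel_pair.nn_integral_snd[symmetric]) auto
  show "(\<integral>\<^sup>+z. h z \<partial>lborel) = (\<integral>\<^sup>+x. \<integral>\<^sup>+y. h (Complex x y) \<partial>lborel \<partial>lborel)"
    unfolding eq by (subst lborel.nn_integral_fst[symmetric]) auto
qed

text \<open>With one coordinate frozen, a shear is a translation in the other; Fubini's theorem in
  the matching order does the rest.\<close>

lemma nn_integral_shear:
  fixes h :: "complex \<Rightarrow> ennreal"
  assumes [measurable]: "h \<in> borel_measurable borel"
  shows "(\<integral>\<^sup>+z. h (Complex (Re z + c * Im z) (Im z)) \<partial>lborel) = (\<integral>\<^sup>+z. h z \<partial>lborel)"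
    and "(\<integral>\<^sup>+z. h (Complex (Re z) (Im z + c * Re z)) \<partial>lborel) = (\<integral>\<^sup>+z. h z \<partial>lborel)"
proof -
  have [measurable]: "(\<lambda>z. Complex (Re z + c * Im z) (Im z)) \<in> borel_measurable borel"
    "(\<lambda>z. Complex (Re z) (Im z + c * Re z)) \<in> borel_measurable borel"
    "(\<lambda>x. Complex x y) \<in> borel_measurable borel" "(\<lambda>y. Complex x y) \<in> borel_measurable borel" for x y
    unfolding Complex_eq by measurable
  have tr: "(\<integral>\<^sup>+x. k (x + d) \<partial>lborel) = (\<integral>\<^sup>+x. k x \<partial>lborel)"
    if "k \<in> borel_measurable borel" for k :: "real \<Rightarrow> ennreal" and d :: real
    using nn_integral_real_affine[of k 1 d] that by (simp add: add.commute)
  show "(\<integral>\<^sup>+z. h (Complex (Re z + c * Im z) (Im z)) \<partial>lborel) = (\<integral>\<^sup>+z. h z \<partial>lborel)"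
    by (simp add: nn_integral_lborel_complex(1) tr[of "\<lambda>x. h (Complex x _)"])
  show "(\<integral>\<^sup>+z. h (Complex (Re z) (Im z + c * Re z)) \<partial>lborel) = (\<integral>\<^sup>+z. h z \<partial>lborel)"
    by (simp add: nn_integral_lborel_complex(2) tr[of "\<lambda>y. h (Complex _ y)"])
qed

text \<open>A rotation by an angle that is not a multiple of \<open>\<pi>\<close> is a product of three shears.\<close>

lemma nn_integral_rotation:
  fixes h :: "complex \<Rightarrow> ennreal"
  assumes [measurable]: "h \<in> borel_measurable borel" and e: "cmod e = 1"
  shows "(\<integral>\<^sup>+z. h (e * z) \<partial>lborel) = (\<integral>\<^sup>+z. h z \<partial>lborel)"
proof -
  have main: "(\<integral>\<^sup>+z. h (e * z) \<partial>lborel) = (\<integral>\<^sup>+z. h z \<partial>lborel)"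
    if [measurable]: "h \<in> borel_measurable borel" and e: "cmod e = 1" and s: "Im e \<noteq> 0" for h and e :: complex
  proof -
    \<comment> \<open>Minus the tangent of half the rotation angle, which is why \<open>Im e\<close>
      must not vanish. The half-angle identity \<open>aa\<close> makes the product of the shears
      equal to multiplication by \<open>e\<close>.\<close>
    define a where "a = (Re e - 1) / Im e"
    let ?X = "\<lambda>z. Complex (Re z + a * Im z) (Im z)" and ?Y = "\<lambda>z. Complex (Re z) (Im z + Im e * Re z)"
    have [measurable]: "?X \<in> borel_measurable borel" "?Y \<in> borel_measurable borel"
      unfolding Complex_eq by measurable
    have sq: "Re e * Re e + Im e * Im e = 1"
      using e by (simp add: cmod_def power2_eq_square)
    have as: "a * Im e = Re e - 1" using s by (simp add: a_def)
    have "a * (1 + Re e) * Im e = - Im e * Im e"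
      using as sq by algebra
    then have aa: "a * (1 + Re e) = - Im e" using s by (metis mult_minus_left mult_right_cancel)
    have "?X (?Y (?X z)) = e * z" for z
    proof (rule complex_eqI)
      have "Re (?X (?Y (?X z))) = (1 + a * Im e) * Re z + (a * (1 + (1 + a * Im e))) * Im z"
        by (simp add: algebra_simps)
      also have "\<dots> = Re (e * z)" unfolding as using aa by simp
      finally show "Re (?X (?Y (?X z))) = Re (e * z)" .
      have "Im (?X (?Y (?X z))) = Im e * Re z + (1 + a * Im e) * Im z"
        by (simp add: algebra_simps)
      also have "\<dots> = Im (e * z)" unfolding as by simp
      finally show "Im (?X (?Y (?X z))) = Im (e * z)" .
    qed
    then have "(\<integral>\<^sup>+z. h (e * z) \<partial>lborel) = (\<integral>\<^sup>+z. h (?X (?Y (?X z))) \<partial>lborel)" by simp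
    also have "\<dots> = (\<integral>\<^sup>+z. h (?X (?Y z)) \<partial>lborel)"
      by (rule nn_integral_shear(1)[of "\<lambda>z. h (?X (?Y z))"]) measurable
    also have "\<dots> = (\<integral>\<^sup>+z. h (?X z) \<partial>lborel)"
      by (rule nn_integral_shear(2)[of "\<lambda>z. h (?X z)"]) measurable
    also have "\<dots> = (\<integral>\<^sup>+z. h z \<partial>lborel)"
      by (rule nn_integral_shear(1)) measurable
    finally show ?thesis .
  qed
  show ?thesis
  proof (cases "Im e = 0")
    case True
    \<comment> \<open>A real \<open>e\<close> is 1 or -1; it splits into two rotations whose
      multipliers are not real.\<close>
    have "e = \<i> * (- \<i> * e)" by simp
    then have "(\<integral>\<^sup>+z. h (e * z) \<partial>lborel) = (\<integral>\<^sup>+z. h (\<i> * ((- \<i> * e) * z)) \<partial>lborel)"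
      by (simp only: mult.assoc[symmetric])
    also have "\<dots> = (\<integral>\<^sup>+z. h (\<i> * z) \<partial>lborel)"
      using e True by (intro main[where h = "\<lambda>z. h (\<i> * z)"]) (auto simp: norm_mult cmod_def)
    also have "\<dots> = (\<integral>\<^sup>+z. h z \<partial>lborel)"
      by (intro main) auto
    finally show ?thesis .
  qed (use main e in auto)
qed

lemma entire_compose:
  assumes "f holomorphic_on UNIV" "g holomorphic_on UNIV"
  shows "(\<lambda>z. g (f z)) holomorphic_on UNIV"
  using holomorphic_on_compose_gen[OF assms] by (simp add: o_def)

text \<open>On the circle the denominator of Cauchy's kernel is at least
  \<open>1 - cmod \<zeta>\<close>. At the centre this is the sub-mean-value property.\<close>

lemma Cauchy_circle_bound:
  assumes g: "g holomorphic_on UNIV" and \<zeta>: "cmod \<zeta> < 1"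
  shows "cmod (g \<zeta>) \<le> 1 / (1 - cmod \<zeta>) * integral {0..1} (\<lambda>t. cmod (g (exp (2 * of_real pi * \<i> * of_real t))))"
proof -
  let ?e = "\<lambda>t. exp (2 * of_real pi * \<i> * of_real t) :: complex"
  have cont: "continuous_on A g" for A
    using g holomorphic_on_imp_continuous_on continuous_on_subset by blast
  have ce: "continuous_on {0..1} (\<lambda>t. g (?e t))"
    by (rule continuous_on_compose2[OF cont[of UNIV]]) (auto intro!: continuous_intros)
  have "((\<lambda>u. g u / (u - \<zeta>)) has_contour_integral (2 * of_real pi * \<i> * g \<zeta>)) (circlepath 0 1)"
    using \<zeta> g cont by (intro Cauchy_integral_circlepath) (auto intro: holomorphic_on_subset)
  then have "((\<lambda>t. g (?e t) / (?e t - \<zeta>) * (2 * pi * \<i> * ?e t)) has_integral (2 * of_real pi * \<i> * g \<zeta>)) {0..1}"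
    unfolding has_contour_integral_def
    by (rule has_integral_eq[rotated])
      (auto simp: vector_derivative_circlepath01[of _ 0 1, unfolded circlepath, simplified] circlepath)
  then have I: "integral {0..1} (\<lambda>t. g (?e t) / (?e t - \<zeta>) * (2 * pi * \<i> * ?e t)) = 2 * of_real pi * \<i> * g \<zeta>"
    and int: "(\<lambda>t. g (?e t) / (?e t - \<zeta>) * (2 * pi * \<i> * ?e t)) integrable_on {0..1}"
    by (auto simp: integral_unique integrable_on_def)
  have ne: "cmod (?e t) = 1" for t :: real by (simp add: norm_exp_eq_Re)
  have "norm (2 * of_real pi * \<i> * g \<zeta>) \<le> integral {0..1} (\<lambda>t. 2 * pi / (1 - cmod \<zeta>) * cmod (g (?e t)))"
    unfolding I[symmetric]
  proof (rule integral_norm_bound_integral[OF int])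
    show "(\<lambda>t. 2 * pi / (1 - cmod \<zeta>) * cmod (g (?e t))) integrable_on {0..1}"
      by (intro integrable_continuous_real continuous_intros ce)
    fix t :: real assume "t \<in> {0..1}"
    have "1 - cmod \<zeta> \<le> cmod (?e t - \<zeta>)"
      using norm_triangle_ineq2[of "?e t" \<zeta>] by (simp only: ne)
    then have "cmod (g (?e t)) / cmod (?e t - \<zeta>) \<le> cmod (g (?e t)) / (1 - cmod \<zeta>)"
      using \<zeta> by (intro divide_left_mono mult_pos_pos) auto
    then have "cmod (g (?e t)) / cmod (?e t - \<zeta>) * (2 * pi) \<le> cmod (g (?e t)) / (1 - cmod \<zeta>) * (2 * pi)"
      by (rule mult_right_mono) simp
    then show "norm (g (?e t) / (?e t - \<zeta>) * (2 * pi * \<i> * ?e t)) \<le> 2 * pi / (1 - cmod \<zeta>) * cmod (g (?e t))"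
      by (simp only: norm_mult norm_divide ne) (simp add: mult.commute)
  qed
  also have "\<dots> = 2 * pi / (1 - cmod \<zeta>) * integral {0..1} (\<lambda>t. cmod (g (?e t)))"
    by simp
  finally have "2 * pi * cmod (g \<zeta>) \<le> 2 * pi * (1 / (1 - cmod \<zeta>) * integral {0..1} (\<lambda>t. cmod (g (?e t))))"
    by (simp add: norm_mult)
  then show ?thesis by (subst (asm) mult_le_cancel_left_pos) auto
qed

text \<open>Rotation invariance takes the place of polar coordinates. For every \<open>u\<close> the
  value at 0 is bounded by the mean over the circle about 0 through \<open>u\<close>. Integrating
  over \<open>u\<close> in the ball and exchanging the integrals leaves, for each angle, an integral
  over the rotated ball, which does not depend on the angle.\<close>

lemma mean_value_ball:
  assumes g: "g holomorphic_on UNIV"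
  shows "ennreal (cmod (g 0)) * emeasure lborel (ball (0::complex) \<rho>) \<le> (\<integral>\<^sup>+u\<in>ball 0 \<rho>. ennreal (cmod (g u)) \<partial>lborel)"
proof -
  let ?e = "\<lambda>t. exp (2 * of_real pi * \<i> * of_real t) :: complex"
  have ne: "cmod (?e t) = 1" for t :: real by (simp add: norm_exp_eq_Re)
  have contg: "continuous_on UNIV g" using g by (rule holomorphic_on_imp_continuous_on)
  have [measurable]: "g \<in> borel_measurable borel" by (rule borel_measurable_continuous_onI[OF contg])
  have [measurable]: "ball (0::complex) \<rho> \<in> sets borel" by simp
  have [measurable]: "?e \<in> borel_measurable borel"
    by (intro borel_measurable_continuous_onI continuous_intros)
  have pt: "ennreal (cmod (g 0)) \<le> (\<integral>\<^sup>+t\<in>{0..1}. ennreal (cmod (g (?e t * u))) \<partial>lborel)" for u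
  proof -
    have "(\<lambda>z. g (z * u)) holomorphic_on UNIV"
      by (intro entire_compose[OF _ g] holomorphic_intros)
    from Cauchy_circle_bound[OF this, of 0]
    have "cmod (g 0) \<le> integral {0..1} (\<lambda>t. cmod (g (?e t * u)))" by simp
    moreover have "continuous_on {0..1} (\<lambda>t. cmod (g (?e t * u)))"
      by (intro continuous_intros continuous_on_compose2[OF contg]) auto
    then have "((\<lambda>t. cmod (g (?e t * u))) has_integral integral {0..1} (\<lambda>t. cmod (g (?e t * u)))) {0..1}"
      by (intro integrable_integral integrable_continuous_real)
    then have "(\<integral>\<^sup>+t\<in>{0..1}. ennreal (cmod (g (?e t * u))) \<partial>lborel) = ennreal (integral {0..1} (\<lambda>t. cmod (g (?e t * u))))"
      by (intro nn_integral_has_integral_lebesgue') auto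
    ultimately show ?thesis by (simp add: ennreal_leI)
  qed
  have "ennreal (cmod (g 0)) * emeasure lborel (ball (0::complex) \<rho>) = (\<integral>\<^sup>+u. ennreal (cmod (g 0)) * indicator (ball (0::complex) \<rho>) u \<partial>lborel)"
    by (simp add: nn_integral_cmult_indicator)
  also have "\<dots> \<le> (\<integral>\<^sup>+u. (\<integral>\<^sup>+t\<in>{0..1}. ennreal (cmod (g (?e t * u))) \<partial>lborel) * indicator (ball (0::complex) \<rho>) u \<partial>lborel)"
    by (intro nn_integral_mono mult_right_mono pt) auto
  \<comment> \<open>The indicator may be evaluated at the rotated point because rotation preserves
    the modulus. Apart from the cut-off in \<open>t\<close>, the integrand is now a function of the
    rotated point alone.\<close>
  also have "\<dots> = (\<integral>\<^sup>+u. (\<integral>\<^sup>+t. ennreal (cmod (g (?e t * u))) * indicator (ball (0::complex) \<rho>) (?e t * u) * indicator {0..1} t \<partial>lborel) \<partial>lborel)"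
    by (subst nn_integral_multc[symmetric])
      (auto intro!: nn_integral_cong split: split_indicator simp: norm_mult ne)
  also have "\<dots> = (\<integral>\<^sup>+t. (\<integral>\<^sup>+u. ennreal (cmod (g (?e t * u))) * indicator (ball (0::complex) \<rho>) (?e t * u) * indicator {0..1} t \<partial>lborel) \<partial>lborel)"
  proof (rule lborel_pair.Fubini')
    have 1: "(\<lambda>k. indicator (ball 0 \<rho>) (?e (fst k) * snd k) :: ennreal) \<in> borel_measurable (borel \<Otimes>\<^sub>M borel)"
      by (rule measurable_compose[of "\<lambda>k. ?e (fst k) * snd k" _ borel]) (simp, rule borel_measurable_indicator, simp)
    have 2: "(\<lambda>k. indicator {0..1::real} (fst k) :: ennreal) \<in> borel_measurable (borel \<Otimes>\<^sub>M (borel :: complex measure))"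
      by (rule measurable_compose[of fst _ borel]) auto
    have 3: "(\<lambda>k. ennreal (cmod (g (?e (fst k) * snd k)))) \<in> borel_measurable (borel \<Otimes>\<^sub>M borel)"
      by measurable
    have 4: "borel_measurable (lborel \<Otimes>\<^sub>M lborel) = borel_measurable (borel \<Otimes>\<^sub>M borel)"
      by (intro measurable_cong_sets sets_pair_measure_cong) auto
    show "(\<lambda>(t, u). ennreal (cmod (g (?e t * u))) * indicator (ball 0 \<rho>) (?e t * u) * indicator {0..1} t)
        \<in> borel_measurable (lborel \<Otimes>\<^sub>M lborel)"
      unfolding split_beta' using 1 2 by (subst 4) (intro borel_measurable_times_ennreal 1 2 3)
  qed
  also have "\<dots> = (\<integral>\<^sup>+t. (\<integral>\<^sup>+u. ennreal (cmod (g u)) * indicator (ball (0::complex) \<rho>) u * indicator {0..1::real} t \<partial>lborel) \<partial>lborel)"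
    by (rule nn_integral_cong, rule nn_integral_rotation[where h = "\<lambda>u. ennreal (cmod (g u)) * indicator (ball (0::complex) \<rho>) u * indicator {0..1} _"])
      (simp_all add: ne borel_measurable_times_ennreal borel_measurable_indicator)
  also have "\<dots> = (\<integral>\<^sup>+t. (\<integral>\<^sup>+u\<in>ball 0 \<rho>. ennreal (cmod (g u)) \<partial>lborel) * indicator {0..1::real} t \<partial>lborel)"
    by (intro nn_integral_cong nn_integral_multc) measurable
  also have "\<dots> = (\<integral>\<^sup>+u\<in>ball 0 \<rho>. ennreal (cmod (g u)) \<partial>lborel)"
    by (subst nn_integral_cmult_indicator) auto
  finally show ?thesis .
qed

section \<open>Unit squares and Gaussian shifts\<close>

lemma square_sets [measurable, simp]: "square t z \<in> sets borel"
proof -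
  have "square t z = (Re -` {Re z - t / 2..<Re z + t / 2} \<inter> space borel) \<inter> (Im -` {Im z - t / 2..<Im z + t / 2} \<inter> space borel)"
    by (auto simp: square_def)
  also have "\<dots> \<in> sets borel" by (intro sets.Int measurable_sets[of _ borel borel]) auto
  finally show ?thesis .
qed

lemma square_sets_lebesgue [measurable, simp]: "square t z \<in> sets lebesgue"
  by (intro sets_completionI_sets) simp

lemma emeasure_lborel_rectangle:
  assumes "a \<le> b" "c \<le> d"
  shows "emeasure lborel {u. a \<le> Re u \<and> Re u < b \<and> c \<le> Im u \<and> Im u < d} = ennreal ((b - a) * (d - c))"
proof -
  let ?S = "{u. a \<le> Re u \<and> Re u < b \<and> c \<le> Im u \<and> Im u < d}"
  have "?S = (Re -` {a..<b} \<inter> space borel) \<inter> (Im -` {c..<d} \<inter> space borel)" by auto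
  also have "\<dots> \<in> sets borel" by (intro sets.Int measurable_sets[of _ borel borel]) auto
  finally have [measurable]: "?S \<in> sets borel" .
  have "emeasure lborel ?S = (\<integral>\<^sup>+z. indicator ?S z \<partial>lborel)" by simp
  also have "\<dots> = (\<integral>\<^sup>+y. \<integral>\<^sup>+x. indicator ?S (Complex x y) \<partial>lborel \<partial>lborel)"
    by (rule nn_integral_lborel_complex) measurable
  also have "\<dots> = (\<integral>\<^sup>+y. \<integral>\<^sup>+x. indicator {c..<d} y * indicator {a..<b} x \<partial>lborel \<partial>lborel)"
    by (intro nn_integral_cong) (auto split: split_indicator)
  also have "\<dots> = ennreal ((b - a) * (d - c))"
    using assms by (simp add: nn_integral_cmult nn_integral_multc mult.commute flip: ennreal_mult)
  finally show ?thesis .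
qed

lemma emeasure_square: "t \<ge> 0 \<Longrightarrow> emeasure lborel (square t z) = ennreal (t\<^sup>2)"
  using emeasure_lborel_rectangle[of "Re z - t / 2" "Re z + t / 2" "Im z - t / 2" "Im z + t / 2"]
  by (simp add: square_def power2_eq_square)

text \<open>Each coordinate interval keeps at least half a side of overlap. This common part is what
  links the masses of neighbouring squares.\<close>

lemma emeasure_square_Int:
  assumes "t > 0" "\<bar>Re z - Re z'\<bar> \<le> t / 2" "\<bar>Im z - Im z'\<bar> \<le> t / 2"
  shows "emeasure lborel (square t z \<inter> square t z') \<ge> ennreal (t\<^sup>2 / 4)"
proof -
  let ?a = "max (Re z) (Re z') - t / 2" and ?b = "min (Re z) (Re z') + t / 2"
  let ?c = "max (Im z) (Im z') - t / 2" and ?d = "min (Im z) (Im z') + t / 2"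
  have eq: "square t z \<inter> square t z' = {u. ?a \<le> Re u \<and> Re u < ?b \<and> ?c \<le> Im u \<and> Im u < ?d}"
    by (auto simp: square_def)
  have "t / 2 \<le> ?b - ?a" "t / 2 \<le> ?d - ?c" using assms by (auto simp: max_def min_def)
  then have "t / 2 * (t / 2) \<le> (?b - ?a) * (?d - ?c)" using assms by (intro mult_mono) auto
  then show ?thesis unfolding eq using assms
    by (subst emeasure_lborel_rectangle) (auto simp: power2_eq_square max_def min_def intro!: ennreal_leI)
qed

text \<open>Half the diagonal. Being strictly below 1, it keeps the square inside the circle on
  which Cauchy's formula is used.\<close>

lemma square_dist:
  assumes "u \<in> square 1 \<nu>"
  shows "cmod (u - \<nu>) \<le> sqrt (1 / 2)"
proof -
  have "\<bar>Re (u - \<nu>)\<bar> \<le> 1 / 2" "\<bar>Im (u - \<nu>)\<bar> \<le> 1 / 2"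
    using assms unfolding square_def abs_le_iff by (auto simp: field_simps)
  then have "(Re (u - \<nu>))\<^sup>2 \<le> (1 / 2)\<^sup>2" "(Im (u - \<nu>))\<^sup>2 \<le> (1 / 2)\<^sup>2"
    by (metis abs_ge_zero power2_abs power_mono)+
  then show ?thesis by (auto simp: cmod_def power2_eq_square intro!: real_sqrt_le_mono)
qed

lemma square_dist_less_1: "u \<in> square 1 \<nu> \<Longrightarrow> cmod (u - \<nu>) < 1"
  by (drule square_dist) (simp add: real_sqrt_divide order_le_less_trans)

lemma ball_subset_square: "ball z (t / 2) \<subseteq> square t z"
proof
  fix u assume "u \<in> ball z (t / 2)"
  then have "cmod (u - z) < t / 2" by (simp add: dist_norm norm_minus_commute)
  then show "u \<in> square t z"
    using abs_Re_le_cmod[of "u - z"] abs_Im_le_cmod[of "u - z"] by (auto simp: square_def)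
qed

lemma lattice_countable: "countable lattice"
proof -
  have "lattice \<subseteq> (\<lambda>(m, n). Complex (real_of_int m) (real_of_int n)) ` UNIV"
  proof
    fix \<nu> assume "\<nu> \<in> lattice"
    then obtain m n where "Re \<nu> = real_of_int m" "Im \<nu> = real_of_int n"
      by (auto simp: lattice_def elim!: Ints_cases)
    then have "\<nu> = (\<lambda>(m, n). Complex (real_of_int m) (real_of_int n)) (m, n)" by (simp add: complex_eq_iff)
    then show "\<nu> \<in> (\<lambda>(m, n). Complex (real_of_int m) (real_of_int n)) ` UNIV" by blast
  qed
  then show ?thesis by (rule countable_subset) (rule countable_image[OF countableI_type])
qed

lemma lattice_square_unique:
  assumes "\<nu> \<in> lattice" "\<nu>' \<in> lattice" "u \<in> square 1 \<nu>" "u \<in> square 1 \<nu>'"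
  shows "\<nu> = \<nu>'"
proof (rule complex_eqI)
  \<comment> \<open>Half-openness is essential: two integers whose intervals share \<open>x\<close>
    differ by strictly less than 1.\<close>
  have *: "a = b" if ab: "a \<in> \<int>" "b \<in> \<int>" "a - 1 / 2 \<le> x" "x < a + 1 / 2" "b - 1 / 2 \<le> x" "x < b + 1 / 2" for a b x :: real
  proof -
    obtain m where "a = real_of_int m" using ab(1) by (auto simp: Ints_def)
    moreover obtain n where "b = real_of_int n" using ab(2) by (auto simp: Ints_def)
    moreover from calculation have "real_of_int (m - n) < 1" "real_of_int (n - m) < 1" using ab(3-6) by linarith+
    then have "m = n" by linarith
    ultimately show ?thesis by simp
  qed
  show "Re \<nu> = Re \<nu>'" using assms by (intro *[of _ _ "Re u"]) (auto simp: lattice_def square_def)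
  show "Im \<nu> = Im \<nu>'" using assms by (intro *[of _ _ "Im u"]) (auto simp: lattice_def square_def)
qed

lemma sum_indicator_square:
  fixes g :: "complex \<Rightarrow> 'a::semiring_1"
  assumes "finite F" "F \<subseteq> lattice" "\<nu> \<in> F" "u \<in> square 1 \<nu>"
  shows "(\<Sum>\<kappa>\<in>F. g \<kappa> * indicator (square 1 \<kappa>) u) = g \<nu>"
proof -
  have "(\<Sum>\<kappa>\<in>F. g \<kappa> * indicator (square 1 \<kappa>) u) = (\<Sum>\<kappa>\<in>{\<nu>}. g \<kappa> * indicator (square 1 \<kappa>) u)"
  proof (rule sum.mono_neutral_right)
    show "\<forall>\<kappa>\<in>F - {\<nu>}. g \<kappa> * indicator (square 1 \<kappa>) u = 0"
      using lattice_square_unique assms by (auto split: split_indicator)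
  qed (use assms in auto)
  then show ?thesis using assms by simp
qed

lemma lattice_square_exists: "\<exists>\<nu>\<in>lattice. u \<in> square 1 \<nu>"
proof
  \<comment> \<open>Rounding halves upwards matches the closed lower and open upper sides of the
    square.\<close>
  let ?\<nu> = "Complex (of_int \<lfloor>Re u + 1 / 2\<rfloor>) (of_int \<lfloor>Im u + 1 / 2\<rfloor>)"
  show "?\<nu> \<in> lattice" by (simp add: lattice_def)
  show "u \<in> square 1 ?\<nu>" unfolding square_def by (auto; linarith)
qed

text \<open>Countable sum and integral are exchanged by monotone convergence. The measure is
  arbitrary because both Lebesgue measure and \<open>\<mu>\<close> are decomposed in this
  way.\<close>

lemma nn_integral_lattice:
  fixes M :: "complex measure" and h :: "complex \<Rightarrow> ennreal"
  assumes [measurable]: "h \<in> borel_measurable M" and Q: "\<And>\<nu>. square 1 \<nu> \<in> sets M"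
  shows "(\<integral>\<^sup>+u. h u \<partial>M) = (\<integral>\<^sup>+\<nu>. (\<integral>\<^sup>+u\<in>square 1 \<nu>. h u \<partial>M) \<partial>count_space lattice)"
proof -
  have "(\<integral>\<^sup>+\<nu>. h u * indicator (square 1 \<nu>) u \<partial>count_space lattice) = h u" for u
  proof -
    obtain \<nu> where \<nu>: "\<nu> \<in> lattice" "u \<in> square 1 \<nu>" using lattice_square_exists by blast
    have "(\<integral>\<^sup>+\<nu>'. h u * indicator (square 1 \<nu>') u \<partial>count_space lattice)
        = (\<Sum>\<nu>'\<in>{\<nu>}. h u * indicator (square 1 \<nu>') u)"
    proof (rule nn_integral_count_space')
      fix \<nu>' assume "\<nu>' \<in> lattice" "\<nu>' \<notin> {\<nu>}"
      then have "u \<notin> square 1 \<nu>'" using lattice_square_unique \<nu> by blast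
      then show "h u * indicator (square 1 \<nu>') u = 0" by simp
    qed (use \<nu> in auto)
    then show ?thesis using \<nu> by simp
  qed
  then have "(\<integral>\<^sup>+u. h u \<partial>M) = (\<integral>\<^sup>+u. (\<integral>\<^sup>+\<nu>. h u * indicator (square 1 \<nu>) u \<partial>count_space lattice) \<partial>M)"
    by simp
  also have "\<dots> = (\<integral>\<^sup>+\<nu>. (\<integral>\<^sup>+u\<in>square 1 \<nu>. h u \<partial>M) \<partial>count_space lattice)"
    using Q by (intro nn_integral_count_space_nn_integral lattice_countable) auto
  finally show ?thesis .
qed

lemma nn_integral_count_space_le:
  assumes A: "countable A" and le: "\<And>F. finite F \<Longrightarrow> F \<subseteq> A \<Longrightarrow> (\<Sum>x\<in>F. f x) \<le> (c::ennreal)"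
  shows "(\<integral>\<^sup>+x. f x \<partial>count_space A) \<le> c"
proof (cases "finite A")
  case True
  then show ?thesis using le[of A] by (simp add: nn_integral_count_space_finite)
next
  case False
  have bij: "bij_betw (from_nat_into A) UNIV A" using A False by (rule bij_betw_from_nat_into)
  have "(\<integral>\<^sup>+x. f x \<partial>count_space A) = (\<integral>\<^sup>+n. f (from_nat_into A n) \<partial>count_space UNIV)"
    by (rule nn_integral_bij_count_space[symmetric, OF bij])
  also have "\<dots> = (\<Sum>n. f (from_nat_into A n))" by (rule nn_integral_count_space_nat)
  also have "\<dots> \<le> c"
  proof (rule suminf_le_const)
    fix n
    have inj: "inj_on (from_nat_into A) {..<n}" using bij by (auto simp: bij_betw_def intro: inj_on_subset)
    have "(\<Sum>i<n. f (from_nat_into A i)) = (\<Sum>x\<in>from_nat_into A ` {..<n}. f x)"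
      using inj by (simp add: sum.reindex)
    also have "\<dots> \<le> c" using bij by (intro le) (auto simp: bij_betw_def)
    finally show "(\<Sum>i<n. f (from_nat_into A i)) \<le> c" .
  qed auto
  finally show ?thesis .
qed

lemma sum_le_nn_integral_count_space:
  fixes f :: "'a \<Rightarrow> ennreal"
  assumes "finite F" "F \<subseteq> A"
  shows "(\<Sum>x\<in>F. f x) \<le> (\<integral>\<^sup>+x. f x \<partial>count_space A)"
proof -
  have "(\<Sum>x\<in>F. f x) = (\<integral>\<^sup>+x. f x * indicator F x \<partial>count_space A)"
    using assms by (subst nn_integral_count_space'[of F]) (auto intro!: sum.cong split: split_indicator)
  also have "\<dots> \<le> (\<integral>\<^sup>+x. f x \<partial>count_space A)"
    by (intro nn_integral_mono) (auto split: split_indicator)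
  finally show ?thesis .
qed

lemma sigma_finite_lebesgue: "sigma_finite_measure (lebesgue :: 'a::euclidean_space measure)"
proof
  obtain A :: "'a set set" where A: "countable A" "A \<subseteq> sets lborel" "\<Union>A = space lborel" "\<forall>a\<in>A. emeasure lborel a \<noteq> \<infinity>"
    using lborel.sigma_finite_countable by blast
  then show "\<exists>A. countable A \<and> A \<subseteq> sets (lebesgue :: 'a measure) \<and> \<Union>A = space lebesgue \<and> (\<forall>a\<in>A. emeasure lebesgue a \<noteq> \<infinity>)"
    by (intro exI[of _ A]) (auto simp: subset_eq)
qed

section \<open>Gaussian modulus, Weyl shifts and local estimates\<close>

definition gauss_abs :: "real \<Rightarrow> (complex \<Rightarrow> complex) \<Rightarrow> complex \<Rightarrow> real" where
  "gauss_abs \<alpha> f z = cmod (f z) * exp (- (\<alpha> / 2) * (cmod z)\<^sup>2)"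

text \<open>The exponential factor is entire in \<zeta> and cancels the cross term of
  \<open>(cmod (\<nu> + \<zeta>))\<^sup>2\<close>, so recentring keeps \<open>f\<close> entire while
  its Gaussian modulus is merely translated.\<close>

definition gauss_shift :: "real \<Rightarrow> (complex \<Rightarrow> complex) \<Rightarrow> complex \<Rightarrow> complex \<Rightarrow> complex" where
  "gauss_shift \<alpha> f \<nu> \<zeta> = f (\<nu> + \<zeta>) * exp (- (of_real \<alpha> * cnj \<nu> * \<zeta>) - of_real (\<alpha> / 2 * (cmod \<nu>)\<^sup>2))"

lemma gauss_abs_nonneg [simp]: "0 \<le> gauss_abs \<alpha> f z"
  by (simp add: gauss_abs_def)

lemma gauss_abs_powr: "gauss_abs \<alpha> f z powr p = cmod (f z) powr p * exp (- (p * \<alpha> / 2) * (cmod z)\<^sup>2)"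
  by (simp add: gauss_abs_def powr_mult powr_def[of "exp _"] mult_ac)

lemma cmod_add_squared: "(cmod (a + b))\<^sup>2 = (cmod a)\<^sup>2 + (cmod b)\<^sup>2 + 2 * Re (cnj a * b)"
  by (simp add: cmod_power2 algebra_simps power2_sum)

lemma norm_gauss_shift:
  "cmod (gauss_shift \<alpha> f \<nu> \<zeta>) = gauss_abs \<alpha> f (\<nu> + \<zeta>) * exp (\<alpha> / 2 * (cmod \<zeta>)\<^sup>2)"
proof -
  have "Re (- (of_real \<alpha> * cnj \<nu> * \<zeta>) - of_real (\<alpha> / 2 * (cmod \<nu>)\<^sup>2))
      = - (\<alpha> / 2) * (cmod (\<nu> + \<zeta>))\<^sup>2 + \<alpha> / 2 * (cmod \<zeta>)\<^sup>2"
    unfolding cmod_add_squared by (simp add: algebra_simps)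
  then show ?thesis
    unfolding gauss_shift_def gauss_abs_def norm_mult norm_exp_eq_Re exp_add[symmetric] mult.assoc by simp
qed

lemma gauss_shift_holomorphic:
  assumes "f holomorphic_on UNIV"
  shows "gauss_shift \<alpha> f \<nu> holomorphic_on UNIV"
  unfolding gauss_shift_def[abs_def]
  by (intro holomorphic_intros entire_compose[OF _ assms])

lemma gauss_abs_measurable:
  assumes "f holomorphic_on UNIV"
  shows "gauss_abs \<alpha> f \<in> borel_measurable borel"
  unfolding gauss_abs_def[abs_def]
  by (intro borel_measurable_continuous_onI continuous_intros holomorphic_on_imp_continuous_on assms)

lemma nn_integral_lborel_shift:
  fixes h :: "complex \<Rightarrow> ennreal"
  assumes [measurable]: "h \<in> borel_measurable borel"
  shows "(\<integral>\<^sup>+u. h (z + u) \<partial>lborel) = (\<integral>\<^sup>+u. h u \<partial>lborel)"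
proof -
  have "(\<integral>\<^sup>+u. h u \<partial>lborel) = (\<integral>\<^sup>+u. h u \<partial>distr lborel borel ((+) z))"
    by (simp add: lborel_distr_plus)
  also have "\<dots> = (\<integral>\<^sup>+u. h (z + u) \<partial>lborel)" by (intro nn_integral_distr) auto
  finally show ?thesis ..
qed

text \<open>The Gaussian modulus has no mean value inequality of its own. The recentred entire
  function has one, and on the disc its modulus exceeds the translated Gaussian modulus by at most
  the factor \<open>exp (\<alpha> / 2 * \<rho>\<^sup>2)\<close>.\<close>

lemma gauss_abs_local:
  assumes f: "f holomorphic_on UNIV" and "\<alpha> > 0"
  shows "ennreal (gauss_abs \<alpha> f z) * emeasure lborel (ball (0::complex) \<rho>)
    \<le> ennreal (exp (\<alpha> / 2 * \<rho>\<^sup>2)) * (\<integral>\<^sup>+u\<in>ball z \<rho>. ennreal (gauss_abs \<alpha> f u) \<partial>lborel)"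
proof -
  note [measurable] = gauss_abs_measurable[OF f]
  have [measurable]: "ball z \<rho> \<in> sets borel" by simp
  have "ennreal (gauss_abs \<alpha> f z) * emeasure lborel (ball (0::complex) \<rho>)
      = ennreal (cmod (gauss_shift \<alpha> f z 0)) * emeasure lborel (ball (0::complex) \<rho>)"
    by (simp add: norm_gauss_shift)
  also have "\<dots> \<le> (\<integral>\<^sup>+u\<in>ball 0 \<rho>. ennreal (cmod (gauss_shift \<alpha> f z u)) \<partial>lborel)"
    by (intro mean_value_ball gauss_shift_holomorphic f)
  also have "\<dots> \<le> (\<integral>\<^sup>+u. ennreal (exp (\<alpha> / 2 * \<rho>\<^sup>2)) * (ennreal (gauss_abs \<alpha> f (z + u)) * indicator (ball z \<rho>) (z + u)) \<partial>lborel)"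
  proof (intro nn_integral_mono)
    fix u :: complex
    have "gauss_abs \<alpha> f (z + u) * exp (\<alpha> / 2 * (cmod u)\<^sup>2) \<le> gauss_abs \<alpha> f (z + u) * exp (\<alpha> / 2 * \<rho>\<^sup>2)" if "cmod u < \<rho>"
      using that \<open>\<alpha> > 0\<close> by (intro mult_left_mono) (auto intro!: mult_left_mono power_mono)
    then show "ennreal (cmod (gauss_shift \<alpha> f z u)) * indicator (ball 0 \<rho>) u
        \<le> ennreal (exp (\<alpha> / 2 * \<rho>\<^sup>2)) * (ennreal (gauss_abs \<alpha> f (z + u)) * indicator (ball z \<rho>) (z + u))"
      by (auto simp: norm_gauss_shift dist_norm mult.commute simp flip: ennreal_mult split: split_indicator intro!: ennreal_leI)
  qed
  also have "\<dots> = (\<integral>\<^sup>+u. ennreal (exp (\<alpha> / 2 * \<rho>\<^sup>2)) * (ennreal (gauss_abs \<alpha> f u) * indicator (ball z \<rho>) u) \<partial>lborel)"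
    by (rule nn_integral_lborel_shift[where h = "\<lambda>u. ennreal (exp (\<alpha> / 2 * \<rho>\<^sup>2)) * (ennreal (gauss_abs \<alpha> f u) * indicator (ball z \<rho>) u)"]) measurable
  also have "\<dots> = ennreal (exp (\<alpha> / 2 * \<rho>\<^sup>2)) * (\<integral>\<^sup>+u\<in>ball z \<rho>. ennreal (gauss_abs \<alpha> f u) \<partial>lborel)"
    by (intro nn_integral_cmult) measurable
  finally show ?thesis .
qed

lemma emeasure_ball_complex:
  fixes z :: complex
  assumes "\<rho> > 0"
  shows "emeasure lborel (ball z \<rho>) = ennreal (measure lborel (ball (0::complex) \<rho>))"
proof -
  have "emeasure lborel (ball z \<rho>) = ennreal (measure lborel (ball z \<rho>))"
    by (intro emeasure_eq_ennreal_measure) (use emeasure_lborel_ball_finite[of z \<rho>] in auto)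
  also have "measure lborel (ball z \<rho>) = measure lborel (ball (0::complex) \<rho>)"
    using assms by (simp add: content_ball)
  finally show ?thesis .
qed

definition local_const :: "real \<Rightarrow> real \<Rightarrow> real \<Rightarrow> real" where
  "local_const \<alpha> p \<rho> = (exp (\<alpha> / 2 * \<rho>\<^sup>2) / measure lborel (ball (0::complex) \<rho>)) powr p"

lemma local_const_pos: "\<rho> > 0 \<Longrightarrow> local_const \<alpha> p \<rho> > 0"
  using content_ball_pos[of \<rho> "0::complex"] by (simp add: local_const_def)

text \<open>Hoelder's inequality with exponents p and p/(p-1) inserts the weight into the unweighted
  estimate, at the price of the dual mass \<open>Y\<close>. It stays a parameter: for the given
  weight its bound comes from the restricted A_p condition, for the averaged weight from near
  constancy on discs.\<close>

lemma gauss_abs_local_weighted: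
  fixes v :: "complex \<Rightarrow> real"
  assumes "\<alpha> > 0" "1 < p" "\<rho> > 0"
    and f: "f holomorphic_on UNIV" and v[measurable]: "v \<in> borel_measurable lebesgue" and v0: "\<And>u. 0 \<le> v u"
    and vpos: "AE u in lebesgue. 0 < v u" and Y: "Y > 0"
    and vY: "(\<integral>\<^sup>+u\<in>ball z \<rho>. ennreal (v u powr (- (1 / (p - 1)))) \<partial>lebesgue) \<le> ennreal Y"
  shows "ennreal (gauss_abs \<alpha> f z powr p) \<le>
    ennreal (local_const \<alpha> p \<rho> * Y powr (p - 1)) * (\<integral>\<^sup>+u\<in>ball z \<rho>. ennreal (gauss_abs \<alpha> f u powr p * v u) \<partial>lebesgue)"
proof -
  define A where "A = measure lborel (ball (0::complex) \<rho>)"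
  have A: "A > 0" "\<And>z::complex. emeasure lborel (ball z \<rho>) = ennreal A"
    using \<open>\<rho> > 0\<close> by (simp_all add: A_def content_ball_pos emeasure_ball_complex)
  define K where "K = local_const \<alpha> p \<rho>"
  have K: "K > 0" using local_const_pos[OF \<open>\<rho> > 0\<close>] by (simp add: K_def)
  have [measurable]: "gauss_abs \<alpha> f \<in> borel_measurable lebesgue"
    using gauss_abs_measurable[OF f] by (simp add: measurable_completion)
  have [measurable]: "ball z \<rho> \<in> sets lebesgue" by simp
  let ?I = "set_nn_integral lebesgue (ball z \<rho>) (\<lambda>u. ennreal (gauss_abs \<alpha> f u powr p * v u))"
  have "ennreal (gauss_abs \<alpha> f z powr p) \<le> ennreal (K * Y powr (p - 1)) * ?I"
  proof (cases "?I = \<infinity>")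
    case True
    have "K * Y powr (p - 1) > 0" using K Y by simp
    then have "ennreal (K * Y powr (p - 1)) \<noteq> 0" by (simp add: ennreal_eq_0_iff)
    then show ?thesis unfolding True by (simp add: ennreal_mult_top)
  next
    case False
    then obtain X where X: "?I = ennreal X" "X \<ge> 0" by (cases ?I) auto
    let ?F = "\<lambda>u. gauss_abs \<alpha> f u powr p * v u * (indicator (ball z \<rho>) u :: real)"
    let ?G = "\<lambda>u. v u powr (- (1 / (p - 1))) * (indicator (ball z \<rho>) u :: real)"
    have "(\<integral>\<^sup>+u\<in>ball z \<rho>. ennreal (gauss_abs \<alpha> f u) \<partial>lebesgue)
        = (\<integral>\<^sup>+u. ennreal (?F u powr (1 / p) * ?G u powr (1 - 1 / p)) \<partial>lebesgue)"
    proof (rule nn_integral_cong_AE, use vpos in eventually_elim)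
      case (elim u)
      have "(v u powr (- (1 / (p - 1)))) powr (1 - 1 / p) = v u powr (- (1 / p))"
        using \<open>1 < p\<close> by (simp add: powr_powr field_simps)
      then have "(gauss_abs \<alpha> f u powr p * v u) powr (1 / p) * (v u powr (- (1 / (p - 1)))) powr (1 - 1 / p) = gauss_abs \<alpha> f u"
        using elim \<open>1 < p\<close> by (simp add: powr_mult powr_powr powr_minus)
      then show ?case by (auto split: split_indicator)
    qed
    also have "\<dots> \<le> ennreal (X powr (1 / p) * Y powr (1 - 1 / p))"
    proof (rule nn_integral_Hoelder)
      show "(\<integral>\<^sup>+u. ennreal (?F u) \<partial>lebesgue) \<le> ennreal X"
        unfolding X(1)[symmetric] by (intro nn_integral_mono) (auto split: split_indicator)
      show "(\<integral>\<^sup>+u. ennreal (?G u) \<partial>lebesgue) \<le> ennreal Y"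
        by (rule order_trans[OF _ vY], intro nn_integral_mono) (auto split: split_indicator)
    qed (use v0 X Y \<open>1 < p\<close> in auto)
    finally have L1: "(\<integral>\<^sup>+u\<in>ball z \<rho>. ennreal (gauss_abs \<alpha> f u) \<partial>lborel) \<le> ennreal (X powr (1 / p) * Y powr (1 - 1 / p))"
      by (simp add: nn_integral_completion)
    have "ennreal (gauss_abs \<alpha> f z * A) = ennreal (gauss_abs \<alpha> f z) * emeasure lborel (ball (0::complex) \<rho>)"
      using A by (simp add: ennreal_mult)
    also have "\<dots> \<le> ennreal (exp (\<alpha> / 2 * \<rho>\<^sup>2)) * ennreal (X powr (1 / p) * Y powr (1 - 1 / p))"
      by (rule order_trans[OF gauss_abs_local[OF f \<open>\<alpha> > 0\<close>] mult_left_mono[OF L1]]) simp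
    finally have "gauss_abs \<alpha> f z * A \<le> exp (\<alpha> / 2 * \<rho>\<^sup>2) * (X powr (1 / p) * Y powr (1 - 1 / p))"
      by (simp flip: ennreal_mult)
    then have "gauss_abs \<alpha> f z \<le> exp (\<alpha> / 2 * \<rho>\<^sup>2) / A * (X powr (1 / p) * Y powr (1 - 1 / p))"
      using A by (simp add: field_simps)
    then have "gauss_abs \<alpha> f z powr p \<le> (exp (\<alpha> / 2 * \<rho>\<^sup>2) / A * (X powr (1 / p) * Y powr (1 - 1 / p))) powr p"
      using \<open>1 < p\<close> by (intro powr_mono2) auto
    also have "\<dots> = K * ((X powr (1 / p)) powr p * (Y powr (1 - 1 / p)) powr p)"
      unfolding K_def local_const_def A_def[symmetric] using A by (subst powr_mult) (auto simp: powr_mult)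
    also have "(X powr (1 / p)) powr p = X" using \<open>1 < p\<close> X by (simp add: powr_powr)
    also have "(Y powr (1 - 1 / p)) powr p = Y powr (p - 1)" using \<open>1 < p\<close> by (simp add: powr_powr left_diff_distrib)
    finally have "ennreal (gauss_abs \<alpha> f z powr p) \<le> ennreal (K * Y powr (p - 1) * X)"
      by (intro ennreal_leI) (simp add: mult_ac)
    also have "\<dots> = ennreal (K * Y powr (p - 1)) * ?I" using K X by (simp add: ennreal_mult)
    finally show ?thesis .
  qed
  then show ?thesis by (simp add: K_def)
qed

section \<open>Restricted weights\<close>

lemma square_mono: "s \<le> t \<Longrightarrow> square s z \<subseteq> square t z"
  by (auto simp: square_def)

lemma square_subset_cball: "square t z \<subseteq> cball z t"
proof
  fix u assume "u \<in> square t z"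
  then have "\<bar>Re (u - z)\<bar> \<le> t / 2" "\<bar>Im (u - z)\<bar> \<le> t / 2"
    unfolding square_def abs_le_iff by (auto simp: field_simps)
  then have "cmod (u - z) \<le> t" using cmod_le[of "u - z"] by linarith
  then show "u \<in> cball z t" by (simp add: dist_norm norm_minus_commute)
qed

lemma weight_measurable:
  assumes "weight w"
  shows "w \<in> borel_measurable lebesgue"
proof (rule borel_measurable_LIMSEQ_real)
  show "(\<lambda>u. indicator (cball 0 (real n)) u *\<^sub>R w u) \<in> borel_measurable lebesgue" for n
    using assms unfolding weight_def set_integrable_def by (intro borel_measurable_integrable) auto
  fix u :: complex
  obtain N where "cmod u \<le> real N" using real_arch_simple by blast
  then have "eventually (\<lambda>n. indicator (cball 0 (real n)) u *\<^sub>R w u = w u) sequentially"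
    by (intro eventually_sequentiallyI[of N]) (auto simp: indicator_def)
  then show "(\<lambda>n. indicator (cball 0 (real n)) u *\<^sub>R w u) \<longlonglongrightarrow> w u"
    by (rule tendsto_eventually)
qed

lemma weight_integrable_square:
  assumes "weight w"
  shows "set_integrable lebesgue (square t z) w"
proof (rule set_integrable_subset)
  show "set_integrable lebesgue (cball z t) w" using assms by (auto simp: weight_def)
qed (auto simp: square_subset_cball)

lemma weight_nn_integral_square:
  assumes "weight w"
  shows "(\<integral>\<^sup>+u\<in>square t z. ennreal (w u) \<partial>lebesgue) = ennreal (weight_mass w (square t z))"
proof -
  have w0: "0 \<le> w u" for u using assms by (auto simp: weight_def)
  have "(\<integral>\<^sup>+u\<in>square t z. ennreal (w u) \<partial>lebesgue) = (\<integral>\<^sup>+u. ennreal (indicator (square t z) u *\<^sub>R w u) \<partial>lebesgue)"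
    by (intro nn_integral_cong) (auto split: split_indicator)
  also have "\<dots> = ennreal (\<integral>u. indicator (square t z) u *\<^sub>R w u \<partial>lebesgue)"
    using weight_integrable_square[OF assms] w0 unfolding set_integrable_def
    by (intro nn_integral_eq_integral) auto
  finally show ?thesis by (simp add: weight_mass_def set_lebesgue_integral_def)
qed

lemma weight_mass_nonneg: "weight w \<Longrightarrow> 0 \<le> weight_mass w E"
  unfolding weight_mass_def set_lebesgue_integral_def weight_def
  by (intro integral_nonneg_AE) auto

lemma weight_hat_measurable:
  assumes "weight w"
  shows "weight_hat w \<in> borel_measurable borel"
proof -
  note [measurable] = weight_measurable[OF assms]
  have "weight_hat w = (\<lambda>z. \<integral>u. indicator (square 1 z) u *\<^sub>R w u \<partial>lebesgue)"
    by (simp add: weight_hat_def weight_mass_def set_lebesgue_integral_def fun_eq_iff)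
  also have "\<dots> \<in> borel_measurable borel"
  proof (rule sigma_finite_measure.borel_measurable_lebesgue_integral[OF sigma_finite_lebesgue])
    have [measurable]: "Re \<in> borel_measurable lebesgue" "Im \<in> borel_measurable lebesgue"
      by (simp_all add: measurable_completion)
    \<comment> \<open>In coordinates, membership of \<open>u\<close> in the square at
      \<open>z\<close> is visibly a jointly measurable condition.\<close>
    have "(\<lambda>(z, u). indicator (square 1 z) u *\<^sub>R w u)
      = (\<lambda>k. (if Re (fst k) - 1 / 2 \<le> Re (snd k) \<and> Re (snd k) < Re (fst k) + 1 / 2 \<and>
                 Im (fst k) - 1 / 2 \<le> Im (snd k) \<and> Im (snd k) < Im (fst k) + 1 / 2 then w (snd k) else 0))"
      by (auto simp: fun_eq_iff square_def)
    also have "\<dots> \<in> borel_measurable (borel \<Otimes>\<^sub>M lebesgue)" by measurable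
    finally show "(\<lambda>(z, u). indicator (square 1 z) u *\<^sub>R w u) \<in> borel_measurable (borel \<Otimes>\<^sub>M lebesgue)" .
  qed
  finally show ?thesis .
qed

lemma set_nn_integral_pos:
  fixes v :: "'a \<Rightarrow> real"
  assumes [measurable]: "v \<in> borel_measurable M" "A \<in> sets M" and v: "AE u in M. 0 < v u" and A: "emeasure M A \<noteq> 0"
  shows "0 < (\<integral>\<^sup>+u\<in>A. ennreal (v u) \<partial>M)"
proof (rule ccontr)
  assume "\<not> ?thesis"
  then have "(\<integral>\<^sup>+u\<in>A. ennreal (v u) \<partial>M) = 0" by simp
  then have "AE u in M. ennreal (v u) * indicator A u = 0" by (subst (asm) nn_integral_0_iff_AE) auto
  with v have "AE u in M. u \<notin> A" by eventually_elim (auto simp: ennreal_eq_0_iff split: split_indicator_asm)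
  then have "A \<in> null_sets M" using AE_iff_null_sets[of A M] by simp
  then show False using A by auto
qed

text \<open>The area factors depend only on the scale and are absorbed into \<open>K\<close>, which
  leaves a bound on a product of masses. Shrinking the scale to at most 1 decreases both masses; it
  makes the square fit into the unit square and its inscribed disc into the unit disc of the local
  estimate.\<close>

lemma Ap_restricted_small_scale:
  assumes p: "1 < p" and w: "Ap_restricted p w"
  obtains t K m \<sigma> where "0 < t" "t \<le> 1" "0 < K"
    "\<And>z. (\<integral>\<^sup>+u\<in>square t z. ennreal (w u) \<partial>lebesgue) = ennreal (m z)" "\<And>z. 0 < m z"
    "\<And>z. (\<integral>\<^sup>+u\<in>square t z. ennreal (w u powr (- (1 / (p - 1)))) \<partial>lebesgue) = ennreal (\<sigma> z)" "\<And>z. 0 < \<sigma> z"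
    "\<And>z. m z * \<sigma> z powr (p - 1) \<le> K"
proof -
  have weight: "weight w" and wpos: "AE z in lebesgue. 0 < w z" using w by (auto simp: Ap_restricted_def)
  note [measurable] = weight_measurable[OF weight]
  have ce: "p / conj_exponent p = p - 1" "conj_exponent p / p = 1 / (p - 1)"
    using p by (auto simp: conj_exponent_def)
  let ?W = "\<lambda>t z. \<integral>\<^sup>+u\<in>square t z. ennreal (w u) \<partial>lebesgue"
  let ?S = "\<lambda>t z. \<integral>\<^sup>+u\<in>square t z. ennreal (w u powr (- (1 / (p - 1)))) \<partial>lebesgue"
  obtain T where T: "T > 0" and sup: "(SUP z. average w (square T z) *
      enn_powr (average (\<lambda>u. w u powr (- (1 / (p - 1)))) (square T z)) (p - 1)) < \<infinity>"
    using w unfolding Ap_restricted_def ce by blast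
  define g where "g z = average w (square T z) *
      enn_powr (average (\<lambda>u. w u powr (- (1 / (p - 1)))) (square T z)) (p - 1)" for z
  have "(SUP z. g z) \<noteq> \<infinity>" using less_imp_neq[OF sup] unfolding g_def .
  then obtain B where B: "B \<ge> 0" and SB: "(SUP z. g z) = ennreal B" by (cases "SUP z. g z") auto
  have leB: "average w (square T z) *
      enn_powr (average (\<lambda>u. w u powr (- (1 / (p - 1)))) (square T z)) (p - 1) \<le> ennreal B" for z
    unfolding SB[symmetric] g_def[symmetric] by (intro SUP_upper) simp
  have WT: "?W T z = ennreal (weight_mass w (square T z))" for z by (rule weight_nn_integral_square[OF weight])
  have Wpos: "?W t z > 0" if "t > 0" for t z
    using that wpos by (intro set_nn_integral_pos) (auto simp: emeasure_square ennreal_eq_0_iff)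
  have Spos: "?S t z > 0" if "t > 0" for t z
    using that wpos by (intro set_nn_integral_pos) (auto simp: emeasure_square ennreal_eq_0_iff)
  have aw: "average w (square T z) = ennreal (weight_mass w (square T z) / T\<^sup>2)" for z
    unfolding average_def WT using T by (simp add: emeasure_square divide_ennreal weight_mass_nonneg weight)
  have awpos: "weight_mass w (square T z) > 0" for z using Wpos[OF T, of z] unfolding WT by simp
  \<comment> \<open>An infinite dual mass would be multiplied by a strictly positive average of
    \<open>w\<close>, so the product would be infinite and exceed \<open>B\<close>.\<close>
  have Sfin: "?S T z < \<infinity>" for z
  proof (rule ccontr)
    assume "\<not> ?thesis"
    then have "?S T z = \<infinity>" by (simp add: less_top[symmetric])
    then have "average (\<lambda>u. w u powr (- (1 / (p - 1)))) (square T z) = \<infinity>"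
      unfolding average_def using T by (simp add: emeasure_square ennreal_top_divide)
    moreover have "weight_mass w (square T z) / T\<^sup>2 > 0" using awpos T by simp
    ultimately show False using leB[of z] unfolding aw enn_powr_def
      by (simp add: ennreal_mult_top ennreal_eq_0_iff top_unique)
  qed
  let ?s = "\<lambda>z. enn2real (?S T z)"
  have ST: "?S T z = ennreal (?s z)" for z using Sfin[of z] by simp
  have key: "weight_mass w (square T z) * ?s z powr (p - 1) \<le> B * T\<^sup>2 * (T\<^sup>2) powr (p - 1)" for z
  proof -
    have "average (\<lambda>u. w u powr (- (1 / (p - 1)))) (square T z) = ennreal (?s z / T\<^sup>2)"
      unfolding average_def using T by (subst ST) (simp add: emeasure_square divide_ennreal)
    then have "ennreal (weight_mass w (square T z) / T\<^sup>2 * (?s z / T\<^sup>2) powr (p - 1)) \<le> ennreal B"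
      using leB[of z] awpos[of z] unfolding aw enn_powr_def
      by (simp add: ennreal_mult del: times_divide_eq_left)
    then have "weight_mass w (square T z) / T\<^sup>2 * (?s z / T\<^sup>2) powr (p - 1) \<le> B"
      using B by (subst (asm) ennreal_le_iff) auto
    then show ?thesis using T by (simp add: powr_divide field_simps)
  qed
  define t where "t = min T 1"
  have t: "0 < t" "t \<le> 1" "t \<le> T" using T by (auto simp: t_def)
  have mono: "?W t z \<le> ?W T z" "?S t z \<le> ?S T z" for z
    using square_mono[OF t(3), of z] by (auto intro!: nn_integral_mono split: split_indicator)
  have fin: "?W t z < \<infinity>" "?S t z < \<infinity>" for z
    using mono[of z] Sfin[of z] WT[of z] by (auto intro: order_le_less_trans)
  show ?thesis
  proof (rule that[of t "B * T\<^sup>2 * (T\<^sup>2) powr (p - 1) + 1" "\<lambda>z. enn2real (?W t z)" "\<lambda>z. enn2real (?S t z)"])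
    show "0 < B * T\<^sup>2 * (T\<^sup>2) powr (p - 1) + 1" using B by (simp add: add_nonneg_pos)
    fix z
    have "enn2real (?W t z) \<le> weight_mass w (square T z)" "enn2real (?S t z) \<le> ?s z"
      using enn2real_mono[OF mono(1)[of z]] enn2real_mono[OF mono(2)[of z]] Sfin[of z] WT[of z] awpos[of z] by auto
    then have "enn2real (?W t z) * enn2real (?S t z) powr (p - 1) \<le> weight_mass w (square T z) * ?s z powr (p - 1)"
      using p awpos[of z] by (intro mult_mono powr_mono2) auto
    then show "enn2real (?W t z) * enn2real (?S t z) powr (p - 1) \<le> B * T\<^sup>2 * (T\<^sup>2) powr (p - 1) + 1"
      using key[of z] by linarith
    show "?W t z = ennreal (enn2real (?W t z))" "?S t z = ennreal (enn2real (?S t z))"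
      using fin[of z] by auto
    show "0 < enn2real (?W t z)" "0 < enn2real (?S t z)"
      using fin[of z] Wpos[OF t(1), of z] Spos[OF t(1), of z] by (auto simp: enn2real_positive_iff)
  qed (use t in auto)
qed

text \<open>A Harnack chain. Distance d is covered in at most 2d/t + 1 steps of length at most t/2,
  each costing a factor \<open>K\<close>; the additional step accounts for the leading
  \<open>K\<close>.\<close>

lemma chain_bound:
  fixes m :: "complex \<Rightarrow> real"
  assumes K: "K \<ge> 1" and t: "t > 0" and m0: "\<And>z. 0 \<le> m z"
    and step: "\<And>z z'. cmod (z - z') \<le> t / 2 \<Longrightarrow> m z \<le> K * m z'"
  shows "m z \<le> K * exp (2 * ln K / t * cmod (z - z')) * m z'"
proof -
  have chain: "m z \<le> K ^ n * m z'" if "cmod (z - z') \<le> real n * (t / 2)" for n z z'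
    using that
  proof (induction n arbitrary: z)
    case (Suc n)
    \<comment> \<open>One step of the chain covers the fraction 1/(n+1) of the way, so the rest has
      length at most n half-scales.\<close>
    define z'' where "z'' = z + of_real (1 / real (Suc n)) * (z' - z)"
    have "z - z'' = - (of_real (1 / real (Suc n)) * (z' - z))" by (simp add: z''_def)
    then have "cmod (z - z'') = 1 / real (Suc n) * cmod (z - z')"
      by (simp only: norm_minus_cancel norm_mult norm_of_real) (simp add: norm_minus_commute)
    also have "\<dots> \<le> 1 / real (Suc n) * (real (Suc n) * (t / 2))" by (intro mult_left_mono Suc.prems) simp
    finally have 1: "cmod (z - z'') \<le> t / 2" by simp
    have "z'' - z' = of_real (real n / real (Suc n)) * (z - z')"
      using of_nat_neq_0[of n, where 'a = complex] by (simp add: z''_def field_simps)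
    then have "cmod (z'' - z') = real n / real (Suc n) * cmod (z - z')"
      by (simp only: norm_mult norm_of_real) simp
    also have "\<dots> \<le> real n / real (Suc n) * (real (Suc n) * (t / 2))" by (intro mult_left_mono Suc.prems) simp
    finally have 2: "cmod (z'' - z') \<le> real n * (t / 2)" by simp
    have "m z \<le> K * m z''" by (rule step[OF 1])
    also have "\<dots> \<le> K * (K ^ n * m z')" using K by (intro mult_left_mono Suc.IH[OF 2]) auto
    finally show ?case by simp
  qed simp
  define n where "n = nat \<lceil>2 * cmod (z - z') / t\<rceil>"
  have n: "2 * cmod (z - z') / t \<le> real n" "real n \<le> 2 * cmod (z - z') / t + 1"
    unfolding n_def using t by (auto simp: real_nat_ceiling_ge)
  then have "cmod (z - z') \<le> real n * (t / 2)" using t by (simp add: field_simps)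
  then have "m z \<le> K ^ n * m z'" by (rule chain)
  also have "K ^ n = exp (ln K * real n)" using K by (simp add: exp_of_nat2_mult)
  also have "exp (ln K * real n) \<le> exp (ln K * (2 * cmod (z - z') / t + 1))"
    using K n by (auto intro!: mult_left_mono)
  also have "\<dots> = K * exp (2 * ln K / t * cmod (z - z'))"
    using K by (simp add: distrib_left exp_add mult.commute)
  finally show ?thesis using m0[of z'] by (simp add: mult_right_mono)
qed

text \<open>What the equivalences use of a weight. \<open>v\<close> is the weight in the norm and
  \<open>H\<close> stands for its unit masses. Keeping them apart gives two instances over one
  \<open>H\<close>, for \<open>w\<close> and for the averaged weight, hence one condition (e).
  \<open>mass\<close> serves the construction of test functions, \<open>local_bound\<close> the
  sampling of arbitrary ones.\<close>

locale fock_weight =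
  fixes \<alpha> p :: real and v H :: "complex \<Rightarrow> real" and C D :: real
  assumes \<alpha>: "\<alpha> > 0" and p: "1 < p"
    and v_measurable [measurable]: "v \<in> borel_measurable lebesgue" and v_nonneg: "\<And>u. 0 \<le> v u"
    and H_measurable [measurable]: "H \<in> borel_measurable borel" and H_pos: "\<And>z. 0 < H z"
    and C: "C \<ge> 1" and D: "D \<ge> 0"
    and growth: "\<And>z z'. H z \<le> C * exp (D * cmod (z - z')) * H z'"
    and mass: "\<And>z. (\<integral>\<^sup>+u\<in>square 1 z. ennreal (v u) \<partial>lebesgue) \<le> ennreal (C * H z)"
    and local_bound: "\<And>f z. f holomorphic_on UNIV \<Longrightarrow>
       ennreal (gauss_abs \<alpha> f z powr p * H z) \<le> ennreal C * (\<integral>\<^sup>+u\<in>ball z 1. ennreal (gauss_abs \<alpha> f u powr p * v u) \<partial>lebesgue)"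

text \<open>On the overlap, 1 is the product of \<open>w powr (1 / p)\<close> and its inverse, to
  which Hoelder's inequality applies. Since \<open>A\<close> and \<open>B\<close> may have different
  centres, masses at two points can be compared.\<close>

lemma overlap_mass_bound:
  assumes p: "1 < p" and [measurable]: "w \<in> borel_measurable lebesgue" and w0: "\<And>u. 0 \<le> w u"
    and wpos: "AE u in lebesgue. 0 < w u" and [measurable]: "A \<in> sets lebesgue" "B \<in> sets lebesgue"
    and M: "(\<integral>\<^sup>+u\<in>A. ennreal (w u) \<partial>lebesgue) \<le> ennreal M" "0 \<le> M"
    and S: "(\<integral>\<^sup>+u\<in>B. ennreal (w u powr (- (1 / (p - 1)))) \<partial>lebesgue) \<le> ennreal S" "0 \<le> S"
    and a: "ennreal a \<le> emeasure lebesgue (A \<inter> B)" "0 \<le> a"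
  shows "a powr p \<le> M * S powr (p - 1)"
proof -
  let ?F = "\<lambda>u. w u * (indicator (A \<inter> B) u :: real)"
  let ?G = "\<lambda>u. w u powr (- (1 / (p - 1))) * (indicator (A \<inter> B) u :: real)"
  have "emeasure lebesgue (A \<inter> B) = (\<integral>\<^sup>+u. indicator (A \<inter> B) u \<partial>lebesgue)" by simp
  also have "\<dots> = (\<integral>\<^sup>+u. ennreal (?F u powr (1 / p) * ?G u powr (1 - 1 / p)) \<partial>lebesgue)"
  proof (rule nn_integral_cong_AE, use wpos in eventually_elim)
    case (elim u)
    have "(w u powr (- (1 / (p - 1)))) powr (1 - 1 / p) = w u powr (- (1 / p))"
      using p by (simp add: powr_powr field_simps)
    then have "w u powr (1 / p) * (w u powr (- (1 / (p - 1)))) powr (1 - 1 / p) = 1"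
      using elim by (simp add: powr_minus)
    then show ?case by (auto split: split_indicator)
  qed
  also have "\<dots> \<le> ennreal (M powr (1 / p) * S powr (1 - 1 / p))"
  proof (rule nn_integral_Hoelder)
    show "(\<integral>\<^sup>+u. ennreal (?F u) \<partial>lebesgue) \<le> ennreal M"
      by (rule order_trans[OF _ M(1)], intro nn_integral_mono) (auto split: split_indicator)
    show "(\<integral>\<^sup>+u. ennreal (?G u) \<partial>lebesgue) \<le> ennreal S"
      by (rule order_trans[OF _ S(1)], intro nn_integral_mono) (auto split: split_indicator)
  qed (use w0 M S p in auto)
  finally have "ennreal a \<le> ennreal (M powr (1 / p) * S powr (1 - 1 / p))"
    by (rule order_trans[OF a(1)])
  then have "a \<le> M powr (1 / p) * S powr (1 - 1 / p)"
    by (subst (asm) ennreal_le_iff) auto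
  then have "a powr p \<le> (M powr (1 / p) * S powr (1 - 1 / p)) powr p"
    using p a by (intro powr_mono2) auto
  also have "\<dots> = (M powr (1 / p)) powr p * (S powr (1 - 1 / p)) powr p" by (simp add: powr_mult)
  also have "(M powr (1 / p)) powr p = M" using p M by (simp add: powr_powr)
  also have "(S powr (1 - 1 / p)) powr p = S powr (p - 1)" using p by (simp add: powr_powr left_diff_distrib)
  finally show ?thesis .
qed

lemma square_covering:
  assumes t: "0 < t" and N: "1 \<le> real N * t"
  shows "square 1 z \<subseteq> (\<Union>(i, j)\<in>{0..N} \<times> {0..N}. square t (z + Complex (real i * t - 1 / 2) (real j * t - 1 / 2)))"
proof
  fix u assume u: "u \<in> square 1 z"
  have *: "\<exists>i\<in>{0..N}. real i * t - t / 2 \<le> x \<and> x < real i * t + t / 2" if x: "0 \<le> x" "x < 1" for x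
  proof
    \<comment> \<open>The nearest grid index. As \<open>x < 1 \<le> real N * t\<close>, rounding can
      reach \<open>N\<close> but not exceed it, hence the range \<open>{0..N}\<close>.\<close>
    let ?i = "nat \<lfloor>x / t + 1 / 2\<rfloor>"
    have nn: "0 \<le> x / t + 1 / 2" using x t by simp
    have i: "real ?i \<le> x / t + 1 / 2" "x / t + 1 / 2 < real ?i + 1" using nn by linarith+
    then show "real ?i * t - t / 2 \<le> x \<and> x < real ?i * t + t / 2" using t by (simp add: field_simps)
    have "x / t < real N" using x N t by (simp add: field_simps)
    then have "real ?i < real N + 1" using i by linarith
    then show "?i \<in> {0..N}" by simp
  qed
  obtain i where "i \<in> {0..N}" "real i * t - t / 2 \<le> Re u - Re z + 1 / 2 \<and> Re u - Re z + 1 / 2 < real i * t + t / 2"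
    using *[of "Re u - Re z + 1 / 2"] u by (auto simp: square_def)
  moreover obtain j where "j \<in> {0..N}" "real j * t - t / 2 \<le> Im u - Im z + 1 / 2 \<and> Im u - Im z + 1 / 2 < real j * t + t / 2"
    using *[of "Im u - Im z + 1 / 2"] u by (auto simp: square_def)
  ultimately show "u \<in> (\<Union>(i, j)\<in>{0..N} \<times> {0..N}. square t (z + Complex (real i * t - 1 / 2) (real j * t - 1 / 2)))"
    by (intro UN_I[of "(i, j)"]) (auto simp: square_def)
qed

lemma set_nn_integral_UN_le:
  fixes h :: "'a \<Rightarrow> ennreal"
  assumes "finite I" and [measurable]: "h \<in> borel_measurable M" and A: "\<And>i. i \<in> I \<Longrightarrow> A i \<in> sets M" and sub: "S \<subseteq> (\<Union>i\<in>I. A i)"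
  shows "(\<integral>\<^sup>+u\<in>S. h u \<partial>M) \<le> (\<Sum>i\<in>I. \<integral>\<^sup>+u\<in>A i. h u \<partial>M)"
proof -
  have "(\<integral>\<^sup>+u\<in>S. h u \<partial>M) \<le> (\<integral>\<^sup>+u. (\<Sum>i\<in>I. h u * indicator (A i) u) \<partial>M)"
  proof (intro nn_integral_mono)
    fix u
    show "h u * indicator S u \<le> (\<Sum>i\<in>I. h u * indicator (A i) u)"
    proof (cases "u \<in> S")
      case True
      then obtain i where i: "i \<in> I" "u \<in> A i" using sub by auto
      then have "h u * indicator (A i) u \<le> (\<Sum>i\<in>I. h u * indicator (A i) u)"
        using \<open>finite I\<close> by (intro member_le_sum) auto
      then show ?thesis using i True by simp
    qed simp
  qed
  also have "\<dots> = (\<Sum>i\<in>I. \<integral>\<^sup>+u\<in>A i. h u \<partial>M)" using A by (intro nn_integral_sum) auto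
  finally show ?thesis .
qed

text \<open>The A_p bound is available at a small scale, the theorem works at scale 1. Masses at the
  small scale are compared by chaining, and a unit square is covered by a fixed number of small
  squares, so the unit masses inherit both the bound and the growth.\<close>

lemma Ap_restricted_hat_comparable:
  assumes p: "1 < p" and w: "Ap_restricted p w"
  obtains t K \<sigma> c D where "0 < t" "t \<le> 1" "0 < K"
    "\<And>z. (\<integral>\<^sup>+u\<in>square t z. ennreal (w u powr (- (1 / (p - 1)))) \<partial>lebesgue) = ennreal (\<sigma> z)" "\<And>z. 0 < \<sigma> z"
    "\<And>z. weight_hat w z * \<sigma> z powr (p - 1) \<le> K"
    "\<And>z. 0 < weight_hat w z" "1 \<le> c" "0 \<le> D"
    "\<And>z z'. weight_hat w z \<le> c * exp (D * cmod (z - z')) * weight_hat w z'"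
proof -
  have weight: "weight w" and wpos: "AE z in lebesgue. 0 < w z" using w by (auto simp: Ap_restricted_def)
  have w0: "0 \<le> w u" for u using weight by (auto simp: weight_def)
  note [measurable] = weight_measurable[OF weight]
  obtain t K m \<sigma> where t: "0 < t" "t \<le> 1" and K: "0 < K"
    and m: "\<And>z. (\<integral>\<^sup>+u\<in>square t z. ennreal (w u) \<partial>lebesgue) = ennreal (m z)" "\<And>z. 0 < m z"
    and \<sigma>: "\<And>z. (\<integral>\<^sup>+u\<in>square t z. ennreal (w u powr (- (1 / (p - 1)))) \<partial>lebesgue) = ennreal (\<sigma> z)" "\<And>z. 0 < \<sigma> z"
    and mK: "\<And>z. m z * \<sigma> z powr (p - 1) \<le> K"
    using Ap_restricted_small_scale[OF p w] by blast
  define L where "L = max 1 (K / (t\<^sup>2 / 4) powr p)"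
  \<comment> \<open>The overlap bound takes \<open>w\<close> at \<open>z'\<close> and the dual
    weight at \<open>z\<close>. Multiplying by \<open>m z\<close> brings in the A_p bound at
    \<open>z\<close>, and only \<open>m z'\<close> remains.\<close>
  have step: "m z \<le> L * m z'" if d: "cmod (z - z') \<le> t / 2" for z z'
  proof -
    have "ennreal (t\<^sup>2 / 4) \<le> emeasure lebesgue (square t z' \<inter> square t z)"
      using emeasure_square_Int[OF t(1), of z' z] d abs_Re_le_cmod[of "z - z'"] abs_Im_le_cmod[of "z - z'"]
      by (simp add: abs_minus_commute)
    then have "(t\<^sup>2 / 4) powr p \<le> m z' * \<sigma> z powr (p - 1)"
      using m(2)[of z'] \<sigma>(2)[of z]
      by (intro overlap_mass_bound[OF p _ w0 wpos _ _ m(1)[THEN eq_refl] _ \<sigma>(1)[THEN eq_refl]]) simp_all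
    then have "m z * (t\<^sup>2 / 4) powr p \<le> m z * (m z' * \<sigma> z powr (p - 1))"
      using m(2)[of z] by simp
    also have "\<dots> = m z' * (m z * \<sigma> z powr (p - 1))" by (simp add: mult_ac)
    also have "\<dots> \<le> m z' * K" using mK[of z] m(2)[of z'] by simp
    finally have "m z \<le> K / (t\<^sup>2 / 4) powr p * m z'" using t by (simp add: field_simps)
    also have "\<dots> \<le> L * m z'" unfolding L_def using m(2)[of z'] by (intro mult_right_mono) auto
    finally show ?thesis .
  qed
  have L: "L \<ge> 1" by (simp add: L_def)
  define D where "D = 2 * ln L / t"
  have D: "D \<ge> 0" using L t by (simp add: D_def)
  have chain: "m z \<le> L * exp (D * cmod (z - z')) * m z'" for z z'
    unfolding D_def using L t m(2) step by (intro chain_bound) (auto intro: less_imp_le)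
  have hat: "(\<integral>\<^sup>+u\<in>square 1 z. ennreal (w u) \<partial>lebesgue) = ennreal (weight_hat w z)" for z
    unfolding weight_hat_def by (rule weight_nn_integral_square[OF weight])
  have mH: "m z \<le> weight_hat w z" for z
  proof -
    have "ennreal (m z) \<le> ennreal (weight_hat w z)"
      unfolding m(1)[symmetric] hat[symmetric] using square_mono[OF t(2), of z]
      by (auto intro!: nn_integral_mono split: split_indicator)
    then show ?thesis using m(2)[of z] by (metis ennreal_le_iff2 not_le)
  qed
  obtain N :: nat where "1 / t \<le> real N" using real_arch_simple by blast
  then have N: "1 \<le> real N * t" using t by (simp add: field_simps)
  \<comment> \<open>\<open>R\<close> bounds the distance from \<open>z\<close> to the centres of the
    covering squares; \<open>c2\<close> is their number times the growth factor over that
    distance.\<close>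
  define R where "R = 2 * (real N * t + 1)"
  define c2 where "c2 = real (Suc N * Suc N) * (L * exp (D * R))"
  have c2: "c2 \<ge> 1"
  proof -
    have "exp (D * R) \<ge> 1" using D t by (simp add: R_def)
    then have "L * exp (D * R) \<ge> 1" using L mult_mono[of 1 L 1 "exp (D * R)"] by simp
    then show ?thesis unfolding c2_def using mult_mono[of 1 "real (Suc N * Suc N)" 1 "L * exp (D * R)"] by simp
  qed
  have Hm: "weight_hat w z \<le> c2 * m z" for z
  proof -
    let ?I = "{0..N} \<times> {0..N}"
    let ?c = "\<lambda>(i, j). z + Complex (real i * t - 1 / 2) (real j * t - 1 / 2)"
    have "ennreal (weight_hat w z) \<le> (\<Sum>k\<in>?I. \<integral>\<^sup>+u\<in>square t (?c k). ennreal (w u) \<partial>lebesgue)"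
      unfolding hat[symmetric] using square_covering[OF t(1) N, of z]
      by (intro set_nn_integral_UN_le) (auto simp: case_prod_beta')
    also have "\<dots> = (\<Sum>k\<in>?I. ennreal (m (?c k)))" by (simp add: m(1))
    also have "\<dots> \<le> (\<Sum>k\<in>?I. ennreal (L * exp (D * R) * m z))"
    proof (intro sum_mono ennreal_leI)
      fix k assume k: "k \<in> ?I"
      obtain i j where ij: "k = (i, j)" by (cases k)
      have b: "\<bar>real l * t - 1 / 2\<bar> \<le> real N * t + 1" if "l \<in> {0..N}" for l
      proof -
        have "real l * t \<le> real N * t" "0 \<le> real l * t" using that t by (auto intro!: mult_right_mono)
        then show ?thesis unfolding abs_le_iff by linarith
      qed
      have "cmod (?c k - z) \<le> \<bar>real i * t - 1 / 2\<bar> + \<bar>real j * t - 1 / 2\<bar>"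
        unfolding ij using cmod_le[of "Complex (real i * t - 1 / 2) (real j * t - 1 / 2)"] by simp
      also have "\<dots> \<le> R" using b[of i] b[of j] k ij by (simp add: R_def)
      finally have "exp (D * cmod (?c k - z)) \<le> exp (D * R)" using D by (simp add: mult_left_mono)
      then have "L * exp (D * cmod (?c k - z)) * m z \<le> L * exp (D * R) * m z"
        using L m(2)[of z] by (intro mult_right_mono mult_left_mono) auto
      then show "m (?c k) \<le> L * exp (D * R) * m z" using chain[of "?c k" z] by linarith
    qed
    also have "\<dots> = ennreal (c2 * m z)"
    proof -
      have "(\<Sum>k\<in>?I. ennreal (L * exp (D * R) * m z)) = ennreal (\<Sum>k\<in>?I. L * exp (D * R) * m z)"
        using L m(2)[of z] by (intro sum_ennreal) auto
      then show ?thesis by (simp add: c2_def card_cartesian_product mult_ac)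
    qed
    finally show ?thesis using c2 m(2)[of z] by (simp add: ennreal_le_iff)
  qed
  have Hpos: "0 < weight_hat w z" for z using mH[of z] m(2)[of z] by linarith
  show ?thesis
  proof (rule that[of t "c2 * K" \<sigma> "c2 * L" D])
    show "weight_hat w z * \<sigma> z powr (p - 1) \<le> c2 * K" for z
    proof -
      have "weight_hat w z * \<sigma> z powr (p - 1) \<le> c2 * m z * \<sigma> z powr (p - 1)"
        using Hm[of z] by (intro mult_right_mono) auto
      also have "\<dots> \<le> c2 * K" using mK[of z] c2 by (simp add: mult.assoc)
      finally show ?thesis .
    qed
    show "weight_hat w z \<le> c2 * L * exp (D * cmod (z - z')) * weight_hat w z'" for z z'
    proof -
      have "weight_hat w z \<le> c2 * (L * exp (D * cmod (z - z')) * m z')"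
        using Hm[of z] chain[of z z'] c2 by (meson order_trans mult_left_mono zero_le_one)
      also have "\<dots> \<le> c2 * (L * exp (D * cmod (z - z')) * weight_hat w z')"
        using mH[of z'] c2 L by (intro mult_left_mono) auto
      finally show ?thesis by (simp add: mult_ac)
    qed
    show "1 \<le> c2 * L" using c2 L mult_mono[of 1 c2 1 L] by simp
  qed (use t K c2 D Hpos \<sigma> in auto)
qed

text \<open>The factor \<open>\<sigma> z powr (p - 1)\<close> from the weighted local estimate is
  cancelled by \<open>weight_hat w z\<close>, thanks to the A_p bound. The estimate is used on the
  disc of radius \<open>t / 2\<close>, which lies in the small square as well as in the unit
  disc.\<close>

lemma fock_weight_original:
  assumes \<alpha>: "0 < \<alpha>" and p: "1 < p" and w: "Ap_restricted p w"
  obtains C D where "fock_weight \<alpha> p w (weight_hat w) C D"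
proof -
  have weight: "weight w" and wpos: "AE z in lebesgue. 0 < w z" using w by (auto simp: Ap_restricted_def)
  have w0: "0 \<le> w u" for u using weight by (auto simp: weight_def)
  obtain t K \<sigma> c D where t: "0 < t" "t \<le> 1" and K: "0 < K"
    and \<sigma>: "\<And>z. (\<integral>\<^sup>+u\<in>square t z. ennreal (w u powr (- (1 / (p - 1)))) \<partial>lebesgue) = ennreal (\<sigma> z)" "\<And>z. 0 < \<sigma> z"
    and HK: "\<And>z. weight_hat w z * \<sigma> z powr (p - 1) \<le> K"
    and H: "\<And>z. 0 < weight_hat w z" and c: "1 \<le> c" and D: "0 \<le> D"
    and growth: "\<And>z z'. weight_hat w z \<le> c * exp (D * cmod (z - z')) * weight_hat w z'"
    by (rule Ap_restricted_hat_comparable[OF p w]) (rule that; iprover)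
  have "t / 2 > 0" using t by simp
  define G where "G = local_const \<alpha> p (t / 2)"
  have G: "G > 0" unfolding G_def using t by (intro local_const_pos) simp
  note bound = gauss_abs_local_weighted[OF \<alpha> p \<open>t / 2 > 0\<close>, folded G_def]
  define C where "C = max c (G * K)"
  have C: "C \<ge> 1" "c \<le> C" "G * K \<le> C" using c by (auto simp: C_def)
  have "fock_weight \<alpha> p w (weight_hat w) C D"
  proof
    show "weight_hat w z \<le> C * exp (D * cmod (z - z')) * weight_hat w z'" for z z'
    proof -
      have "c * exp (D * cmod (z - z')) * weight_hat w z' \<le> C * exp (D * cmod (z - z')) * weight_hat w z'"
        using C H[of z'] by (intro mult_right_mono) auto
      then show ?thesis using growth[of z z'] by linarith
    qed
    show "(\<integral>\<^sup>+u\<in>square 1 z. ennreal (w u) \<partial>lebesgue) \<le> ennreal (C * weight_hat w z)" for z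
    proof -
      have "weight_hat w z \<le> C * weight_hat w z" using C H[of z] by simp
      then show ?thesis unfolding weight_nn_integral_square[OF weight] weight_hat_def by (rule ennreal_leI)
    qed
    fix f z assume f: "f holomorphic_on UNIV"
    have le: "(\<integral>\<^sup>+u\<in>ball z (t / 2). ennreal (w u powr (- (1 / (p - 1)))) \<partial>lebesgue) \<le> ennreal (\<sigma> z)"
      unfolding \<sigma>(1)[symmetric] using ball_subset_square[of z t]
      by (auto intro!: nn_integral_mono split: split_indicator)
    have "ennreal (gauss_abs \<alpha> f z powr p * weight_hat w z) = ennreal (weight_hat w z) * ennreal (gauss_abs \<alpha> f z powr p)"
      using H[of z] by (simp add: ennreal_mult less_imp_le mult.commute)
    also have "\<dots> \<le> ennreal (weight_hat w z) * (ennreal (G * \<sigma> z powr (p - 1)) * (\<integral>\<^sup>+u\<in>ball z (t / 2). ennreal (gauss_abs \<alpha> f u powr p * w u) \<partial>lebesgue))"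
      by (intro mult_left_mono bound f le \<sigma> weight_measurable weight w0 wpos) auto
    also have "\<dots> = ennreal (G * (weight_hat w z * \<sigma> z powr (p - 1))) * (\<integral>\<^sup>+u\<in>ball z (t / 2). ennreal (gauss_abs \<alpha> f u powr p * w u) \<partial>lebesgue)"
      using H[of z] G by (simp add: ennreal_mult less_imp_le mult_ac)
    also have "\<dots> \<le> ennreal C * (\<integral>\<^sup>+u\<in>ball z 1. ennreal (gauss_abs \<alpha> f u powr p * w u) \<partial>lebesgue)"
    proof (intro mult_mono ennreal_leI)
      have "G * (weight_hat w z * \<sigma> z powr (p - 1)) \<le> G * K" using HK[of z] G by simp
      then show "G * (weight_hat w z * \<sigma> z powr (p - 1)) \<le> C" using C by linarith
      show "(\<integral>\<^sup>+u\<in>ball z (t / 2). ennreal (gauss_abs \<alpha> f u powr p * w u) \<partial>lebesgue)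
          \<le> (\<integral>\<^sup>+u\<in>ball z 1. ennreal (gauss_abs \<alpha> f u powr p * w u) \<partial>lebesgue)"
        using t by (auto intro!: nn_integral_mono split: split_indicator)
    qed auto
    finally show "ennreal (gauss_abs \<alpha> f z powr p * weight_hat w z)
        \<le> ennreal C * (\<integral>\<^sup>+u\<in>ball z 1. ennreal (gauss_abs \<alpha> f u powr p * w u) \<partial>lebesgue)" .
  qed (use \<alpha> p w0 H D C weight_measurable[OF weight] weight_hat_measurable[OF weight] in auto)
  then show ?thesis by (rule that)
qed

text \<open>By \<open>growth\<close>, \<open>H\<close> varies by at most the factor \<open>E\<close>
  on a unit disc and so behaves there like a constant: its dual mass is at most a multiple of that
  of the constant \<open>H z\<close>, and \<open>H\<close> can act as its own unit mass.\<close>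

lemma fock_weight_hat:
  assumes "fock_weight \<alpha> p w H C D"
  obtains C' where "fock_weight \<alpha> p H H C' D"
proof -
  interpret fock_weight \<alpha> p w H C D by fact
  have Hl: "H \<in> borel_measurable lebesgue" by (simp add: measurable_completion)
  define A where "A = measure lborel (ball (0::complex) 1)"
  have A: "A > 0" "\<And>z::complex. emeasure lborel (ball z 1) = ennreal A"
    by (simp_all add: A_def content_ball_pos emeasure_ball_complex)
  define G where "G = local_const \<alpha> p 1"
  have G: "G > 0" unfolding G_def by (intro local_const_pos) simp
  note bound = gauss_abs_local_weighted[OF \<alpha> p zero_less_one, folded G_def]
  define E where "E = C * exp D"
  have E: "E \<ge> C" "E > 0" using C D by (auto simp: E_def intro: order_less_le_trans)
  have near: "H z \<le> E * H u" if "cmod (z - u) \<le> 1" for z u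
  proof -
    have "C * exp (D * cmod (z - u)) * H u \<le> E * H u"
      unfolding E_def using that D C H_pos[of u] mult_left_mono[OF that D]
      by (intro mult_right_mono mult_left_mono) auto
    then show ?thesis using growth[of z u] by linarith
  qed
  define C' where "C' = max E (G * (A powr (p - 1) * E))"
  have C': "E \<le> C'" "C \<le> C'" "1 \<le> C'" "G * (A powr (p - 1) * E) \<le> C'" using C E by (auto simp: C'_def)
  have "fock_weight \<alpha> p H H C' D"
  proof
    show "H z \<le> C' * exp (D * cmod (z - z')) * H z'" for z z'
    proof -
      have "C * exp (D * cmod (z - z')) * H z' \<le> C' * exp (D * cmod (z - z')) * H z'"
        using C' H_pos[of z'] by (intro mult_right_mono) auto
      then show ?thesis using growth[of z z'] by linarith
    qed
    show "(\<integral>\<^sup>+u\<in>square 1 z. ennreal (H u) \<partial>lebesgue) \<le> ennreal (C' * H z)" for z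
    proof -
      have "(\<integral>\<^sup>+u\<in>square 1 z. ennreal (H u) \<partial>lebesgue) \<le> (\<integral>\<^sup>+u. ennreal (C' * H z) * indicator (square 1 z) u \<partial>lebesgue)"
      proof (intro nn_integral_mono)
        fix u
        have "H u \<le> C' * H z" if "u \<in> square 1 z"
        proof -
          have "H u \<le> E * H z" using square_dist_less_1[OF that] by (intro near) auto
          also have "\<dots> \<le> C' * H z" using C' H_pos[of z] by simp
          finally show ?thesis .
        qed
        then show "ennreal (H u) * indicator (square 1 z) u \<le> ennreal (C' * H z) * indicator (square 1 z) u"
          by (auto split: split_indicator intro: ennreal_leI)
      qed
      also have "\<dots> = ennreal (C' * H z)" by (simp add: nn_integral_cmult_indicator emeasure_square)
      finally show ?thesis .
    qed
    fix f z assume f: "f holomorphic_on UNIV"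
    \<comment> \<open>The area of the disc times an upper bound of the dual weight, since
      \<open>H u \<ge> H z / E\<close> there. Its power p - 1 is a constant times
      \<open>E / H z\<close>, which cancels \<open>H z\<close>.\<close>
    define Y where "Y = A * (H z / E) powr (- (1 / (p - 1)))"
    have Hz: "H z / E > 0" using H_pos[of z] E by simp
    have Y: "Y > 0" unfolding Y_def using A Hz by (intro mult_pos_pos) (use E H_pos[of z] in \<open>simp_all add: powr_gt_zero less_imp_neq[symmetric]\<close>)
    have le: "(\<integral>\<^sup>+u\<in>ball z 1. ennreal (H u powr (- (1 / (p - 1)))) \<partial>lebesgue) \<le> ennreal Y"
    proof -
      have "(\<integral>\<^sup>+u\<in>ball z 1. ennreal (H u powr (- (1 / (p - 1)))) \<partial>lebesgue)
         \<le> (\<integral>\<^sup>+u. ennreal ((H z / E) powr (- (1 / (p - 1)))) * indicator (ball z 1) u \<partial>lebesgue)"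
      proof (intro nn_integral_mono)
        fix u
        have "H u powr (- (1 / (p - 1))) \<le> (H z / E) powr (- (1 / (p - 1)))" if "u \<in> ball z 1"
        proof (rule powr_mono2')
          have "H z \<le> E * H u" using that by (intro near) (simp add: dist_norm)
          then show "H z / E \<le> H u" using E by (simp add: field_simps)
        qed (use Hz p in auto)
        then show "ennreal (H u powr (- (1 / (p - 1)))) * indicator (ball z 1) u
            \<le> ennreal ((H z / E) powr (- (1 / (p - 1)))) * indicator (ball z 1) u"
          by (auto split: split_indicator intro: ennreal_leI)
      qed
      also have "\<dots> = ennreal ((H z / E) powr (- (1 / (p - 1)))) * ennreal A"
        by (subst nn_integral_cmult_indicator) (simp_all add: A)
      also have "\<dots> = ennreal Y"
        using A by (simp add: Y_def ennreal_mult mult.commute)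
      finally show ?thesis .
    qed
    have "Y powr (p - 1) = A powr (p - 1) * (H z / E) powr (-1)"
      unfolding Y_def using A p by (simp add: powr_mult powr_powr)
    also have "(H z / E) powr (-1) = E / H z" using E H_pos[of z] by (simp add: powr_minus)
    finally have Yp: "Y powr (p - 1) = A powr (p - 1) * (E / H z)" .
    have "ennreal (gauss_abs \<alpha> f z powr p * H z) = ennreal (H z) * ennreal (gauss_abs \<alpha> f z powr p)"
      using H_pos[of z] by (simp add: ennreal_mult less_imp_le mult.commute)
    also have "\<dots> \<le> ennreal (H z) * (ennreal (G * Y powr (p - 1)) * (\<integral>\<^sup>+u\<in>ball z 1. ennreal (gauss_abs \<alpha> f u powr p * H u) \<partial>lebesgue))"
      using H_pos Hl by (intro mult_left_mono bound f le Y) (auto intro: less_imp_le)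
    also have "\<dots> = ennreal (H z * (G * Y powr (p - 1))) * (\<integral>\<^sup>+u\<in>ball z 1. ennreal (gauss_abs \<alpha> f u powr p * H u) \<partial>lebesgue)"
      using H_pos[of z] G by (simp add: ennreal_mult less_imp_le mult.assoc)
    also have "H z * (G * Y powr (p - 1)) = G * (A powr (p - 1) * E)"
      unfolding Yp using H_pos[of z] by simp
    also have "ennreal (G * (A powr (p - 1) * E)) * (\<integral>\<^sup>+u\<in>ball z 1. ennreal (gauss_abs \<alpha> f u powr p * H u) \<partial>lebesgue)
        \<le> ennreal C' * (\<integral>\<^sup>+u\<in>ball z 1. ennreal (gauss_abs \<alpha> f u powr p * H u) \<partial>lebesgue)"
      using C' by (intro mult_right_mono ennreal_leI) auto
    finally show "ennreal (gauss_abs \<alpha> f z powr p * H z)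
        \<le> ennreal C' * (\<integral>\<^sup>+u\<in>ball z 1. ennreal (gauss_abs \<alpha> f u powr p * H u) \<partial>lebesgue)" .
  qed (use \<alpha> p D C' Hl H_measurable H_pos in \<open>auto intro: less_imp_le\<close>)
  then show ?thesis by (rule that)
qed

section \<open>Sufficiency of the summability condition\<close>

text \<open>A duality argument: the vector of integrals is paired with itself, the sum moved under
  the integral, and Cauchy-Schwarz applied for each \<open>t\<close>. One factor \<open>T\<close> is
  then divided out.\<close>

lemma integral_L2_Minkowski:
  fixes h :: "'a \<Rightarrow> real \<Rightarrow> real"
  assumes F: "finite F" and cont: "\<And>x. x \<in> F \<Longrightarrow> continuous_on {0..1} (h x)"
  shows "sqrt (\<Sum>x\<in>F. (integral {0..1} (h x))\<^sup>2) \<le> integral {0..1} (\<lambda>t. sqrt (\<Sum>x\<in>F. (h x t)\<^sup>2))"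
proof -
  define v where "v x = integral {0..1} (h x)" for x
  define T where "T = sqrt (\<Sum>x\<in>F. (v x)\<^sup>2)"
  have T0: "T \<ge> 0" by (simp add: T_def sum_nonneg)
  have int1: "(\<lambda>t. v x * h x t) integrable_on {0..1}" if "x \<in> F" for x
    by (intro integrable_continuous_real continuous_intros cont that)
  have int2: "(\<lambda>t. sqrt (\<Sum>x\<in>F. (h x t)\<^sup>2)) integrable_on {0..1}"
    by (intro integrable_continuous_real continuous_intros cont)
  have "T * T = (\<Sum>x\<in>F. v x * v x)" by (simp add: T_def sum_nonneg power2_eq_square)
  also have "\<dots> = (\<Sum>x\<in>F. integral {0..1} (\<lambda>t. v x * h x t))" by (simp add: v_def)
  also have "\<dots> = integral {0..1} (\<lambda>t. \<Sum>x\<in>F. v x * h x t)"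
    using F int1 by (intro integral_sum[symmetric]) auto
  also have "\<dots> \<le> integral {0..1} (\<lambda>t. T * sqrt (\<Sum>x\<in>F. (h x t)\<^sup>2))"
  proof (rule integral_le)
    show "(\<lambda>t. \<Sum>x\<in>F. v x * h x t) integrable_on {0..1}" using F int1 by (intro integrable_sum) auto
    show "(\<lambda>t. T * sqrt (\<Sum>x\<in>F. (h x t)\<^sup>2)) integrable_on {0..1}"
      by (intro integrable_continuous_real continuous_intros cont)
    fix t
    have "(\<Sum>x\<in>F. v x * h x t) \<le> (\<Sum>x\<in>F. \<bar>v x\<bar> * \<bar>h x t\<bar>)"
      by (intro sum_mono) (metis abs_ge_self abs_mult)
    also have "\<dots> \<le> T * sqrt (\<Sum>x\<in>F. (h x t)\<^sup>2)"
      using L2_set_mult_ineq[of v "\<lambda>x. h x t" F] by (simp add: L2_set_def T_def)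
    finally show "(\<Sum>x\<in>F. v x * h x t) \<le> T * sqrt (\<Sum>x\<in>F. (h x t)\<^sup>2)" .
  qed
  also have "\<dots> = T * integral {0..1} (\<lambda>t. sqrt (\<Sum>x\<in>F. (h x t)\<^sup>2))" by simp
  finally have TT: "T * T \<le> T * integral {0..1} (\<lambda>t. sqrt (\<Sum>x\<in>F. (h x t)\<^sup>2))" .
  have "T \<le> integral {0..1} (\<lambda>t. sqrt (\<Sum>x\<in>F. (h x t)\<^sup>2))"
  proof (cases "T = 0")
    case True
    then show ?thesis using int2 by (simp add: integral_nonneg sum_nonneg)
  next
    case False
    then show ?thesis using TT T0 by simp
  qed
  then show ?thesis by (simp add: T_def v_def)
qed

lemma continuous_on_powr_const:
  fixes h :: "'a::topological_space \<Rightarrow> real"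
  assumes "continuous_on S h" "\<And>t. t \<in> S \<Longrightarrow> 0 \<le> h t" "0 < r"
  shows "continuous_on S (\<lambda>t. h t powr r)"
  using assms by (intro continuous_on_powr') (auto intro: continuous_intros)

text \<open>Young's inequality at the mean \<open>m\<close> plays the role of the supporting line of
  the convex power. The case r = 1 is separate because it has no finite conjugate exponent.\<close>

lemma integral_powr_Jensen:
  fixes h :: "real \<Rightarrow> real"
  assumes cont: "continuous_on {0..1} h" and h: "\<And>t. t \<in> {0..1} \<Longrightarrow> 0 \<le> h t" and r: "1 \<le> r"
  shows "(integral {0..1} h) powr r \<le> integral {0..1} (\<lambda>t. h t powr r)"
proof (cases "r = 1")
  case True
  have "integral {0..1} h \<ge> 0" by (intro integral_nonneg integrable_continuous_real cont h)
  moreover have "integral {0..1} (\<lambda>t. h t powr r) = integral {0..1} h"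
    using h True by (intro integral_cong) auto
  ultimately show ?thesis using True by simp
next
  case False
  then have r: "r > 1" using r by simp
  define m where "m = integral {0..1} h"
  have m: "m \<ge> 0" unfolding m_def by (intro integral_nonneg integrable_continuous_real cont h)
  have contp: "continuous_on {0..1} (\<lambda>t. h t powr r)"
    using cont h r by (intro continuous_on_powr_const) auto
  have y: "m powr (r - 1) * h t \<le> (1 / r) * h t powr r + (1 - 1 / r) * m powr r" if "t \<in> {0..1}" for t
  proof -
    have "h t * m powr (r - 1) \<le> h t powr r / r + (m powr (r - 1)) powr (r / (r - 1)) / (r / (r - 1))"
      using r m h[OF that] by (intro Youngs_inequality) (auto simp: field_simps)
    also have "(m powr (r - 1)) powr (r / (r - 1)) = m powr r" using r by (simp add: powr_powr)
    also have "m powr r / (r / (r - 1)) = (1 - 1 / r) * m powr r" using r by (simp add: field_simps)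
    finally show ?thesis by (simp add: mult.commute)
  qed
  have "m powr (r - 1) * m = integral {0..1} (\<lambda>t. m powr (r - 1) * h t)" by (simp add: m_def)
  also have "\<dots> \<le> integral {0..1} (\<lambda>t. (1 / r) * h t powr r + (1 - 1 / r) * m powr r)"
    using y by (intro integral_le integrable_continuous_real continuous_intros cont contp) auto
  also have "\<dots> = (1 / r) * integral {0..1} (\<lambda>t. h t powr r) + (1 - 1 / r) * m powr r"
    using r by (subst integral_add) (auto intro!: integrable_continuous_real continuous_intros contp)
  also have "m powr (r - 1) * m = m powr r"
    using m by (metis add_diff_cancel diff_add_cancel powr_add powr_one)
  finally show ?thesis using r by (simp add: m_def field_simps)
qed

section \<open>Lattice sampling in weighted Fock spaces\<close>

lemma infinite_lattice: "infinite lattice"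
proof -
  have "range (of_nat :: nat \<Rightarrow> complex) \<subseteq> lattice" by (auto simp: lattice_def)
  moreover have "infinite (range (of_nat :: nat \<Rightarrow> complex))"
    by (intro range_inj_infinite) (simp add: inj_on_def)
  ultimately show ?thesis using infinite_super by blast
qed

lemma dual_ball_sup_upper:
  assumes x: "\<And>j. j < n \<Longrightarrow> x j \<in> carrier_of X" and r: "0 < r" and \<phi>: "\<phi> \<in> dual_ball X"
  shows "(\<Sum>j<n. cmod (\<phi> (x j)) powr r) powr (1 / r) \<le> (SUP \<phi>\<in>dual_ball X. (\<Sum>j<n. cmod (\<phi> (x j)) powr r) powr (1 / r))"
\<comment> \<open>A real supremum dominates its members only if the set is bounded above; the norms
  of the \<open>x j\<close> provide the bound.\<close>
proof (rule cSUP_upper[OF \<phi>], rule bdd_aboveI2)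
  fix \<psi> assume "\<psi> \<in> dual_ball X"
  then have "(\<Sum>j<n. cmod (\<psi> (x j)) powr r) \<le> (\<Sum>j<n. norm_of X (x j) powr r)"
    using x r by (intro sum_mono powr_mono2) (auto simp: dual_ball_def)
  then show "(\<Sum>j<n. cmod (\<psi> (x j)) powr r) powr (1 / r) \<le> (\<Sum>j<n. norm_of X (x j) powr r) powr (1 / r)"
    using r by (intro powr_mono2) (auto intro: sum_nonneg)
qed

lemma zero_in_dual_ball: "(\<And>f. f \<in> carrier_of X \<Longrightarrow> 0 \<le> norm_of X f) \<Longrightarrow> (\<lambda>_. 0) \<in> dual_ball X"
  by (auto simp: dual_ball_def)

context fock_weight
begin

abbreviation Fock :: "complex fspace" where
  "Fock \<equiv> Fock_space \<alpha> p v"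

lemma H_nonneg [simp]: "0 \<le> H z"
  using H_pos[of z] by simp

lemma Fock_carrier:
  "f \<in> carrier_of Fock \<longleftrightarrow>
     f holomorphic_on UNIV \<and> (\<integral>\<^sup>+z. ennreal (gauss_abs \<alpha> f z powr p * v z) \<partial>lebesgue) < \<infinity>"
  by (simp add: Fock_space_def gauss_abs_powr mult_ac)

lemma Fock_norm:
  "norm_of Fock f = enn2real (\<integral>\<^sup>+z. ennreal (gauss_abs \<alpha> f z powr p * v z) \<partial>lebesgue) powr (1 / p)"
  by (simp add: Fock_space_def gauss_abs_powr mult_ac)

lemma Fock_norm_nonneg: "0 \<le> norm_of Fock f"
  by (simp add: Fock_norm)

lemma Fock_integral_eq:
  assumes "f \<in> carrier_of Fock"
  shows "(\<integral>\<^sup>+z. ennreal (gauss_abs \<alpha> f z powr p * v z) \<partial>lebesgue) = ennreal (norm_of Fock f powr p)"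
  using assms p by (simp add: Fock_carrier Fock_norm powr_powr)

text \<open>A Plancherel-Polya inequality: each sample is bounded by an integral over the disc of
  radius 2 about \<nu>, and these discs overlap boundedly often. The constant is independent of the
  circle point \<zeta>, so that samples can later be averaged over the circle.\<close>

lemma lattice_sampling:
  obtains K where "K > 0" "\<And>F f \<zeta>. finite F \<Longrightarrow> F \<subseteq> lattice \<Longrightarrow> f \<in> carrier_of Fock \<Longrightarrow> cmod \<zeta> = 1 \<Longrightarrow>
     (\<Sum>\<nu>\<in>F. H \<nu> * cmod (gauss_shift \<alpha> f \<nu> \<zeta>) powr p) \<le> K * norm_of Fock f powr p"
proof -
  obtain S where S: "S > 0" "\<And>F z. finite F \<Longrightarrow> F \<subseteq> lattice \<Longrightarrow> (\<Sum>\<nu>\<in>F. exp (- 2 * cmod (z - \<nu>))) \<le> S"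
    by (rule lattice_exp_sum) (rule that; iprover)
  \<comment> \<open>\<open>C * exp D\<close> moves \<open>H\<close> from \<nu> to \<nu> + \<zeta>,
    at distance 1; \<open>exp (p * \<alpha> / 2)\<close> is the Gaussian factor of the shift
    there.\<close>
  define c where "c = C * exp D * exp (p * \<alpha> / 2)"
  have c: "c > 0" using C by (simp add: c_def)
  define K where "K = c * C * (exp 4 * S)"
  show ?thesis
  proof (rule that[of K])
    show "K > 0" using S c C by (simp add: K_def)
    fix F f \<zeta>
    assume F: "finite F" "F \<subseteq> lattice" and f: "f \<in> carrier_of Fock" and \<zeta>: "cmod \<zeta> = 1"
    have hol: "f holomorphic_on UNIV" using f by (simp add: Fock_carrier)
    note [measurable] = gauss_abs_measurable[OF hol]
    have [measurable]: "gauss_abs \<alpha> f \<in> borel_measurable lebesgue" by (simp add: measurable_completion)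
    have [measurable]: "ball x r \<in> sets lebesgue" for x :: complex and r by simp
    let ?g = "\<lambda>u. ennreal (gauss_abs \<alpha> f u powr p * v u)"
    have one: "ennreal (H \<nu> * cmod (gauss_shift \<alpha> f \<nu> \<zeta>) powr p) \<le> ennreal (c * C) * (\<integral>\<^sup>+u\<in>ball \<nu> 2. ?g u \<partial>lebesgue)" for \<nu>
    proof -
      have sh: "cmod (gauss_shift \<alpha> f \<nu> \<zeta>) powr p = gauss_abs \<alpha> f (\<nu> + \<zeta>) powr p * exp (p * \<alpha> / 2)"
        by (simp add: norm_gauss_shift \<zeta> powr_mult powr_def[of "exp _"])
      have "H \<nu> \<le> C * exp D * H (\<nu> + \<zeta>)" using growth[of \<nu> "\<nu> + \<zeta>"] \<zeta> by simp
      then have "H \<nu> * cmod (gauss_shift \<alpha> f \<nu> \<zeta>) powr p \<le> (C * exp D * H (\<nu> + \<zeta>)) * cmod (gauss_shift \<alpha> f \<nu> \<zeta>) powr p"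
        by (intro mult_right_mono) auto
      also have "\<dots> = c * (gauss_abs \<alpha> f (\<nu> + \<zeta>) powr p * H (\<nu> + \<zeta>))" unfolding sh c_def by simp
      finally have "ennreal (H \<nu> * cmod (gauss_shift \<alpha> f \<nu> \<zeta>) powr p) \<le> ennreal (c * (gauss_abs \<alpha> f (\<nu> + \<zeta>) powr p * H (\<nu> + \<zeta>)))"
        by (rule ennreal_leI)
      also have "\<dots> = ennreal c * ennreal (gauss_abs \<alpha> f (\<nu> + \<zeta>) powr p * H (\<nu> + \<zeta>))"
        using c H_pos by (intro ennreal_mult mult_nonneg_nonneg) (auto intro: less_imp_le)
      also have "\<dots> \<le> ennreal c * (ennreal C * (\<integral>\<^sup>+u\<in>ball (\<nu> + \<zeta>) 1. ?g u \<partial>lebesgue))"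
        by (intro mult_left_mono local_bound hol) auto
      also have "\<dots> \<le> ennreal c * (ennreal C * (\<integral>\<^sup>+u\<in>ball \<nu> 2. ?g u \<partial>lebesgue))"
      proof (rule mult_left_mono, rule mult_left_mono, rule nn_integral_mono)
        fix u
        have "ball (\<nu> + \<zeta>) 1 \<subseteq> ball \<nu> 2"
        proof
          fix x assume "x \<in> ball (\<nu> + \<zeta>) 1"
          then have "cmod ((\<nu> + \<zeta>) - x) < 1" by (simp add: dist_norm)
          moreover have "cmod (\<nu> - x) \<le> cmod ((\<nu> + \<zeta>) - x) + cmod \<zeta>"
            using norm_triangle_ineq4[of "(\<nu> + \<zeta>) - x" \<zeta>] by simp
          ultimately show "x \<in> ball \<nu> 2" using \<zeta> by (simp add: dist_norm)
        qed
        then show "?g u * indicator (ball (\<nu> + \<zeta>) 1) u \<le> ?g u * indicator (ball \<nu> 2) u"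
          by (auto split: split_indicator)
      qed auto
      also have "\<dots> = ennreal (c * C) * (\<integral>\<^sup>+u\<in>ball \<nu> 2. ?g u \<partial>lebesgue)"
        using c C by (simp add: ennreal_mult mult.assoc)
      finally show ?thesis .
    qed
    \<comment> \<open>On the disc of radius 2 about \<nu> the exponential is at least
      \<open>exp (- 4)\<close>, so the lattice sum bounds the overlap count.\<close>
    have ind: "(\<Sum>\<nu>\<in>F. indicator (ball \<nu> 2) u :: ennreal) \<le> ennreal (exp 4 * S)" for u
    proof -
      have "(\<Sum>\<nu>\<in>F. indicator (ball \<nu> 2) u :: ennreal) \<le> (\<Sum>\<nu>\<in>F. ennreal (exp 4 * exp (- 2 * cmod (u - \<nu>))))"
      proof (intro sum_mono)
        fix \<nu>
        have "1 \<le> exp 4 * exp (- 2 * cmod (u - \<nu>))" if "u \<in> ball \<nu> 2"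
          using that unfolding mult_exp_exp by (simp add: dist_norm norm_minus_commute)
        then show "indicator (ball \<nu> 2) u \<le> ennreal (exp 4 * exp (- 2 * cmod (u - \<nu>)))"
          by (auto split: split_indicator simp flip: ennreal_1 intro!: ennreal_leI simp del: ennreal_1)
      qed
      also have "\<dots> = ennreal (exp 4 * (\<Sum>\<nu>\<in>F. exp (- 2 * cmod (u - \<nu>))))"
        by (simp add: sum_distrib_left)
      also have "\<dots> \<le> ennreal (exp 4 * S)" using S(2)[OF F] by (intro ennreal_leI mult_left_mono) auto
      finally show ?thesis .
    qed
    have "ennreal (\<Sum>\<nu>\<in>F. H \<nu> * cmod (gauss_shift \<alpha> f \<nu> \<zeta>) powr p) = (\<Sum>\<nu>\<in>F. ennreal (H \<nu> * cmod (gauss_shift \<alpha> f \<nu> \<zeta>) powr p))"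
      using H_pos by (intro sum_ennreal[symmetric] mult_nonneg_nonneg) (auto intro: less_imp_le)
    also have "\<dots> \<le> (\<Sum>\<nu>\<in>F. ennreal (c * C) * (\<integral>\<^sup>+u\<in>ball \<nu> 2. ?g u \<partial>lebesgue))" by (intro sum_mono one)
    also have "\<dots> = ennreal (c * C) * (\<integral>\<^sup>+u. (\<Sum>\<nu>\<in>F. ?g u * indicator (ball \<nu> 2) u) \<partial>lebesgue)"
      by (subst nn_integral_sum) (auto simp: sum_distrib_left)
    also have "\<dots> \<le> ennreal (c * C) * (\<integral>\<^sup>+u. ennreal (exp 4 * S) * ?g u \<partial>lebesgue)"
    proof (rule mult_left_mono, rule nn_integral_mono)
      fix u
      have "?g u * (\<Sum>\<nu>\<in>F. indicator (ball \<nu> 2) u) \<le> ?g u * ennreal (exp 4 * S)"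
        by (intro mult_left_mono ind) simp
      then show "(\<Sum>\<nu>\<in>F. ?g u * indicator (ball \<nu> 2) u) \<le> ennreal (exp 4 * S) * ?g u"
        by (simp add: sum_distrib_left mult.commute)
    qed simp
    also have "\<dots> = ennreal (c * C) * (ennreal (exp 4 * S) * ennreal (norm_of Fock f powr p))"
      by (subst nn_integral_cmult) (auto simp: Fock_integral_eq[OF f])
    also have "\<dots> = ennreal (K * norm_of Fock f powr p)"
      unfolding K_def using c C S by (simp add: ennreal_mult mult.assoc)
    finally show "(\<Sum>\<nu>\<in>F. H \<nu> * cmod (gauss_shift \<alpha> f \<nu> \<zeta>) powr p) \<le> K * norm_of Fock f powr p"
      using S c C by (subst (asm) ennreal_le_iff) (auto simp: K_def)
  qed
qed

end

text \<open>The sequence of (e) with an abstract \<open>H\<close> in place of the unit masses, so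
  that both weights lead to the same sequence.\<close>

definition mass_ratio :: "real \<Rightarrow> (complex \<Rightarrow> real) \<Rightarrow> complex measure \<Rightarrow> complex \<Rightarrow> ennreal" where
  "mass_ratio e H \<mu> \<nu> = emeasure \<mu> (square 1 \<nu>) / ennreal (H \<nu> powr e)"

abbreviation circle_point :: "real \<Rightarrow> complex" where
  "circle_point t \<equiv> exp (2 * of_real pi * \<i> * of_real t)"

definition circle_mean :: "real \<Rightarrow> (complex \<Rightarrow> complex) \<Rightarrow> complex \<Rightarrow> real" where
  "circle_mean \<alpha> f \<nu> = integral {0..1} (\<lambda>t. cmod (gauss_shift \<alpha> f \<nu> (circle_point t)))"

lemma gauss_shift_add: "gauss_shift \<alpha> (\<lambda>x. f x + g x) \<nu> \<zeta> = gauss_shift \<alpha> f \<nu> \<zeta> + gauss_shift \<alpha> g \<nu> \<zeta>"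
  by (simp add: gauss_shift_def distrib_right)

lemma gauss_shift_cmult: "gauss_shift \<alpha> (\<lambda>x. c * f x) \<nu> \<zeta> = c * gauss_shift \<alpha> f \<nu> \<zeta>"
  by (simp add: gauss_shift_def)

lemma continuous_gauss_shift_circle:
  assumes "f holomorphic_on UNIV"
  shows "continuous_on S (\<lambda>t. gauss_shift \<alpha> f \<nu> (circle_point t))"
  by (rule continuous_on_compose2[OF holomorphic_on_imp_continuous_on[OF gauss_shift_holomorphic[OF assms]]])
    (auto intro!: continuous_intros)

lemma circle_mean_nonneg: 
  assumes "f holomorphic_on UNIV"
  shows "0 \<le> circle_mean \<alpha> f \<nu>"
  unfolding circle_mean_def
  by (intro integral_nonneg integrable_continuous_real continuous_intros continuous_gauss_shift_circle assms) auto

lemma gauss_abs_le_circle_mean: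
  assumes f: "f holomorphic_on UNIV" and \<alpha>: "0 < \<alpha>" and u: "u \<in> square 1 \<nu>"
  shows "gauss_abs \<alpha> f u \<le> 4 * circle_mean \<alpha> f \<nu>"
proof -
  let ?\<zeta> = "u - \<nu>"
  \<comment> \<open>A convenient bound below 1; it turns the factor 1/(1 - |\<zeta>|) of Cauchy's
    estimate into 4.\<close>
  have "sqrt (1 / 2 :: real) \<le> 3 / 4" by (rule real_le_lsqrt) (auto simp: power2_eq_square)
  then have \<zeta>: "cmod ?\<zeta> \<le> 3 / 4" using square_dist[OF u] by linarith
  have "gauss_abs \<alpha> f u * 1 \<le> gauss_abs \<alpha> f u * exp (\<alpha> / 2 * (cmod ?\<zeta>)\<^sup>2)"
    using \<alpha> by (intro mult_left_mono) auto
  also have "\<dots> = cmod (gauss_shift \<alpha> f \<nu> ?\<zeta>)" by (simp add: norm_gauss_shift)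
  also have "\<dots> \<le> 1 / (1 - cmod ?\<zeta>) * circle_mean \<alpha> f \<nu>"
    unfolding circle_mean_def using \<zeta> by (intro Cauchy_circle_bound gauss_shift_holomorphic f) auto
  also have "\<dots> \<le> 4 * circle_mean \<alpha> f \<nu>"
    using \<zeta> circle_mean_nonneg[OF f] by (intro mult_right_mono) (auto simp: field_simps)
  finally show ?thesis by simp
qed

context fock_weight
begin

text \<open>Duality of weighted sequence spaces: divided by \<open>H \<nu> powr (1 / p)\<close>, the
  coefficients have \<open>u \<nu>\<close> as their powers of exponent p/(p-1), so Hoelder's
  inequality against the sampling bound gives the norm. The bound is uniform in signs and circle
  point, over which the functionals are averaged later.\<close>

lemma sampling_functional_in_dual_ball:
  assumes samp: "\<And>f. f \<in> carrier_of Fock \<Longrightarrow>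
      (\<Sum>\<nu>\<in>F. H \<nu> * cmod (gauss_shift \<alpha> f \<nu> \<zeta>) powr p) \<le> K * norm_of Fock f powr p"
    and F: "finite F" and K: "K > 0" and U: "U > 0" and u: "\<And>\<nu>. 0 \<le> u \<nu>" "(\<Sum>\<nu>\<in>F. u \<nu>) \<le> U"
    and \<epsilon>: "\<And>\<nu>. \<bar>\<epsilon> \<nu>\<bar> = 1"
  shows "(\<lambda>f. (\<Sum>\<nu>\<in>F. \<epsilon> \<nu> *\<^sub>R (of_real (H \<nu> powr (1 / p) * u \<nu> powr (1 - 1 / p)) * gauss_shift \<alpha> f \<nu> \<zeta>))
      / of_real (K powr (1 / p) * U powr (1 - 1 / p))) \<in> dual_ball Fock"
proof -
  let ?d = "\<lambda>\<nu>. H \<nu> powr (1 / p) * u \<nu> powr (1 - 1 / p)"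
  let ?\<kappa> = "K powr (1 / p) * U powr (1 - 1 / p)"
  have \<kappa>: "?\<kappa> > 0" using K U by simp
  have bound: "cmod (\<Sum>\<nu>\<in>F. \<epsilon> \<nu> *\<^sub>R (of_real (?d \<nu>) * gauss_shift \<alpha> f \<nu> \<zeta>)) \<le> ?\<kappa> * norm_of Fock f"
    if f: "f \<in> carrier_of Fock" for f
  proof -
    have "cmod (\<Sum>\<nu>\<in>F. \<epsilon> \<nu> *\<^sub>R (of_real (?d \<nu>) * gauss_shift \<alpha> f \<nu> \<zeta>)) \<le> (\<Sum>\<nu>\<in>F. ?d \<nu> * cmod (gauss_shift \<alpha> f \<nu> \<zeta>))"
      by (rule order_trans[OF norm_sum]) (simp add: norm_mult \<epsilon>)
    also have "\<dots> = (\<Sum>\<nu>\<in>F. (H \<nu> * cmod (gauss_shift \<alpha> f \<nu> \<zeta>) powr p) powr (1 / p) * u \<nu> powr (1 - 1 / p))"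
      using H_pos p by (intro sum.cong) (auto simp: powr_mult powr_powr less_imp_le)
    also have "\<dots> \<le> (\<Sum>\<nu>\<in>F. H \<nu> * cmod (gauss_shift \<alpha> f \<nu> \<zeta>) powr p) powr (1 / p) * (\<Sum>\<nu>\<in>F. u \<nu>) powr (1 - 1 / p)"
      using p F u by (intro sum_Hoelder) auto
    also have "\<dots> \<le> (K * norm_of Fock f powr p) powr (1 / p) * U powr (1 - 1 / p)"
      using p u samp[OF f] by (intro mult_mono powr_mono2) (auto intro!: sum_nonneg)
    also have "\<dots> = ?\<kappa> * norm_of Fock f"
      using K p Fock_norm_nonneg[of f] by (simp add: powr_mult powr_powr)
    finally show ?thesis .
  qed
  show ?thesis
    unfolding dual_ball_def
  proof (intro CollectI conjI ballI allI)
    fix f assume "f \<in> carrier_of Fock"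
    from bound[OF this] show "cmod ((\<Sum>\<nu>\<in>F. \<epsilon> \<nu> *\<^sub>R (of_real (?d \<nu>) * gauss_shift \<alpha> f \<nu> \<zeta>)) / of_real ?\<kappa>) \<le> norm_of Fock f"
      using \<kappa> by (simp add: norm_divide field_simps del: of_real_mult)
  qed (simp_all add: gauss_shift_add gauss_shift_cmult distrib_left scaleR_add_right sum.distrib add_divide_distrib
      sum_distrib_left sum_divide_distrib mult_ac scaleR_conv_of_real)
qed

text \<open>The finite form of the domination. \<open>main\<close> bounds the left side for one
  function by a mean of |\<phi> f| over signs and circle points, all \<phi> being in the dual ball.
  Convexity moves the r-th power inside these means, where the weak bound \<open>B\<close> applies
  to each functional separately.\<close>

lemma finite_lattice_sampling_bound:
  fixes n :: nat
  assumes q: "1 \<le> q" "q \<le> 2" and s: "1 / s = 1 + q / 2 - q / p" "s > 0"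
    and samp: "\<And>f \<zeta>. f \<in> carrier_of Fock \<Longrightarrow> cmod \<zeta> = 1 \<Longrightarrow>
      (\<Sum>\<nu>\<in>F. H \<nu> * cmod (gauss_shift \<alpha> f \<nu> \<zeta>) powr p) \<le> K * norm_of Fock f powr p"
    and F: "finite F" and K: "K > 0" and U: "U > 0" and l: "\<And>\<nu>. 0 \<le> l \<nu>" "(\<Sum>\<nu>\<in>F. l \<nu> powr s) \<le> U"
    and r: "1 \<le> r" and x: "\<And>j. j < n \<Longrightarrow> x j \<in> carrier_of Fock"
    and B: "0 \<le> B" "\<And>\<phi>. \<phi> \<in> dual_ball Fock \<Longrightarrow> (\<Sum>j<n. cmod (\<phi> (x j)) powr r) \<le> B powr r"
  shows "(\<Sum>j<n. (\<Sum>\<nu>\<in>F. l \<nu> * H \<nu> powr (q / p) * circle_mean \<alpha> (x j) \<nu> powr q) powr (r / q))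
    \<le> (9 / 5 * K powr (1 / p) * U powr (1 / (q * s)) * B) powr r"
proof -
  \<comment> \<open>This choice explains \<open>s\<close>: in \<open>summand\<close>, Hoelder's
    inequality and the functionals contribute the exponents 1 - q/2 and q(1 - 1/p) of
    \<open>u\<close>, whose sum is 1/s.\<close>
  define u where "u \<nu> = l \<nu> powr s" for \<nu>
  define d where "d \<nu> = H \<nu> powr (1 / p) * u \<nu> powr (1 - 1 / p)" for \<nu>
  have d0: "0 \<le> d \<nu>" for \<nu> by (simp add: d_def)
  define \<kappa> where "\<kappa> = K powr (1 / p) * U powr (1 - 1 / p)"
  have \<kappa>: "\<kappa> > 0" using K U by (simp add: \<kappa>_def)
  define X where "X A t f = (\<Sum>\<nu>\<in>F. sgn_of A \<nu> *\<^sub>R (of_real (d \<nu>) * gauss_shift \<alpha> f \<nu> (circle_point t)))" for A t f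
  define \<phi> where "\<phi> A t f = X A t f / of_real \<kappa>" for A t f
  define h where "h t f = (\<Sum>A\<in>Pow F. cmod (\<phi> A t f)) / 2 ^ card F" for t f
  have circ: "cmod (circle_point t) = 1" for t by (simp add: norm_exp_eq_Re)
  have \<phi>: "\<phi> A t \<in> dual_ball Fock" for A t
    unfolding \<phi>_def[abs_def] X_def \<kappa>_def d_def
    using F K U l unfolding u_def by (intro sampling_functional_in_dual_ball samp circ) simp_all
  have h0: "0 \<le> h t f" for t f by (simp add: h_def sum_nonneg)
  have hr: "(\<Sum>j<n. h t (x j) powr r) \<le> B powr r" for t
  proof -
    have cP: "real (card (Pow F)) = 2 ^ card F" using F by (simp add: card_Pow)
    have "h t (x j) powr r \<le> (\<Sum>A\<in>Pow F. cmod (\<phi> A t (x j)) powr r) / 2 ^ card F" for j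
    proof -
      have "h t (x j) powr r = (\<Sum>A\<in>Pow F. cmod (\<phi> A t (x j))) powr r / (2 ^ card F) powr r"
        unfolding h_def by (rule powr_divide)
      also have "\<dots> \<le> (2 ^ card F) powr (r - 1) * (\<Sum>A\<in>Pow F. cmod (\<phi> A t (x j)) powr r) / (2 ^ card F) powr r"
        using power_mean_le[of "Pow F" "\<lambda>A. cmod (\<phi> A t (x j))" r] F r cP
        by (intro divide_right_mono) auto
      also have "\<dots> = (\<Sum>A\<in>Pow F. cmod (\<phi> A t (x j)) powr r) / 2 ^ card F"
        by (simp add: powr_diff)
      finally show ?thesis .
    qed
    then have "(\<Sum>j<n. h t (x j) powr r) \<le> (\<Sum>j<n. (\<Sum>A\<in>Pow F. cmod (\<phi> A t (x j)) powr r) / 2 ^ card F)"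
      by (intro sum_mono) auto
    also have "\<dots> = (\<Sum>A\<in>Pow F. (\<Sum>j<n. cmod (\<phi> A t (x j)) powr r)) / 2 ^ card F"
      unfolding sum_divide_distrib[symmetric] by (subst sum.swap) simp
    also have "\<dots> \<le> (\<Sum>A\<in>Pow F. B powr r) / 2 ^ card F"
      by (intro divide_right_mono sum_mono B \<phi>) auto
    also have "\<dots> = B powr r" using F by (simp add: card_Pow)
    finally show ?thesis .
  qed
  have main: "(\<Sum>\<nu>\<in>F. l \<nu> * H \<nu> powr (q / p) * circle_mean \<alpha> f \<nu> powr q) powr (1 / q)
      \<le> 9 / 5 * K powr (1 / p) * U powr (1 / (q * s)) * integral {0..1} (\<lambda>t. h t f)"
    and hcont: "continuous_on {0..1} (\<lambda>t. h t f)"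
    if f: "f \<in> carrier_of Fock" for f
  proof -
    have hol: "f holomorphic_on UNIV" using f by (simp add: Fock_carrier)
    note cont = continuous_gauss_shift_circle[OF hol]
    show hcont: "continuous_on {0..1} (\<lambda>t. h t f)"
      unfolding h_def \<phi>_def X_def using \<kappa> by (intro continuous_intros cont) auto
    let ?M = "circle_mean \<alpha> f"
    have M0: "0 \<le> ?M \<nu>" for \<nu> by (rule circle_mean_nonneg[OF hol])
    have summand: "l \<nu> * H \<nu> powr (q / p) * ?M \<nu> powr q = ((d \<nu> * ?M \<nu>)\<^sup>2) powr (q / 2) * u \<nu> powr (1 - q / 2)" for \<nu>
    proof (cases "l \<nu> = 0")
      case True
      then show ?thesis using s by (simp add: d_def u_def)
    next
      case False
      then have l0: "l \<nu> > 0" using l(1)[of \<nu>] by simp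
      have "((d \<nu> * ?M \<nu>)\<^sup>2) powr (q / 2) = (d \<nu> * ?M \<nu>) powr q"
        using d0[of \<nu>] M0[of \<nu>] by (simp add: square_powr_half)
      also have "\<dots> = H \<nu> powr (q / p) * u \<nu> powr (q * (1 - 1 / p)) * ?M \<nu> powr q"
        using M0[of \<nu>] unfolding d_def by (simp add: powr_mult powr_powr mult.commute)
      finally have "((d \<nu> * ?M \<nu>)\<^sup>2) powr (q / 2) * u \<nu> powr (1 - q / 2)
          = H \<nu> powr (q / p) * ?M \<nu> powr q * (u \<nu> powr (q * (1 - 1 / p)) * u \<nu> powr (1 - q / 2))" by simp
      also have "u \<nu> powr (q * (1 - 1 / p)) * u \<nu> powr (1 - q / 2) = u \<nu> powr (1 / s)"
        unfolding powr_add[symmetric] s(1) by (simp add: algebra_simps)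
      also have "u \<nu> powr (1 / s) = l \<nu>" using l0 s(2) by (simp add: u_def powr_powr)
      finally show ?thesis by (simp add: mult_ac)
    qed
    have "(\<Sum>\<nu>\<in>F. l \<nu> * H \<nu> powr (q / p) * ?M \<nu> powr q)
        \<le> (\<Sum>\<nu>\<in>F. (d \<nu> * ?M \<nu>)\<^sup>2) powr (q / 2) * (\<Sum>\<nu>\<in>F. u \<nu>) powr (1 - q / 2)"
      unfolding summand using F q by (intro sum_Hoelder) (auto simp: u_def)
    also have "\<dots> \<le> (\<Sum>\<nu>\<in>F. (d \<nu> * ?M \<nu>)\<^sup>2) powr (q / 2) * U powr (1 - q / 2)"
      using q l by (intro mult_left_mono powr_mono2) (auto intro!: sum_nonneg simp: u_def)
    finally have "(\<Sum>\<nu>\<in>F. l \<nu> * H \<nu> powr (q / p) * ?M \<nu> powr q) powr (1 / q)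
        \<le> ((\<Sum>\<nu>\<in>F. (d \<nu> * ?M \<nu>)\<^sup>2) powr (q / 2) * U powr (1 - q / 2)) powr (1 / q)"
      using q l by (intro powr_mono2) (auto intro!: sum_nonneg)
    also have "\<dots> = sqrt (\<Sum>\<nu>\<in>F. (d \<nu> * ?M \<nu>)\<^sup>2) * U powr (1 / q - 1 / 2)"
      using q by (simp add: powr_mult powr_powr powr_half_sqrt sum_nonneg diff_divide_distrib)
    \<comment> \<open>Minkowski's inequality takes the circle mean out of the l2 norm before
      Khinchin's inequality is applied, because each functional evaluates all the shifts at one
      common circle point.\<close>
    also have "sqrt (\<Sum>\<nu>\<in>F. (d \<nu> * ?M \<nu>)\<^sup>2) \<le> 9 / 5 * \<kappa> * integral {0..1} (\<lambda>t. h t f)"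
    proof -
      let ?g = "\<lambda>\<nu> t. d \<nu> * cmod (gauss_shift \<alpha> f \<nu> (circle_point t))"
      have cg: "continuous_on {0..1} (?g \<nu>)" for \<nu> by (intro continuous_intros cont)
      have "sqrt (\<Sum>\<nu>\<in>F. (d \<nu> * ?M \<nu>)\<^sup>2) = sqrt (\<Sum>\<nu>\<in>F. (integral {0..1} (?g \<nu>))\<^sup>2)"
        by (simp add: circle_mean_def)
      also have "\<dots> \<le> integral {0..1} (\<lambda>t. sqrt (\<Sum>\<nu>\<in>F. (?g \<nu> t)\<^sup>2))"
        by (rule integral_L2_Minkowski[OF F cg])
      also have "\<dots> \<le> integral {0..1} (\<lambda>t. 9 / 5 * \<kappa> * h t f)"
      proof (intro integral_le integrable_continuous_real)
        show "continuous_on {0..1} (\<lambda>t. sqrt (\<Sum>\<nu>\<in>F. (?g \<nu> t)\<^sup>2))" by (intro continuous_intros cont)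
        show "continuous_on {0..1} (\<lambda>t. 9 / 5 * \<kappa> * h t f)" by (intro continuous_intros hcont)
        fix t
        have "2 ^ card F * sqrt (\<Sum>\<nu>\<in>F. (?g \<nu> t)\<^sup>2) \<le> 9 / 5 * (\<Sum>A\<in>Pow F. cmod (X A t f))"
          using Khinchin_L1[OF F, of "\<lambda>\<nu>. of_real (d \<nu>) * gauss_shift \<alpha> f \<nu> (circle_point t)"] d0
          unfolding X_def by (simp add: norm_mult)
        also have "\<dots> = 2 ^ card F * (9 / 5 * \<kappa> * h t f)"
          using \<kappa> unfolding h_def \<phi>_def by (simp add: norm_divide sum_divide_distrib[symmetric])
        finally show "sqrt (\<Sum>\<nu>\<in>F. (?g \<nu> t)\<^sup>2) \<le> 9 / 5 * \<kappa> * h t f" by simp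
      qed
      finally show ?thesis by simp
    qed
    also have "9 / 5 * \<kappa> * integral {0..1} (\<lambda>t. h t f) * U powr (1 / q - 1 / 2)
        = 9 / 5 * K powr (1 / p) * (U powr (1 - 1 / p) * U powr (1 / q - 1 / 2)) * integral {0..1} (\<lambda>t. h t f)"
      by (simp add: \<kappa>_def)
    also have "U powr (1 - 1 / p) * U powr (1 / q - 1 / 2) = U powr (1 / (q * s))"
    proof -
      have "1 / (q * s) = (1 / s) / q" by simp
      also have "\<dots> = 1 - 1 / p + (1 / q - 1 / 2)" unfolding s(1) using q p by (simp add: field_simps)
      finally show ?thesis by (simp only: powr_add[symmetric])
    qed
    finally show "(\<Sum>\<nu>\<in>F. l \<nu> * H \<nu> powr (q / p) * circle_mean \<alpha> f \<nu> powr q) powr (1 / q)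
      \<le> 9 / 5 * K powr (1 / p) * U powr (1 / (q * s)) * integral {0..1} (\<lambda>t. h t f)"
      by (simp add: mult_right_mono)
  qed
  let ?c = "9 / 5 * K powr (1 / p) * U powr (1 / (q * s))"
  have "(\<Sum>j<n. (\<Sum>\<nu>\<in>F. l \<nu> * H \<nu> powr (q / p) * circle_mean \<alpha> (x j) \<nu> powr q) powr (r / q))
      \<le> (\<Sum>j<n. ?c powr r * integral {0..1} (\<lambda>t. h t (x j) powr r))"
  proof (rule sum_mono)
    fix j assume "j \<in> {..<n}"
    then have xj: "x j \<in> carrier_of Fock" using x by simp
    let ?S = "\<Sum>\<nu>\<in>F. l \<nu> * H \<nu> powr (q / p) * circle_mean \<alpha> (x j) \<nu> powr q"
    have i0: "0 \<le> integral {0..1} (\<lambda>t. h t (x j))"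
      by (intro integral_nonneg integrable_continuous_real hcont xj h0)
    have "?S powr (r / q) = (?S powr (1 / q)) powr r" by (simp add: powr_powr)
    also have "\<dots> \<le> (?c * integral {0..1} (\<lambda>t. h t (x j))) powr r"
      using r main[OF xj] by (intro powr_mono2) auto
    also have "\<dots> = ?c powr r * (integral {0..1} (\<lambda>t. h t (x j))) powr r"
      using i0 by (subst powr_mult) auto
    also have "\<dots> \<le> ?c powr r * integral {0..1} (\<lambda>t. h t (x j) powr r)"
      using r by (intro mult_left_mono integral_powr_Jensen hcont xj h0) auto
    finally show "?S powr (r / q) \<le> ?c powr r * integral {0..1} (\<lambda>t. h t (x j) powr r)" .
  qed
  also have "\<dots> = ?c powr r * integral {0..1} (\<lambda>t. \<Sum>j<n. h t (x j) powr r)"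
    using x h0 r unfolding sum_distrib_left[symmetric]
    by (subst integral_sum) (auto intro!: integrable_continuous_real continuous_on_powr_const hcont)
  also have "\<dots> \<le> ?c powr r * integral {0..1::real} (\<lambda>t. B powr r)"
    using x h0 r hr
    by (intro mult_left_mono integral_le) (auto intro!: integrable_continuous_real continuous_intros continuous_on_powr_const hcont)
  also have "\<dots> = (?c * B) powr r" using B(1) by (subst powr_mult) auto
  finally show ?thesis .
qed

end

lemma gauss_space_carrier:
  "f \<in> carrier_of (gauss_Lebesgue_space \<alpha> q \<mu>) \<longleftrightarrow>
     f \<in> borel_measurable \<mu> \<and> (\<integral>\<^sup>+z. ennreal (gauss_abs \<alpha> f z powr q) \<partial>\<mu>) < \<infinity>"
  by (simp add: gauss_Lebesgue_space_def gauss_abs_powr)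

lemma gauss_space_norm:
  "norm_of (gauss_Lebesgue_space \<alpha> q \<mu>) f = enn2real (\<integral>\<^sup>+z. ennreal (gauss_abs \<alpha> f z powr q) \<partial>\<mu>) powr (1 / q)"
  by (simp add: gauss_Lebesgue_space_def gauss_abs_powr)

lemma enn_powr_ennreal [simp]: "x \<ge> 0 \<Longrightarrow> enn_powr (ennreal x) a = ennreal (x powr a)"
  by (simp add: enn_powr_def)

lemma mass_ratio_eq:
  assumes H: "0 < H \<nu>" and fin: "mass_ratio e H \<mu> \<nu> < \<infinity>"
  shows "emeasure \<mu> (square 1 \<nu>) = ennreal (enn2real (mass_ratio e H \<mu> \<nu>) * H \<nu> powr e)"
proof (cases "emeasure \<mu> (square 1 \<nu>)")
  case (real m)
  have "mass_ratio e H \<mu> \<nu> = ennreal (m / H \<nu> powr e)"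
    using real H by (simp add: mass_ratio_def divide_ennreal)
  then show ?thesis using real H by simp
next
  case top
  then have "mass_ratio e H \<mu> \<nu> = \<infinity>" by (simp add: mass_ratio_def ennreal_top_divide)
  then show ?thesis using fin by simp
qed

lemma mass_ratio_eq_mult:
  assumes "0 < H \<nu>"
  shows "mass_ratio e H \<mu> \<nu> = ennreal (H \<nu> powr (- e)) * emeasure \<mu> (square 1 \<nu>)"
proof -
  have "H \<nu> powr e > 0" using assms by simp
  then show ?thesis
    by (simp add: mass_ratio_def divide_ennreal_def inverse_ennreal powr_minus mult.commute)
qed

lemma ell_space_finite:
  assumes "a \<in> ell_space s" "\<nu> \<in> lattice"
  shows "a \<nu> < \<infinity>"
proof (rule ccontr)
  assume "\<not> ?thesis"
  then have "enn_powr (a \<nu>) s = \<infinity>" by (simp add: enn_powr_def less_top[symmetric])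
  moreover have "(\<Sum>\<nu>\<in>{\<nu>}. enn_powr (a \<nu>) s) \<le> (\<integral>\<^sup>+\<nu>. enn_powr (a \<nu>) s \<partial>count_space lattice)"
    using assms by (intro sum_le_nn_integral_count_space) auto
  ultimately show False using assms by (simp add: ell_space_def top_unique)
qed

lemma ell_space_sum_le:
  assumes a: "a \<in> ell_space s" and F: "finite F" "F \<subseteq> lattice"
  shows "(\<Sum>\<nu>\<in>F. enn2real (a \<nu>) powr s) \<le> enn2real (\<integral>\<^sup>+\<nu>. enn_powr (a \<nu>) s \<partial>count_space lattice)"
proof -
  let ?W = "\<integral>\<^sup>+\<nu>. enn_powr (a \<nu>) s \<partial>count_space lattice"
  have "ennreal (\<Sum>\<nu>\<in>F. enn2real (a \<nu>) powr s) = (\<Sum>\<nu>\<in>F. enn_powr (a \<nu>) s)"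
  proof (subst sum_ennreal[symmetric], simp, intro sum.cong refl)
    fix \<nu> assume "\<nu> \<in> F"
    then have "a \<nu> < \<infinity>" using ell_space_finite[OF a] F by auto
    then show "ennreal (enn2real (a \<nu>) powr s) = enn_powr (a \<nu>) s" by (simp add: enn_powr_def)
  qed
  also have "\<dots> \<le> ?W" by (rule sum_le_nn_integral_count_space[OF F])
  also have "\<dots> = ennreal (enn2real ?W)" using a by (simp add: ell_space_def)
  finally show ?thesis by (subst (asm) ennreal_le_iff) auto
qed

context fock_weight
begin

text \<open>Passage from finite subsets to the whole lattice. The constant is chosen before
  \<open>\<mu>\<close> and \<open>r\<close>, as the norm comparison requires.\<close>

lemma summing_of_mass_ratio:
  assumes q: "1 \<le> q" "q \<le> 2" and s: "1 / s = 1 + q / 2 - q / p" "s > 0"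
  obtains c where "c > 0"
    "\<And>\<mu> r. sets \<mu> = sets borel \<Longrightarrow> mass_ratio (q / p) H \<mu> \<in> ell_space s \<Longrightarrow> 1 \<le> r \<Longrightarrow>
      linear_map Fock (gauss_Lebesgue_space \<alpha> q \<mu>) (\<lambda>f. f) \<and>
      summing_bound r Fock (gauss_Lebesgue_space \<alpha> q \<mu>) (\<lambda>f. f)
        (c * ell_norm s (mass_ratio (q / p) H \<mu>) powr (1 / q))"
proof -
  obtain K where K: "K > 0" and samp: "\<And>F f \<zeta>. finite F \<Longrightarrow> F \<subseteq> lattice \<Longrightarrow> f \<in> carrier_of Fock \<Longrightarrow> cmod \<zeta> = 1 \<Longrightarrow>
     (\<Sum>\<nu>\<in>F. H \<nu> * cmod (gauss_shift \<alpha> f \<nu> \<zeta>) powr p) \<le> K * norm_of Fock f powr p"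
    by (rule lattice_sampling) (rule that; iprover)
  define c where "c = 9 / 5 * K powr (1 / p)"
  have c: "c > 0" using K by (simp add: c_def)
  let ?X = Fock
  show ?thesis
  proof (rule that[of "4 * c"])
    show "4 * c > 0" using c by simp
    fix \<mu> :: "complex measure" and r :: real
    assume sets: "sets \<mu> = sets borel" and a: "mass_ratio (q / p) H \<mu> \<in> ell_space s" and r: "1 \<le> r"
    let ?Y = "gauss_Lebesgue_space \<alpha> q \<mu>"
    define l where "l \<nu> = enn2real (mass_ratio (q / p) H \<mu> \<nu>)" for \<nu>
    have l0: "0 \<le> l \<nu>" for \<nu> by (simp add: l_def)
    have \<mu>Q: "emeasure \<mu> (square 1 \<nu>) = ennreal (l \<nu> * H \<nu> powr (q / p))" if "\<nu> \<in> lattice" for \<nu>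
      unfolding l_def by (intro mass_ratio_eq H_pos ell_space_finite[OF a that])
    define W where "W = enn2real (\<integral>\<^sup>+\<nu>. enn_powr (mass_ratio (q / p) H \<mu> \<nu>) s \<partial>count_space lattice)"
    have W0: "0 \<le> W" by (simp add: W_def)
    have lW: "(\<Sum>\<nu>\<in>F. l \<nu> powr s) \<le> W" if "finite F" "F \<subseteq> lattice" for F
      unfolding l_def W_def by (rule ell_space_sum_le[OF a that])
    define b where "b f \<nu> = l \<nu> * H \<nu> powr (q / p) * circle_mean \<alpha> f \<nu> powr q" for f \<nu>
    have b0: "0 \<le> b f \<nu>" for f \<nu> using l0 by (simp add: b_def)
    have core: "(\<Sum>j<n. (\<Sum>\<nu>\<in>F. b (x j) \<nu>) powr (r / q)) \<le> (c * W powr (1 / (q * s)) * B) powr r"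
      if F: "finite F" "F \<subseteq> lattice" and x: "\<And>j. j < n \<Longrightarrow> x j \<in> carrier_of ?X"
        and B: "0 \<le> B" "\<And>\<phi>. \<phi> \<in> dual_ball ?X \<Longrightarrow> (\<Sum>j<n. cmod (\<phi> (x j)) powr r) \<le> B powr r" for F and n :: nat and x B
    \<comment> \<open>The finite bound asks for a strictly positive \<open>U\<close>; if
      \<open>W\<close> vanishes, so does every \<open>l \<nu>\<close> with \<nu> in
      \<open>F\<close>.\<close>
    proof (cases "W = 0")
      case True
      have "l \<nu> = 0" if "\<nu> \<in> F" for \<nu>
      proof -
        have "l \<nu> powr s \<le> 0" using lW[of "{\<nu>}"] that F True by auto
        then have "l \<nu> powr s = 0" using powr_ge_zero[of "l \<nu>" s] by linarith
        then show ?thesis by simp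
      qed
      then show ?thesis by (simp add: b_def)
    next
      case False
      then have "W > 0" using W0 by simp
      then show ?thesis
        unfolding b_def c_def
        using samp[OF F] F(1) K l0 lW[OF F] r x B by (intro finite_lattice_sampling_bound[OF q s]) blast+
    qed
    let ?e = "from_nat_into lattice"
    have bij: "bij_betw ?e UNIV lattice" by (rule bij_betw_from_nat_into[OF lattice_countable infinite_lattice])
    have part: "(\<Sum>i<N. g (?e i)) = (\<Sum>\<nu>\<in>?e ` {..<N}. g \<nu>)" for g :: "complex \<Rightarrow> real" and N
      using bij by (subst sum.reindex) (auto simp: bij_betw_def intro: inj_on_subset)
    have eF: "finite (?e ` {..<N})" "?e ` {..<N} \<subseteq> lattice" for N
      using bij by (auto simp: bij_betw_def)
    \<comment> \<open>The bound for the family consisting of \<open>f\<close> alone, with its norm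
      as \<open>B\<close>, controls the partial sums. Convergence of this series is what puts
      \<open>f\<close> into the target space.\<close>
    have summ: "summable (\<lambda>i. b f (?e i))" if f: "f \<in> carrier_of ?X" for f
    proof (rule summableI_nonneg_bounded)
      fix N
      let ?R = "(c * W powr (1 / (q * s)) * norm_of ?X f) powr r"
      have "(\<Sum>j<(1::nat). (\<Sum>\<nu>\<in>?e ` {..<N}. b f \<nu>) powr (r / q)) \<le> ?R"
        using f r Fock_norm_nonneg[of f]
        by (intro core eF) (auto intro!: powr_mono2 simp: dual_ball_def)
      then have "((\<Sum>i<N. b f (?e i)) powr (r / q)) powr (q / r) \<le> ?R powr (q / r)"
        using r q by (intro powr_mono2) (auto simp: part)
      then show "(\<Sum>i<N. b f (?e i)) \<le> ?R powr (q / r)"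
        using r q b0 by (simp add: powr_powr sum_nonneg)
    qed (rule b0)
    have integral_le: "(\<integral>\<^sup>+z. ennreal (gauss_abs \<alpha> f z powr q) \<partial>\<mu>) \<le> ennreal (4 powr q * (\<Sum>i. b f (?e i)))"
      if f: "f \<in> carrier_of ?X" for f
    proof -
      have hol: "f holomorphic_on UNIV" using f by (simp add: Fock_carrier)
      have [measurable]: "gauss_abs \<alpha> f \<in> borel_measurable \<mu>"
        using gauss_abs_measurable[OF hol] sets by (simp cong: measurable_cong_sets)
      have "(\<integral>\<^sup>+z. ennreal (gauss_abs \<alpha> f z powr q) \<partial>\<mu>)
          = (\<integral>\<^sup>+\<nu>. (\<integral>\<^sup>+z\<in>square 1 \<nu>. ennreal (gauss_abs \<alpha> f z powr q) \<partial>\<mu>) \<partial>count_space lattice)"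
        using sets by (intro nn_integral_lattice) auto
      also have "\<dots> \<le> (\<integral>\<^sup>+\<nu>. ennreal (4 powr q * b f \<nu>) \<partial>count_space lattice)"
      proof (rule nn_integral_mono)
        fix \<nu> assume "\<nu> \<in> space (count_space lattice)"
        then have \<nu>: "\<nu> \<in> lattice" by simp
        have "(\<integral>\<^sup>+z\<in>square 1 \<nu>. ennreal (gauss_abs \<alpha> f z powr q) \<partial>\<mu>)
            \<le> (\<integral>\<^sup>+z. ennreal ((4 * circle_mean \<alpha> f \<nu>) powr q) * indicator (square 1 \<nu>) z \<partial>\<mu>)"
          using q gauss_abs_le_circle_mean[OF hol \<alpha>]
          by (intro nn_integral_mono) (auto split: split_indicator intro!: ennreal_leI powr_mono2)
        also have "\<dots> = ennreal ((4 * circle_mean \<alpha> f \<nu>) powr q) * emeasure \<mu> (square 1 \<nu>)"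
          using sets by (intro nn_integral_cmult_indicator) simp
        also have "\<dots> = ennreal (4 powr q * b f \<nu>)"
          unfolding \<mu>Q[OF \<nu>] b_def using l0 circle_mean_nonneg[OF hol]
          by (subst ennreal_mult[symmetric]) (auto simp: powr_mult mult_ac)
        finally show "(\<integral>\<^sup>+z\<in>square 1 \<nu>. ennreal (gauss_abs \<alpha> f z powr q) \<partial>\<mu>) \<le> ennreal (4 powr q * b f \<nu>)" .
      qed
      also have "\<dots> = (\<Sum>i. ennreal (4 powr q * b f (?e i)))"
        by (subst nn_integral_bij_count_space[symmetric, OF bij], rule nn_integral_count_space_nat)
      also have "\<dots> = ennreal (\<Sum>i. 4 powr q * b f (?e i))"
        using b0 summ[OF f] by (intro suminf_ennreal2) (auto intro: summable_mult)
      also have "\<dots> = ennreal (4 powr q * (\<Sum>i. b f (?e i)))"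
        by (simp add: suminf_mult summ[OF f])
      finally show ?thesis .
    qed
    have mem: "f \<in> carrier_of ?Y" if f: "f \<in> carrier_of ?X" for f
    proof -
      have "continuous_on UNIV f" using f by (simp add: Fock_carrier holomorphic_on_imp_continuous_on)
      then have "f \<in> borel_measurable borel" by (rule borel_measurable_continuous_onI)
      then have "f \<in> borel_measurable \<mu>" using sets by (simp cong: measurable_cong_sets)
      moreover have "(\<integral>\<^sup>+z. ennreal (gauss_abs \<alpha> f z powr q) \<partial>\<mu>) < \<infinity>"
        by (rule order_le_less_trans[OF integral_le[OF f]]) simp
      ultimately show ?thesis by (simp add: gauss_space_carrier)
    qed
    have norm_le: "norm_of ?Y f \<le> 4 * (\<Sum>i. b f (?e i)) powr (1 / q)" if f: "f \<in> carrier_of ?X" for f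
    proof -
      have pos: "0 \<le> (\<Sum>i. b f (?e i))" by (intro suminf_nonneg summ f b0)
      have "enn2real (\<integral>\<^sup>+z. ennreal (gauss_abs \<alpha> f z powr q) \<partial>\<mu>) \<le> 4 powr q * (\<Sum>i. b f (?e i))"
        using enn2real_mono[OF integral_le[OF f]] pos by simp
      then have "norm_of ?Y f \<le> (4 powr q * (\<Sum>i. b f (?e i))) powr (1 / q)"
        unfolding gauss_space_norm using q by (intro powr_mono2) auto
      then show ?thesis using q pos by (simp add: powr_mult powr_powr)
    qed
    have "summing_bound r ?X ?Y (\<lambda>f. f) (4 * c * W powr (1 / (q * s)))"
      unfolding summing_bound_def
    proof (intro conjI allI impI)
      show "0 \<le> 4 * c * W powr (1 / (q * s))" using c by simp
      fix n :: nat and x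
      assume x': "\<forall>j<n. x j \<in> carrier_of ?X"
      then have x: "x j \<in> carrier_of ?X" if "j < n" for j using that by blast
      define B where "B = (SUP \<phi>\<in>dual_ball ?X. (\<Sum>j<n. cmod (\<phi> (x j)) powr r) powr (1 / r))"
      have up: "(\<Sum>j<n. cmod (\<phi> (x j)) powr r) powr (1 / r) \<le> B" if "\<phi> \<in> dual_ball ?X" for \<phi>
        unfolding B_def using r that x by (intro dual_ball_sup_upper) auto
      have B0: "0 \<le> B" using up[OF zero_in_dual_ball[OF Fock_norm_nonneg]] r by simp
      have up': "(\<Sum>j<n. cmod (\<phi> (x j)) powr r) \<le> B powr r" if "\<phi> \<in> dual_ball ?X" for \<phi>
      proof -
        have "((\<Sum>j<n. cmod (\<phi> (x j)) powr r) powr (1 / r)) powr r \<le> B powr r"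
          using up[OF that] r by (intro powr_mono2) auto
        then show ?thesis using r by (simp add: powr_powr sum_nonneg)
      qed
      \<comment> \<open>The bound is uniform over finite sets, so it survives the limit along an
        enumeration of the lattice.\<close>
      have lim: "(\<lambda>N. \<Sum>j<n. (\<Sum>i<N. b (x j) (?e i)) powr (r / q)) \<longlonglongrightarrow> (\<Sum>j<n. (\<Sum>i. b (x j) (?e i)) powr (r / q))"
        using q r b0 x
        by (intro tendsto_sum tendsto_powr' summable_LIMSEQ summ tendsto_const) (auto intro!: always_eventually sum_nonneg)
      have sumB: "(\<Sum>j<n. (\<Sum>i. b (x j) (?e i)) powr (r / q)) \<le> (c * W powr (1 / (q * s)) * B) powr r"
      proof (rule LIMSEQ_le_const2[OF lim], intro exI[of _ 0] allI impI)
        fix N :: nat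
        show "(\<Sum>j<n. (\<Sum>i<N. b (x j) (?e i)) powr (r / q)) \<le> (c * W powr (1 / (q * s)) * B) powr r"
          unfolding part using x up' by (intro core eF B0) blast+
      qed
      have "(\<Sum>j<n. norm_of ?Y (x j) powr r) \<le> (\<Sum>j<n. 4 powr r * (\<Sum>i. b (x j) (?e i)) powr (r / q))"
      proof (rule sum_mono)
        fix j assume "j \<in> {..<n}"
        then have xj: "x j \<in> carrier_of ?X" using x by simp
        have "norm_of ?Y (x j) powr r \<le> (4 * (\<Sum>i. b (x j) (?e i)) powr (1 / q)) powr r"
          using r norm_le[OF xj] by (intro powr_mono2) (auto simp: gauss_space_norm)
        then show "norm_of ?Y (x j) powr r \<le> 4 powr r * (\<Sum>i. b (x j) (?e i)) powr (r / q)"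
          by (simp add: powr_mult powr_powr)
      qed
      also have "\<dots> \<le> 4 powr r * (c * W powr (1 / (q * s)) * B) powr r"
        unfolding sum_distrib_left[symmetric] by (intro mult_left_mono sumB) auto
      also have "\<dots> = (4 * c * W powr (1 / (q * s)) * B) powr r"
        using c B0 by (simp add: powr_mult[symmetric] mult_ac)
      finally have "(\<Sum>j<n. norm_of ?Y (x j) powr r) powr (1 / r) \<le> ((4 * c * W powr (1 / (q * s)) * B) powr r) powr (1 / r)"
        using r by (intro powr_mono2) (auto intro: sum_nonneg)
      also have "\<dots> = 4 * c * W powr (1 / (q * s)) * B"
        using r c B0 by (simp add: powr_powr)
      finally show "(\<Sum>j<n. norm_of ?Y (x j) powr r) powr (1 / r) \<le> 4 * c * W powr (1 / (q * s)) *
          (SUP \<phi>\<in>dual_ball ?X. (\<Sum>j<n. cmod (\<phi> (x j)) powr r) powr (1 / r))"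
        unfolding B_def .
    qed
    moreover have "W powr (1 / (q * s)) = ell_norm s (mass_ratio (q / p) H \<mu>) powr (1 / q)"
      unfolding ell_norm_def W_def by (simp add: powr_powr mult.commute)
    moreover have "linear_map ?X ?Y (\<lambda>f. f)" using mem by (simp add: linear_map_def)
    ultimately show "linear_map ?X ?Y (\<lambda>f. f) \<and>
        summing_bound r ?X ?Y (\<lambda>f. f) (4 * c * ell_norm s (mass_ratio (q / p) H \<mu>) powr (1 / q))"
      by simp
  qed
qed

end

section \<open>Necessity of the summability condition\<close>

text \<open>The extremal choice \<beta> = a^(s/r) turns both \<beta>^q a and \<beta>^r into a^s,
  since s q/r + 1 = s. The hypothesis then reads \<open>T \<le> K * T powr (q / r)\<close>, and
  division leaves \<open>T powr (1 / s) \<le> K\<close>.\<close>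

lemma ell_space_duality:
  assumes s: "s > 0" "1 / s = 1 - q / r" and q: "0 < q" and r: "0 < r" and K: "0 \<le> K"
    and le: "\<And>F \<beta>. finite F \<Longrightarrow> F \<subseteq> lattice \<Longrightarrow> (\<And>\<nu>. 0 \<le> \<beta> \<nu>) \<Longrightarrow>
      (\<Sum>\<nu>\<in>F. ennreal (\<beta> \<nu> powr q) * a \<nu>) \<le> ennreal (K * (\<Sum>\<nu>\<in>F. \<beta> \<nu> powr r) powr (q / r))"
  shows "a \<in> ell_space s" "ell_norm s a \<le> K"
proof -
  \<comment> \<open>Terms may a priori be infinite; testing a single point with \<beta> = 1 excludes
    it.\<close>
  have fin: "a \<nu> < \<infinity>" if "\<nu> \<in> lattice" for \<nu>
    using le[of "{\<nu>}" "\<lambda>_. 1"] that by (auto simp: le_less_trans)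
  define l where "l \<nu> = enn2real (a \<nu>)" for \<nu>
  have l0: "0 \<le> l \<nu>" for \<nu> by (simp add: l_def)
  have al: "a \<nu> = ennreal (l \<nu>)" if "\<nu> \<in> lattice" for \<nu> using fin[OF that] by (simp add: l_def)
  have sr: "s * q / r + 1 = s" using s r by (simp add: field_simps)
  have "(\<Sum>\<nu>\<in>F. enn_powr (a \<nu>) s) \<le> ennreal (K powr s)" if F: "finite F" "F \<subseteq> lattice" for F
  proof -
    define T where "T = (\<Sum>\<nu>\<in>F. l \<nu> powr s)"
    have T0: "0 \<le> T" by (simp add: T_def sum_nonneg)
    have prod: "(l \<nu> powr (s / r)) powr q * l \<nu> = l \<nu> powr s" for \<nu>
    proof (cases "l \<nu> = 0")
      case False
      then have "(l \<nu> powr (s / r)) powr q * l \<nu> = l \<nu> powr (s * q / r + 1)"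
        using l0[of \<nu>] by (simp add: powr_powr powr_add)
      then show ?thesis by (simp only: sr)
    qed simp
    have "ennreal T = (\<Sum>\<nu>\<in>F. ennreal (l \<nu> powr s))" unfolding T_def by (intro sum_ennreal[symmetric]) simp
    also have "\<dots> = (\<Sum>\<nu>\<in>F. ennreal ((l \<nu> powr (s / r)) powr q) * a \<nu>)"
      using F l0 al by (intro sum.cong refl) (auto simp: prod subset_iff simp flip: ennreal_mult)
    also have "\<dots> \<le> ennreal (K * (\<Sum>\<nu>\<in>F. (l \<nu> powr (s / r)) powr r) powr (q / r))"
      by (intro le F) simp
    also have "(\<Sum>\<nu>\<in>F. (l \<nu> powr (s / r)) powr r) = T"
      using r by (simp add: powr_powr T_def)
    finally have TK: "T \<le> K * T powr (q / r)" using K by (subst (asm) ennreal_le_iff) auto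
    have "T powr (1 / s) \<le> K"
    proof (cases "T = 0")
      case False
      then have "T powr (1 / s) * T powr (q / r) = T" using T0 s(2) by (simp add: powr_add[symmetric])
      then have "T powr (1 / s) * T powr (q / r) \<le> K * T powr (q / r)" using TK by simp
      then show ?thesis using False by (subst (asm) mult_le_cancel_right_pos) (auto simp: powr_gt_zero)
    qed (use K in simp)
    then have "(T powr (1 / s)) powr s \<le> K powr s" using s by (intro powr_mono2) auto
    then have "T \<le> K powr s" using T0 s(1) by (simp add: powr_powr)
    moreover have "(\<Sum>\<nu>\<in>F. enn_powr (a \<nu>) s) = ennreal T"
    proof -
      have "(\<Sum>\<nu>\<in>F. enn_powr (a \<nu>) s) = (\<Sum>\<nu>\<in>F. ennreal (l \<nu> powr s))"
        using F al l0 by (intro sum.cong refl) (metis enn_powr_ennreal subsetD)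
      then show ?thesis unfolding T_def by simp
    qed
    ultimately show ?thesis by (simp add: ennreal_leI)
  qed
  then have I: "(\<integral>\<^sup>+\<nu>. enn_powr (a \<nu>) s \<partial>count_space lattice) \<le> ennreal (K powr s)"
    by (intro nn_integral_count_space_le lattice_countable)
  then show "a \<in> ell_space s" by (auto simp: ell_space_def intro: order_le_less_trans)
  have "enn2real (\<integral>\<^sup>+\<nu>. enn_powr (a \<nu>) s \<partial>count_space lattice) \<le> K powr s"
    using enn2real_mono[OF I] by simp
  then have "ell_norm s a \<le> (K powr s) powr (1 / s)" unfolding ell_norm_def using s(1) by (intro powr_mono2) auto
  then show "ell_norm s a \<le> K" using K s(1) by (simp add: powr_powr)
qed

text \<open>Completing the square. The free rate \<open>d\<close> lets a Gaussian absorb the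
  exponential growth of \<open>H\<close> and still leave rate 2 for the lattice sum.\<close>

lemma exp_square_le:
  fixes a :: real
  assumes "a > 0"
  shows "exp (- a * x\<^sup>2) \<le> exp (d\<^sup>2 / (4 * a)) * exp (- d * x)"
proof -
  have "0 \<le> a * (x - d / (2 * a))\<^sup>2" using assms by simp
  also have "\<dots> = a * x\<^sup>2 - d * x + d\<^sup>2 / (4 * a)" using assms by (simp add: power2_eq_square field_simps)
  finally show ?thesis unfolding mult_exp_exp by simp
qed

text \<open>Reindexing, because the families to be tested are indexed by the sign patterns
  \<open>Pow F\<close> instead of an initial segment.\<close>

lemma summing_bound_finite:
  assumes C: "summing_bound r X Y T C" and r: "0 < r" and I: "finite I" and x: "\<And>i. i \<in> I \<Longrightarrow> x i \<in> carrier_of X"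
    and X0: "\<And>f. f \<in> carrier_of X \<Longrightarrow> 0 \<le> norm_of X f"
    and S: "0 \<le> S" "\<And>\<phi>. \<phi> \<in> dual_ball X \<Longrightarrow> (\<Sum>i\<in>I. cmod (\<phi> (x i)) powr r) \<le> S powr r"
  shows "(\<Sum>i\<in>I. norm_of Y (T (x i)) powr r) \<le> (C * S) powr r"
proof -
  obtain h where h: "bij_betw h {0..<card I} I" using I ex_bij_betw_nat_finite by blast
  then have hI: "h j \<in> I" if "j < card I" for j using that by (auto simp: bij_betw_def)
  have re: "(\<Sum>j<card I. g (h j)) = (\<Sum>i\<in>I. g i)" for g :: "'c \<Rightarrow> real"
    using sum.reindex_bij_betw[OF h, of g] by (simp add: lessThan_atLeast0)
  have C0: "0 \<le> C" using C by (simp add: summing_bound_def)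
  have "(\<Sum>j<card I. norm_of Y (T (x (h j))) powr r) powr (1 / r)
      \<le> C * (SUP \<phi>\<in>dual_ball X. (\<Sum>j<card I. cmod (\<phi> (x (h j))) powr r) powr (1 / r))"
    using C hI x unfolding summing_bound_def by (auto dest!: spec[of _ "card I"] spec[of _ "\<lambda>j. x (h j)"])
  also have "\<dots> \<le> C * S"
  proof (intro mult_left_mono C0 cSUP_least)
    show "dual_ball X \<noteq> {}" using zero_in_dual_ball[of X, OF X0] by blast
    fix \<phi> assume "\<phi> \<in> dual_ball X"
    then have "(\<Sum>i\<in>I. cmod (\<phi> (x i)) powr r) powr (1 / r) \<le> (S powr r) powr (1 / r)"
      using r S by (intro powr_mono2) (auto intro: sum_nonneg)
    then show "(\<Sum>j<card I. cmod (\<phi> (x (h j))) powr r) powr (1 / r) \<le> S"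
      using r S(1) by (simp add: re[of "\<lambda>i. cmod (\<phi> (x i)) powr r"] powr_powr)
  qed
  finally have "((\<Sum>i\<in>I. norm_of Y (T (x i)) powr r) powr (1 / r)) powr r \<le> (C * S) powr r"
    using r by (intro powr_mono2) (auto simp: re[of "\<lambda>i. norm_of Y (T (x i)) powr r"])
  then show ?thesis using r by (simp add: powr_powr sum_nonneg)
qed

text \<open>The normalised reproducing kernel of the classical Fock space at \<nu>; its Gaussian
  modulus is a Gaussian bump centred at \<nu>.\<close>

definition coherent :: "real \<Rightarrow> complex \<Rightarrow> complex \<Rightarrow> complex" where
  "coherent \<alpha> \<nu> z = exp (of_real \<alpha> * cnj \<nu> * z - of_real (\<alpha> / 2 * (cmod \<nu>)\<^sup>2))"

lemma cmod_diff_squared: "(cmod (a - b))\<^sup>2 = (cmod a)\<^sup>2 + (cmod b)\<^sup>2 - 2 * Re (cnj b * a)"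
  by (simp add: cmod_power2 algebra_simps power2_diff)

lemma gauss_abs_coherent: "gauss_abs \<alpha> (coherent \<alpha> \<nu>) z = exp (- (\<alpha> / 2) * (cmod (z - \<nu>))\<^sup>2)"
proof -
  have "Re (of_real \<alpha> * cnj \<nu> * z - of_real (\<alpha> / 2 * (cmod \<nu>)\<^sup>2)) + (- (\<alpha> / 2) * (cmod z)\<^sup>2)
      = - (\<alpha> / 2) * (cmod (z - \<nu>))\<^sup>2"
    unfolding cmod_diff_squared by (simp add: algebra_simps)
  then show ?thesis unfolding gauss_abs_def coherent_def norm_exp_eq_Re exp_add[symmetric] by simp
qed

lemma coherent_holomorphic: "coherent \<alpha> \<nu> holomorphic_on UNIV"
  unfolding coherent_def[abs_def] by (intro holomorphic_intros)

context fock_weight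
begin

text \<open>The factor normalises: the atoms have norms bounded independently of \<nu>, as
  \<open>synthesis\<close> gives for one-point sets.\<close>

definition atom :: "complex \<Rightarrow> complex \<Rightarrow> complex" where
  "atom \<nu> z = of_real (H \<nu> powr (- (1 / p))) * coherent \<alpha> \<nu> z"

lemma gaussian_mass:
  obtains J where "J > 0" "\<And>\<nu>. (\<integral>\<^sup>+z. ennreal (exp (- (\<alpha> / 2) * (cmod (z - \<nu>))\<^sup>2) * v z) \<partial>lebesgue) \<le> ennreal (J * H \<nu>)"
proof -
  obtain S where S: "S > 0" "\<And>F z. finite F \<Longrightarrow> F \<subseteq> lattice \<Longrightarrow> (\<Sum>\<nu>\<in>F. exp (- 2 * cmod (z - \<nu>))) \<le> S"
    by (rule lattice_exp_sum) (rule that; iprover)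
  \<comment> \<open>Of the rate D + 2, the part D pays for the growth of \<open>H\<close> and 2 is
    left for the lattice sum. The second factor pays for replacing \<open>z\<close> by the centre of
    its square, less than 1 away.\<close>
  define M where "M = exp ((D + 2)\<^sup>2 / (4 * (\<alpha> / 2))) * exp (D + 2)"
  define J where "J = M * C * C * S"
  have M: "M > 0" by (simp add: M_def)
  show ?thesis
  proof (rule that[of J])
    show "J > 0" using M C S by (simp add: J_def)
    fix \<nu>
    have [measurable]: "(\<lambda>z. exp (- (\<alpha> / 2) * (cmod (z - \<nu>))\<^sup>2)) \<in> borel_measurable lebesgue"
      by (intro measurable_completion) measurable
    have m: "(\<lambda>z. ennreal (exp (- (\<alpha> / 2) * (cmod (z - \<nu>))\<^sup>2) * v z)) \<in> borel_measurable lebesgue"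
      by measurable
    have "(\<integral>\<^sup>+z. ennreal (exp (- (\<alpha> / 2) * (cmod (z - \<nu>))\<^sup>2) * v z) \<partial>lebesgue)
        = (\<integral>\<^sup>+\<kappa>. (\<integral>\<^sup>+z\<in>square 1 \<kappa>. ennreal (exp (- (\<alpha> / 2) * (cmod (z - \<nu>))\<^sup>2) * v z) \<partial>lebesgue) \<partial>count_space lattice)"
      by (intro nn_integral_lattice m) simp
    also have "\<dots> \<le> (\<integral>\<^sup>+\<kappa>. ennreal (M * C * C * H \<nu> * exp (- 2 * cmod (\<nu> - \<kappa>))) \<partial>count_space lattice)"
    proof (rule nn_integral_mono)
      fix \<kappa>
      let ?m = "M * exp (- (D + 2) * cmod (\<kappa> - \<nu>))"
      have "(\<integral>\<^sup>+z\<in>square 1 \<kappa>. ennreal (exp (- (\<alpha> / 2) * (cmod (z - \<nu>))\<^sup>2) * v z) \<partial>lebesgue)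
          \<le> (\<integral>\<^sup>+z. ennreal ?m * (ennreal (v z) * indicator (square 1 \<kappa>) z) \<partial>lebesgue)"
      proof (rule nn_integral_mono)
        fix z
        have "exp (- (\<alpha> / 2) * (cmod (z - \<nu>))\<^sup>2) \<le> ?m" if z: "z \<in> square 1 \<kappa>"
        proof -
          have "cmod (\<kappa> - \<nu>) \<le> cmod (z - \<nu>) + 1"
            using square_dist_less_1[OF z] norm_triangle_ineq4[of "z - \<nu>" "z - \<kappa>"] by simp
          then have "(D + 2) * cmod (\<kappa> - \<nu>) \<le> (D + 2) * (cmod (z - \<nu>) + 1)"
            using D by (intro mult_left_mono) auto
          then have "exp (- (D + 2) * cmod (z - \<nu>)) \<le> exp (D + 2) * exp (- (D + 2) * cmod (\<kappa> - \<nu>))"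
            unfolding mult_exp_exp exp_le_cancel_iff by (simp add: algebra_simps)
          then have "exp ((D + 2)\<^sup>2 / (4 * (\<alpha> / 2))) * exp (- (D + 2) * cmod (z - \<nu>)) \<le> ?m"
            unfolding M_def mult.assoc by (intro mult_left_mono) auto
          then show ?thesis using exp_square_le[of "\<alpha> / 2" "cmod (z - \<nu>)" "D + 2"] \<alpha> by linarith
        qed
        then show "ennreal (exp (- (\<alpha> / 2) * (cmod (z - \<nu>))\<^sup>2) * v z) * indicator (square 1 \<kappa>) z
            \<le> ennreal ?m * (ennreal (v z) * indicator (square 1 \<kappa>) z)"
          using M v_nonneg[of z]
          by (auto split: split_indicator simp flip: ennreal_mult intro!: ennreal_leI mult_right_mono)
      qed
      also have "\<dots> = ennreal ?m * (\<integral>\<^sup>+z\<in>square 1 \<kappa>. ennreal (v z) \<partial>lebesgue)"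
        by (intro nn_integral_cmult) auto
      also have "\<dots> \<le> ennreal ?m * ennreal (C * (C * exp (D * cmod (\<kappa> - \<nu>)) * H \<nu>))"
        using C growth[of \<kappa> \<nu>] by (intro mult_left_mono order_trans[OF mass] ennreal_leI) auto
      also have "\<dots> = ennreal (M * C * C * H \<nu> * (exp (- (D + 2) * cmod (\<kappa> - \<nu>)) * exp (D * cmod (\<kappa> - \<nu>))))"
        using M C by (simp add: mult_ac flip: ennreal_mult)
      also have "exp (- (D + 2) * cmod (\<kappa> - \<nu>)) * exp (D * cmod (\<kappa> - \<nu>)) = exp (- 2 * cmod (\<nu> - \<kappa>))"
        unfolding mult_exp_exp by (simp add: algebra_simps norm_minus_commute)
      finally show "(\<integral>\<^sup>+z\<in>square 1 \<kappa>. ennreal (exp (- (\<alpha> / 2) * (cmod (z - \<nu>))\<^sup>2) * v z) \<partial>lebesgue)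
          \<le> ennreal (M * C * C * H \<nu> * exp (- 2 * cmod (\<nu> - \<kappa>)))" .
    qed
    also have "\<dots> \<le> ennreal (J * H \<nu>)"
    proof (rule nn_integral_count_space_le[OF lattice_countable])
      fix F assume F: "finite F" "F \<subseteq> lattice"
      have "(\<Sum>\<kappa>\<in>F. ennreal (M * C * C * H \<nu> * exp (- 2 * cmod (\<nu> - \<kappa>))))
          = ennreal (M * C * C * H \<nu> * (\<Sum>\<kappa>\<in>F. exp (- 2 * cmod (\<nu> - \<kappa>))))"
        unfolding sum_distrib_left using M C by (intro sum_ennreal) auto
      also have "\<dots> \<le> ennreal (M * C * C * H \<nu> * S)"
        using S(2)[OF F, of \<nu>] M C by (intro ennreal_leI mult_left_mono) auto
      finally show "(\<Sum>\<kappa>\<in>F. ennreal (M * C * C * H \<nu> * exp (- 2 * cmod (\<nu> - \<kappa>)))) \<le> ennreal (J * H \<nu>)"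
        by (simp add: J_def mult_ac)
    qed
    finally show "(\<integral>\<^sup>+z. ennreal (exp (- (\<alpha> / 2) * (cmod (z - \<nu>))\<^sup>2) * v z) \<partial>lebesgue) \<le> ennreal (J * H \<nu>)" .
  qed
qed

text \<open>A Schur-type estimate. Each Gaussian is split into its powers 1/p and 1 - 1/p; Hoelder's
  inequality leaves a sum of Gaussians that is bounded uniformly in \<open>z\<close>, and a sum that
  \<open>gaussian_mass\<close> integrates term by term.\<close>

lemma synthesis:
  obtains K where "K > 0" "\<And>F b. finite F \<Longrightarrow> F \<subseteq> lattice \<Longrightarrow>
      (\<lambda>z. \<Sum>\<nu>\<in>F. b \<nu> * atom \<nu> z) \<in> carrier_of Fock \<and>
      norm_of Fock (\<lambda>z. \<Sum>\<nu>\<in>F. b \<nu> * atom \<nu> z) \<le> K * (\<Sum>\<nu>\<in>F. cmod (b \<nu>) powr p) powr (1 / p)"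
proof -
  obtain S where S: "S > 0" "\<And>F z. finite F \<Longrightarrow> F \<subseteq> lattice \<Longrightarrow> (\<Sum>\<nu>\<in>F. exp (- 2 * cmod (z - \<nu>))) \<le> S"
    by (rule lattice_exp_sum) (rule that; iprover)
  obtain J where J: "J > 0" "\<And>\<nu>. (\<integral>\<^sup>+z. ennreal (exp (- (\<alpha> / 2) * (cmod (z - \<nu>))\<^sup>2) * v z) \<partial>lebesgue) \<le> ennreal (J * H \<nu>)"
    by (rule gaussian_mass) (rule that; iprover)
  define M where "M = exp (2\<^sup>2 / (4 * (\<alpha> / 2))) * S"
  have M: "M > 0" using S by (simp add: M_def)
  define K where "K = (M powr (p - 1) * J) powr (1 / p)"
  show ?thesis
  proof (rule that[of K])
    have "M powr (p - 1) * J > 0" using M J by (intro mult_pos_pos) (auto simp: powr_gt_zero)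
    then show "K > 0" unfolding K_def by (simp only: powr_gt_zero)
    fix F b assume F: "finite F" "F \<subseteq> lattice"
    let ?g = "\<lambda>z. \<Sum>\<nu>\<in>F. b \<nu> * atom \<nu> z"
    let ?E = "\<lambda>\<nu> z. exp (- (\<alpha> / 2) * (cmod (z - \<nu>))\<^sup>2)"
    have hol: "?g holomorphic_on UNIV"
      unfolding atom_def by (intro holomorphic_intros coherent_holomorphic)
    have [measurable]: "?E \<nu> \<in> borel_measurable lebesgue" for \<nu>
      by (intro measurable_completion) measurable
    have pt: "gauss_abs \<alpha> ?g z powr p \<le> M powr (p - 1) * (\<Sum>\<nu>\<in>F. cmod (b \<nu>) powr p / H \<nu> * ?E \<nu> z)" for z
    proof -
      have "gauss_abs \<alpha> ?g z \<le> (\<Sum>\<nu>\<in>F. cmod (b \<nu> * atom \<nu> z)) * exp (- (\<alpha> / 2) * (cmod z)\<^sup>2)"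
        unfolding gauss_abs_def by (intro mult_right_mono norm_sum) auto
      also have "\<dots> = (\<Sum>\<nu>\<in>F. cmod (b \<nu>) * H \<nu> powr (- (1 / p)) * gauss_abs \<alpha> (coherent \<alpha> \<nu>) z)"
        unfolding sum_distrib_right by (intro sum.cong refl) (simp add: atom_def gauss_abs_def norm_mult)
      also have "\<dots> = (\<Sum>\<nu>\<in>F. (cmod (b \<nu>) powr p / H \<nu> * ?E \<nu> z) powr (1 / p) * ?E \<nu> z powr (1 - 1 / p))"
      proof (intro sum.cong refl)
        fix \<nu>
        have "?E \<nu> z powr (1 / p) * ?E \<nu> z powr (1 - 1 / p) = ?E \<nu> z"
          by (subst powr_add[symmetric]) simp
        moreover have "(cmod (b \<nu>) powr p / H \<nu> * ?E \<nu> z) powr (1 / p)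
            = cmod (b \<nu>) * H \<nu> powr (- (1 / p)) * ?E \<nu> z powr (1 / p)"
          using p by (simp add: powr_mult powr_divide powr_powr powr_minus_divide)
        ultimately show "cmod (b \<nu>) * H \<nu> powr (- (1 / p)) * gauss_abs \<alpha> (coherent \<alpha> \<nu>) z
            = (cmod (b \<nu>) powr p / H \<nu> * ?E \<nu> z) powr (1 / p) * ?E \<nu> z powr (1 - 1 / p)"
          unfolding gauss_abs_coherent by (simp add: mult.assoc)
      qed
      also have "\<dots> \<le> (\<Sum>\<nu>\<in>F. cmod (b \<nu>) powr p / H \<nu> * ?E \<nu> z) powr (1 / p) * (\<Sum>\<nu>\<in>F. ?E \<nu> z) powr (1 - 1 / p)"
        using F p by (intro sum_Hoelder) auto
      also have "\<dots> \<le> (\<Sum>\<nu>\<in>F. cmod (b \<nu>) powr p / H \<nu> * ?E \<nu> z) powr (1 / p) * M powr (1 - 1 / p)"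
      proof (intro mult_left_mono powr_mono2)
        have "(\<Sum>\<nu>\<in>F. ?E \<nu> z) \<le> (\<Sum>\<nu>\<in>F. exp (2\<^sup>2 / (4 * (\<alpha> / 2))) * exp (- 2 * cmod (z - \<nu>)))"
          using \<alpha> by (intro sum_mono exp_square_le) simp
        also have "\<dots> \<le> M" unfolding M_def sum_distrib_left[symmetric] by (intro mult_left_mono S(2) F) simp
        finally show "(\<Sum>\<nu>\<in>F. ?E \<nu> z) \<le> M" .
      qed (use p in \<open>auto intro: sum_nonneg\<close>)
      finally have "gauss_abs \<alpha> ?g z powr p \<le> ((\<Sum>\<nu>\<in>F. cmod (b \<nu>) powr p / H \<nu> * ?E \<nu> z) powr (1 / p) * M powr (1 - 1 / p)) powr p"
        using p by (intro powr_mono2) auto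
      also have "\<dots> = M powr (p - 1) * (\<Sum>\<nu>\<in>F. cmod (b \<nu>) powr p / H \<nu> * ?E \<nu> z)"
      proof -
        have "p * (1 - 1 / p) = p - 1" using p by (simp add: right_diff_distrib)
        then show ?thesis using p by (simp add: powr_mult powr_powr sum_nonneg mult.commute[of _ p])
      qed
      finally show ?thesis .
    qed
    have int: "(\<integral>\<^sup>+z. ennreal (gauss_abs \<alpha> ?g z powr p * v z) \<partial>lebesgue) \<le> ennreal (M powr (p - 1) * J * (\<Sum>\<nu>\<in>F. cmod (b \<nu>) powr p))"
    proof -
      have "(\<integral>\<^sup>+z. ennreal (gauss_abs \<alpha> ?g z powr p * v z) \<partial>lebesgue)
          \<le> (\<integral>\<^sup>+z. (\<Sum>\<nu>\<in>F. ennreal (M powr (p - 1) * (cmod (b \<nu>) powr p / H \<nu>)) * ennreal (?E \<nu> z * v z)) \<partial>lebesgue)"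
      proof (rule nn_integral_mono)
        fix z
        have "gauss_abs \<alpha> ?g z powr p * v z \<le> M powr (p - 1) * (\<Sum>\<nu>\<in>F. cmod (b \<nu>) powr p / H \<nu> * ?E \<nu> z) * v z"
          by (intro mult_right_mono pt v_nonneg)
        also have "\<dots> = (\<Sum>\<nu>\<in>F. M powr (p - 1) * (cmod (b \<nu>) powr p / H \<nu>) * (?E \<nu> z * v z))"
          by (simp add: sum_distrib_left sum_distrib_right mult_ac)
        finally have "ennreal (gauss_abs \<alpha> ?g z powr p * v z) \<le> ennreal (\<Sum>\<nu>\<in>F. M powr (p - 1) * (cmod (b \<nu>) powr p / H \<nu>) * (?E \<nu> z * v z))"
          by (rule ennreal_leI)
        also have "\<dots> = (\<Sum>\<nu>\<in>F. ennreal (M powr (p - 1) * (cmod (b \<nu>) powr p / H \<nu>)) * ennreal (?E \<nu> z * v z))"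
        proof (subst sum_ennreal[symmetric])
          show "0 \<le> M powr (p - 1) * (cmod (b \<nu>) powr p / H \<nu>) * (?E \<nu> z * v z)" for \<nu>
            using v_nonneg[of z] by (intro mult_nonneg_nonneg divide_nonneg_nonneg) auto
        qed (use v_nonneg[of z] in \<open>intro sum.cong refl ennreal_mult, auto\<close>)
        finally show "ennreal (gauss_abs \<alpha> ?g z powr p * v z) \<le> (\<Sum>\<nu>\<in>F. ennreal (M powr (p - 1) * (cmod (b \<nu>) powr p / H \<nu>)) * ennreal (?E \<nu> z * v z))" .
      qed
      also have "\<dots> = (\<Sum>\<nu>\<in>F. ennreal (M powr (p - 1) * (cmod (b \<nu>) powr p / H \<nu>)) * (\<integral>\<^sup>+z. ennreal (?E \<nu> z * v z) \<partial>lebesgue))"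
      proof -
        have m: "(\<lambda>z. ennreal (?E \<nu> z * v z)) \<in> borel_measurable lebesgue" for \<nu> by measurable
        show ?thesis
          by (subst nn_integral_sum, intro borel_measurable_times_ennreal m borel_measurable_const,
              intro sum.cong refl nn_integral_cmult m)
      qed
      also have "\<dots> \<le> (\<Sum>\<nu>\<in>F. ennreal (M powr (p - 1) * (cmod (b \<nu>) powr p / H \<nu>)) * ennreal (J * H \<nu>))"
        by (intro sum_mono mult_left_mono J) auto
      also have "\<dots> = (\<Sum>\<nu>\<in>F. ennreal (M powr (p - 1) * J * cmod (b \<nu>) powr p))"
      proof (intro sum.cong refl)
        fix \<nu>
        have "H \<nu> \<noteq> 0" using H_pos[of \<nu>] by simp
        then have "M powr (p - 1) * (cmod (b \<nu>) powr p / H \<nu>) * (J * H \<nu>) = M powr (p - 1) * J * cmod (b \<nu>) powr p"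
          by simp
        then show "ennreal (M powr (p - 1) * (cmod (b \<nu>) powr p / H \<nu>)) * ennreal (J * H \<nu>)
            = ennreal (M powr (p - 1) * J * cmod (b \<nu>) powr p)"
          using J by (subst ennreal_mult[symmetric]) auto
      qed
      also have "\<dots> = ennreal (M powr (p - 1) * J * (\<Sum>\<nu>\<in>F. cmod (b \<nu>) powr p))"
        unfolding sum_distrib_left using J by (intro sum_ennreal) auto
      finally show ?thesis .
    qed
    have mem: "?g \<in> carrier_of Fock"
      using hol order_le_less_trans[OF int] by (simp add: Fock_carrier)
    have "norm_of Fock ?g powr p \<le> M powr (p - 1) * J * (\<Sum>\<nu>\<in>F. cmod (b \<nu>) powr p)"
      using int J unfolding Fock_integral_eq[OF mem] by (subst (asm) ennreal_le_iff) (auto intro!: sum_nonneg mult_nonneg_nonneg)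
    then have "(norm_of Fock ?g powr p) powr (1 / p) \<le> (M powr (p - 1) * J * (\<Sum>\<nu>\<in>F. cmod (b \<nu>) powr p)) powr (1 / p)"
      using p by (intro powr_mono2) auto
    also have "\<dots> = K * (\<Sum>\<nu>\<in>F. cmod (b \<nu>) powr p) powr (1 / p)"
      unfolding K_def by (rule powr_mult)
    finally show "?g \<in> carrier_of Fock \<and>
      norm_of Fock ?g \<le> K * (\<Sum>\<nu>\<in>F. cmod (b \<nu>) powr p) powr (1 / p)"
      using mem p Fock_norm_nonneg[of ?g] by (simp add: powr_powr)
  qed
qed


text \<open>Elements of \<open>dual_ball\<close> are linear on the carrier only, so the induction
  has to know that every partial sum belongs to it.\<close>

lemma functional_sum:
  assumes \<phi>: "\<phi> \<in> dual_ball Fock" and F: "finite F"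
    and mem: "\<And>F' b. finite F' \<Longrightarrow> F' \<subseteq> F \<Longrightarrow> (\<lambda>z. \<Sum>\<nu>\<in>F'. b \<nu> * g \<nu> z) \<in> carrier_of Fock"
  shows "\<phi> (\<lambda>z. \<Sum>\<nu>\<in>F. b \<nu> * g \<nu> z) = (\<Sum>\<nu>\<in>F. b \<nu> * \<phi> (g \<nu>))"
proof -
  let ?X = Fock
  have add: "\<phi> (\<lambda>x. f x + h x) = \<phi> f + \<phi> h" if "f \<in> carrier_of ?X" "h \<in> carrier_of ?X" for f h
    using \<phi> that by (auto simp: dual_ball_def)
  have scale: "\<phi> (\<lambda>x. c * f x) = c * \<phi> f" if "f \<in> carrier_of ?X" for f c
    using \<phi> that by (auto simp: dual_ball_def)
  have "F' \<subseteq> F \<Longrightarrow> \<phi> (\<lambda>z. \<Sum>\<nu>\<in>F'. b \<nu> * g \<nu> z) = (\<Sum>\<nu>\<in>F'. b \<nu> * \<phi> (g \<nu>))" if "finite F'" for F'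
    using that
  proof (induction F' rule: finite_induct)
    case empty
    \<comment> \<open>That \<phi> vanishes at the zero function comes from homogeneity with factor
      0.\<close>
    have "\<phi> (\<lambda>z. 0 * (\<Sum>\<nu>\<in>{}. b \<nu> * g \<nu> z)) = 0 * \<phi> (\<lambda>z. \<Sum>\<nu>\<in>{}. b \<nu> * g \<nu> z)"
      by (intro scale mem) auto
    then show ?case by simp
  next
    case (insert \<kappa> F')
    have g: "g \<kappa> \<in> carrier_of ?X" using mem[of "{\<kappa>}" "\<lambda>_. 1"] insert.prems by simp
    have bg: "(\<lambda>z. b \<kappa> * g \<kappa> z) \<in> carrier_of ?X" using mem[of "{\<kappa>}" b] insert.prems by simp
    have "\<phi> (\<lambda>z. b \<kappa> * g \<kappa> z + (\<Sum>\<nu>\<in>F'. b \<nu> * g \<nu> z)) = \<phi> (\<lambda>z. b \<kappa> * g \<kappa> z) + \<phi> (\<lambda>z. \<Sum>\<nu>\<in>F'. b \<nu> * g \<nu> z)"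
      using insert by (intro add bg mem) auto
    then show ?case using insert by (simp add: scale[OF g])
  qed
  then show ?thesis using F by blast
qed

text \<open>The coefficients \<open>b\<close> are chosen so that \<phi> takes the value
  \<open>Z\<close>, the left side, on the combination of atoms. Synthesis and Hoelder's inequality
  bound that value by \<open>K * T powr (1 / r) * sqrt Z\<close>, and one \<open>sqrt Z\<close>
  cancels. The exponent satisfies 1/r = 1/p - 1/2.\<close>

lemma weak_two_norm_atoms:
  assumes p2: "p < 2" and r: "r = 2 * p / (2 - p)"
    and K: "K > 0" and syn: "\<And>F b. finite F \<Longrightarrow> F \<subseteq> lattice \<Longrightarrow>
      (\<lambda>z. \<Sum>\<nu>\<in>F. b \<nu> * atom \<nu> z) \<in> carrier_of Fock \<and>
      norm_of Fock (\<lambda>z. \<Sum>\<nu>\<in>F. b \<nu> * atom \<nu> z) \<le> K * (\<Sum>\<nu>\<in>F. cmod (b \<nu>) powr p) powr (1 / p)"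
    and F: "finite F" "F \<subseteq> lattice" and \<beta>: "\<And>\<nu>. 0 \<le> \<beta> \<nu>"
    and \<phi>: "\<phi> \<in> dual_ball Fock"
  shows "(\<Sum>\<nu>\<in>F. (\<beta> \<nu> * cmod (\<phi> (atom \<nu>)))\<^sup>2) \<le> (K * (\<Sum>\<nu>\<in>F. \<beta> \<nu> powr r) powr (1 / r))\<^sup>2"
proof -
  define Z where "Z = (\<Sum>\<nu>\<in>F. (\<beta> \<nu> * cmod (\<phi> (atom \<nu>)))\<^sup>2)"
  have Z0: "0 \<le> Z" by (simp add: Z_def sum_nonneg)
  define T where "T = (\<Sum>\<nu>\<in>F. \<beta> \<nu> powr r)"
  define b where "b \<nu> = of_real ((\<beta> \<nu>)\<^sup>2) * cnj (\<phi> (atom \<nu>))" for \<nu>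
  have r0: "r > 0" using p p2 r by simp
  have "\<phi> (\<lambda>z. \<Sum>\<nu>\<in>F. b \<nu> * atom \<nu> z) = (\<Sum>\<nu>\<in>F. b \<nu> * \<phi> (atom \<nu>))"
    using syn F by (intro functional_sum[OF \<phi>]) blast+
  also have "\<dots> = of_real Z"
  proof -
    have "b \<nu> * \<phi> (atom \<nu>) = of_real ((\<beta> \<nu> * cmod (\<phi> (atom \<nu>)))\<^sup>2)" for \<nu>
      unfolding b_def power_mult_distrib of_real_mult complex_norm_square by (simp add: mult_ac)
    then show ?thesis by (simp add: Z_def)
  qed
  finally have "Z = cmod (\<phi> (\<lambda>z. \<Sum>\<nu>\<in>F. b \<nu> * atom \<nu> z))" using Z0 by simp
  also have "\<dots> \<le> norm_of Fock (\<lambda>z. \<Sum>\<nu>\<in>F. b \<nu> * atom \<nu> z)"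
    using \<phi> syn[OF F, of b] by (auto simp: dual_ball_def)
  also have "\<dots> \<le> K * (\<Sum>\<nu>\<in>F. cmod (b \<nu>) powr p) powr (1 / p)" using syn[OF F, of b] by blast
  also have "\<dots> \<le> K * (T powr (1 - p / 2) * Z powr (p / 2)) powr (1 / p)"
  proof (intro mult_left_mono powr_mono2)
    have "(\<Sum>\<nu>\<in>F. cmod (b \<nu>) powr p) = (\<Sum>\<nu>\<in>F. (\<beta> \<nu> powr r) powr (1 - p / 2) * ((\<beta> \<nu> * cmod (\<phi> (atom \<nu>)))\<^sup>2) powr (1 - (1 - p / 2)))"
    proof (intro sum.cong refl)
      fix \<nu>
      have rp: "r * (1 - p / 2) = p" using r p p2 by (simp add: field_simps)
      have "cmod (b \<nu>) = \<beta> \<nu> * (\<beta> \<nu> * cmod (\<phi> (atom \<nu>)))"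
        unfolding b_def norm_mult norm_of_real complex_mod_cnj using \<beta>[of \<nu>] by (simp add: power2_eq_square)
      then have "cmod (b \<nu>) powr p = \<beta> \<nu> powr p * (\<beta> \<nu> * cmod (\<phi> (atom \<nu>))) powr p"
        by (simp add: powr_mult)
      then show "cmod (b \<nu>) powr p = (\<beta> \<nu> powr r) powr (1 - p / 2) * ((\<beta> \<nu> * cmod (\<phi> (atom \<nu>)))\<^sup>2) powr (1 - (1 - p / 2))"
        using \<beta>[of \<nu>] square_powr_half[of "\<beta> \<nu> * cmod (\<phi> (atom \<nu>))" p] by (simp add: powr_powr rp)
    qed
    also have "\<dots> \<le> T powr (1 - p / 2) * Z powr (1 - (1 - p / 2))"
      unfolding T_def Z_def using p p2 F by (intro sum_Hoelder) auto
    finally show "(\<Sum>\<nu>\<in>F. cmod (b \<nu>) powr p) \<le> T powr (1 - p / 2) * Z powr (p / 2)" by simp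
  qed (use K p in \<open>auto intro: sum_nonneg\<close>)
  also have "\<dots> = K * T powr (1 / r) * sqrt Z"
  proof -
    have "(1 - p / 2) * (1 / p) = 1 / r" unfolding r using p p2 by (simp add: field_simps)
    then show ?thesis using p Z0 by (simp add: powr_mult powr_powr powr_half_sqrt)
  qed
  finally have le: "sqrt Z * sqrt Z \<le> K * T powr (1 / r) * sqrt Z" using Z0 by simp
  have "sqrt Z \<le> K * T powr (1 / r)"
  proof (cases "Z = 0")
    case False
    then have "sqrt Z > 0" using Z0 by simp
    then show ?thesis using le by (subst (asm) mult_le_cancel_right_pos)
  qed (use K in simp)
  then have "(sqrt Z)\<^sup>2 \<le> (K * T powr (1 / r))\<^sup>2" using Z0 by (intro power_mono) auto
  then show ?thesis using Z0 by (simp add: Z_def T_def)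
qed

text \<open>The mean modulus over the signs dominates the l2 norm of the values at \<open>u\<close>,
  hence the single term of the atom whose square contains \<open>u\<close>: on average the other
  atoms cannot cancel it.\<close>

lemma random_atoms_lower_bound:
  assumes q: "1 \<le> q" and F: "finite F" and \<nu>: "\<nu> \<in> F" and u: "u \<in> square 1 \<nu>"
    and \<beta>: "\<And>\<nu>. 0 \<le> \<beta> \<nu>"
  shows "2 ^ card F * ((5 / 9 * exp (- (\<alpha> / 4))) powr q * (\<beta> \<nu> powr q * H \<nu> powr (- (q / p))))
    \<le> (\<Sum>A\<in>Pow F. gauss_abs \<alpha> (\<lambda>z. \<Sum>\<kappa>\<in>F. of_real (sgn_of A \<kappa> * \<beta> \<kappa>) * atom \<kappa> z) u powr q)"
proof -
  define N :: real where "N = 2 ^ card F"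
  have N: "N > 0" by (simp add: N_def)
  have cP: "real (card (Pow F)) = N" using F by (simp add: card_Pow N_def)
  let ?g = "\<lambda>A. gauss_abs \<alpha> (\<lambda>z. \<Sum>\<kappa>\<in>F. of_real (sgn_of A \<kappa> * \<beta> \<kappa>) * atom \<kappa> z) u"
  let ?c = "\<lambda>\<kappa>. of_real (\<beta> \<kappa> * exp (- (\<alpha> / 2) * (cmod u)\<^sup>2)) * atom \<kappa> u"
  \<comment> \<open>\<open>exp (- (\<alpha> / 4))\<close> bounds the Gaussian modulus of the
    coherent state from below on the square, where the squared distance to \<nu> is at most
    1/2.\<close>
  define y where "y = \<beta> \<nu> * (H \<nu> powr (- (1 / p)) * exp (- (\<alpha> / 4)))"
  have y0: "0 \<le> y" using \<beta>[of \<nu>] by (simp add: y_def)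
  have g: "?g A = norm (\<Sum>\<kappa>\<in>F. sgn_of A \<kappa> *\<^sub>R ?c \<kappa>)" for A
  proof -
    have "(\<Sum>\<kappa>\<in>F. sgn_of A \<kappa> *\<^sub>R ?c \<kappa>)
        = (\<Sum>\<kappa>\<in>F. of_real (sgn_of A \<kappa> * \<beta> \<kappa>) * atom \<kappa> u) * of_real (exp (- (\<alpha> / 2) * (cmod u)\<^sup>2))"
      unfolding sum_distrib_right by (intro sum.cong refl) (simp add: scaleR_conv_of_real mult_ac)
    then show ?thesis by (simp only: gauss_abs_def norm_mult norm_of_real abs_exp_cancel)
  qed
  have "(cmod (u - \<nu>))\<^sup>2 \<le> (sqrt (1 / 2))\<^sup>2" by (intro power_mono square_dist u) simp
  then have d: "(cmod (u - \<nu>))\<^sup>2 \<le> 1 / 2" by simp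
  have "y \<le> norm (?c \<nu>)"
  proof -
    have "norm (?c \<nu>) = \<beta> \<nu> * (H \<nu> powr (- (1 / p)) * gauss_abs \<alpha> (coherent \<alpha> \<nu>) u)"
      using \<beta>[of \<nu>] by (simp add: norm_mult atom_def gauss_abs_def)
    moreover have "exp (- (\<alpha> / 4)) \<le> gauss_abs \<alpha> (coherent \<alpha> \<nu>) u"
      unfolding gauss_abs_coherent using d \<alpha> mult_left_mono[OF d, of "\<alpha> / 2"] by simp
    ultimately show ?thesis unfolding y_def using \<beta>[of \<nu>] by (auto intro!: mult_left_mono)
  qed
  also have "\<dots> \<le> sqrt (\<Sum>\<kappa>\<in>F. (norm (?c \<kappa>))\<^sup>2)"
    using F \<nu> by (intro real_le_rsqrt member_le_sum) auto
  finally have "N * y \<le> 2 ^ card F * sqrt (\<Sum>\<kappa>\<in>F. (norm (?c \<kappa>))\<^sup>2)"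
    unfolding N_def by (intro mult_left_mono) auto
  also have "\<dots> \<le> 9 / 5 * (\<Sum>A\<in>Pow F. ?g A)"
    unfolding g by (rule Khinchin_L1[OF F])
  finally have "N * (5 / 9 * y) \<le> (\<Sum>A\<in>Pow F. ?g A)" by simp
  then have "(N * (5 / 9 * y)) powr q \<le> (\<Sum>A\<in>Pow F. ?g A) powr q"
    using q N y0 by (intro powr_mono2) auto
  also have "\<dots> \<le> N powr (q - 1) * (\<Sum>A\<in>Pow F. ?g A powr q)"
    using power_mean_le[of "Pow F" ?g q] F q unfolding cP by simp
  finally have "(N * (5 / 9 * y)) powr q \<le> N powr (q - 1) * (\<Sum>A\<in>Pow F. ?g A powr q)" .
  then have "N powr (q - 1) * (N * (5 / 9 * y) powr q) \<le> N powr (q - 1) * (\<Sum>A\<in>Pow F. ?g A powr q)"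
  proof -
    have "N powr q = N powr (q - 1) * N" using N by (simp add: powr_diff)
    then have "(N * (5 / 9 * y)) powr q = N powr (q - 1) * (N * (5 / 9 * y) powr q)"
      unfolding powr_mult[of N] by simp
    then show ?thesis using \<open>(N * (5 / 9 * y)) powr q \<le> N powr (q - 1) * (\<Sum>A\<in>Pow F. ?g A powr q)\<close> by simp
  qed
  then have "N * (5 / 9 * y) powr q \<le> (\<Sum>A\<in>Pow F. ?g A powr q)"
    using N by (subst (asm) mult_le_cancel_left_pos) (auto simp: powr_gt_zero)
  moreover have "(5 / 9 * y) powr q = (5 / 9 * exp (- (\<alpha> / 4))) powr q * (\<beta> \<nu> powr q * H \<nu> powr (- (q / p)))"
  proof -
    have "5 / 9 * y = (5 / 9 * exp (- (\<alpha> / 4))) * (\<beta> \<nu> * H \<nu> powr (- (1 / p)))" by (simp add: y_def)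
    then show ?thesis by (simp only: powr_mult powr_powr) simp
  qed
  ultimately show ?thesis by (simp add: N_def)
qed

text \<open>The number \<open>N\<close> of sign patterns cancels: the second moment identity gives
  \<open>N\<close> times the squared weak 2-norm of the scaled atoms, and the averaged lower bound
  gives \<open>N\<close> times the sum over squares.\<close>

lemma mass_ratio_of_summing:
  assumes q: "1 \<le> q" "q \<le> 2" and p2: "p < 2" and s: "1 / s = 1 + q / 2 - q / p" "s > 0"
  obtains c where "c > 0"
    "\<And>\<mu> B. sets \<mu> = sets borel \<Longrightarrow>
      linear_map Fock (gauss_Lebesgue_space \<alpha> q \<mu>) (\<lambda>f. f) \<Longrightarrow>
      summing_bound 2 Fock (gauss_Lebesgue_space \<alpha> q \<mu>) (\<lambda>f. f) B \<Longrightarrow>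
      mass_ratio (q / p) H \<mu> \<in> ell_space s \<and> ell_norm s (mass_ratio (q / p) H \<mu>) powr (1 / q) \<le> c * B"
proof -
  let ?X = Fock
  obtain K where K: "K > 0" and syn: "\<And>F b. finite F \<Longrightarrow> F \<subseteq> lattice \<Longrightarrow>
      (\<lambda>z. \<Sum>\<nu>\<in>F. b \<nu> * atom \<nu> z) \<in> carrier_of ?X \<and>
      norm_of ?X (\<lambda>z. \<Sum>\<nu>\<in>F. b \<nu> * atom \<nu> z) \<le> K * (\<Sum>\<nu>\<in>F. cmod (b \<nu>) powr p) powr (1 / p)"
    by (rule synthesis) (rule that; iprover)
  define r where "r = 2 * p / (2 - p)"
  have r: "r > 0" "1 / s = 1 - q / r" using p p2 s by (auto simp: r_def field_simps)
  define c0 where "c0 = 5 / 9 * exp (- (\<alpha> / 4))"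
  have c0: "c0 > 0" by (simp add: c0_def)
  show ?thesis
  proof (rule that[of "K / c0"])
    show "K / c0 > 0" using K c0 by simp
    fix \<mu> :: "complex measure" and B
    assume sets: "sets \<mu> = sets borel"
    let ?Y = "gauss_Lebesgue_space \<alpha> q \<mu>"
    assume lin: "linear_map ?X ?Y (\<lambda>f. f)" and sum: "summing_bound 2 ?X ?Y (\<lambda>f. f) B"
    have B0: "0 \<le> B" using sum by (simp add: summing_bound_def)
    define G where "G = (B * K / c0) powr q"
    have G0: "0 \<le> G" by (simp add: G_def)
    have main: "(\<Sum>\<nu>\<in>F. ennreal (\<beta> \<nu> powr q) * mass_ratio (q / p) H \<mu> \<nu>) \<le> ennreal (G * (\<Sum>\<nu>\<in>F. \<beta> \<nu> powr r) powr (q / r))"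
      if F: "finite F" "F \<subseteq> lattice" and \<beta>: "\<And>\<nu>. 0 \<le> \<beta> \<nu>" for F \<beta>
    proof -
      define T where "T = (\<Sum>\<nu>\<in>F. \<beta> \<nu> powr r)"
      define N :: real where "N = 2 ^ card F"
      have N: "N > 0" by (simp add: N_def)
      have cP: "real (card (Pow F)) = N" using F by (simp add: card_Pow N_def)
      define x where "x A = (\<lambda>z. \<Sum>\<kappa>\<in>F. of_real (sgn_of A \<kappa> * \<beta> \<kappa>) * atom \<kappa> z)" for A
      have xX: "x A \<in> carrier_of ?X" for A unfolding x_def by (rule syn[OF F, THEN conjunct1])
      have xY: "x A \<in> carrier_of ?Y" for A using lin xX by (simp add: linear_map_def)
      have hol: "x A holomorphic_on UNIV" for A using xX[of A] by (simp add: Fock_carrier)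
      have [measurable]: "gauss_abs \<alpha> (x A) \<in> borel_measurable \<mu>" for A
        using gauss_abs_measurable[OF hol[of A]] sets by (simp cong: measurable_cong_sets)
      define R where "R = B * (K * T powr (1 / r))"
      have R0: "0 \<le> R" using B0 K by (simp add: R_def)
      have "(\<Sum>A\<in>Pow F. norm_of ?Y (x A) powr 2) \<le> (B * (sqrt N * (K * T powr (1 / r)))) powr 2"
      proof (rule summing_bound_finite[OF sum])
        fix \<phi> assume \<phi>: "\<phi> \<in> dual_ball ?X"
        have "\<phi> (x A) = (\<Sum>\<kappa>\<in>F. sgn_of A \<kappa> *\<^sub>R (of_real (\<beta> \<kappa>) * \<phi> (atom \<kappa>)))" for A
        proof -
          have "\<phi> (x A) = (\<Sum>\<kappa>\<in>F. of_real (sgn_of A \<kappa> * \<beta> \<kappa>) * \<phi> (atom \<kappa>))"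
            unfolding x_def using syn F by (intro functional_sum[OF \<phi>]) blast+
          then show ?thesis by (simp add: scaleR_conv_of_real mult.assoc)
        qed
        then have "(\<Sum>A\<in>Pow F. (cmod (\<phi> (x A)))\<^sup>2) = N * (\<Sum>\<kappa>\<in>F. (\<beta> \<kappa> * cmod (\<phi> (atom \<kappa>)))\<^sup>2)"
          using \<beta> by (simp add: rademacher_second_moment[OF F(1)] N_def norm_mult)
        also have "\<dots> \<le> N * (K * T powr (1 / r))\<^sup>2"
          unfolding T_def using N by (intro mult_left_mono weak_two_norm_atoms[OF p2 r_def K syn F \<beta> \<phi>]) auto
        finally show "(\<Sum>A\<in>Pow F. cmod (\<phi> (x A)) powr 2) \<le> (sqrt N * (K * T powr (1 / r))) powr 2"
          using N K by (simp add: power_mult_distrib)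
      qed (use F K N xX Fock_norm_nonneg in auto)
      also have "\<dots> = N * R\<^sup>2" using N B0 K by (simp add: R_def power_mult_distrib)
      finally have two: "(\<Sum>A\<in>Pow F. (norm_of ?Y (x A))\<^sup>2) \<le> N * R\<^sup>2"
        by (simp add: gauss_space_norm)
      have Iq: "(\<integral>\<^sup>+z. ennreal (gauss_abs \<alpha> (x A) z powr q) \<partial>\<mu>) = ennreal (norm_of ?Y (x A) powr q)" for A
        using xY[of A] q by (simp add: gauss_space_carrier gauss_space_norm powr_powr)
      \<comment> \<open>From squares to q-th powers over the sign patterns, possible as q is at most
        2. The q-th powers are integrals against \<open>\<mu>\<close>, so they can be compared
        square by square.\<close>
      have "(\<Sum>A\<in>Pow F. norm_of ?Y (x A) powr q) = (\<Sum>A\<in>Pow F. ((norm_of ?Y (x A))\<^sup>2) powr (q / 2) * 1 powr (1 - q / 2))"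
        by (simp add: square_powr_half gauss_space_norm)
      also have "\<dots> \<le> (\<Sum>A\<in>Pow F. (norm_of ?Y (x A))\<^sup>2) powr (q / 2) * (\<Sum>A\<in>Pow F. 1) powr (1 - q / 2)"
        using F q by (intro sum_Hoelder) auto
      also have "\<dots> \<le> (N * R\<^sup>2) powr (q / 2) * N powr (1 - q / 2)"
        using two q cP by (intro mult_mono powr_mono2) (auto intro: sum_nonneg)
      also have "\<dots> = N * R powr q"
      proof -
        have "(N * R\<^sup>2) powr (q / 2) * N powr (1 - q / 2) = (N powr (q / 2) * N powr (1 - q / 2)) * R powr q"
          using R0 by (simp add: powr_mult square_powr_half)
        also have "N powr (q / 2) * N powr (1 - q / 2) = N" using N by (simp add: powr_add[symmetric])
        finally show ?thesis .
      qed
      finally have upper: "(\<Sum>A\<in>Pow F. norm_of ?Y (x A) powr q) \<le> N * R powr q" .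
      let ?w = "\<lambda>\<nu>. N * (c0 powr q * (\<beta> \<nu> powr q * H \<nu> powr (- (q / p))))"
      have pt: "(\<Sum>\<nu>\<in>F. ennreal (?w \<nu>) * indicator (square 1 \<nu>) u) \<le> (\<Sum>A\<in>Pow F. ennreal (gauss_abs \<alpha> (x A) u powr q))" for u
      proof (cases "\<exists>\<nu>\<in>F. u \<in> square 1 \<nu>")
        case True
        then obtain \<nu> where \<nu>: "\<nu> \<in> F" "u \<in> square 1 \<nu>" by blast
        have "(\<Sum>\<kappa>\<in>F. ennreal (?w \<kappa>) * indicator (square 1 \<kappa>) u) = ennreal (?w \<nu>)"
          by (rule sum_indicator_square[OF F \<nu>])
        also have "\<dots> \<le> ennreal (\<Sum>A\<in>Pow F. gauss_abs \<alpha> (x A) u powr q)"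
          unfolding N_def c0_def x_def
          by (intro ennreal_leI random_atoms_lower_bound q F \<nu> \<beta>)
        also have "\<dots> = (\<Sum>A\<in>Pow F. ennreal (gauss_abs \<alpha> (x A) u powr q))"
          by (intro sum_ennreal[symmetric]) simp
        finally show ?thesis .
      next
        case False
        then show ?thesis by (simp add: sum.neutral)
      qed
      have "ennreal (N * c0 powr q) * (\<Sum>\<nu>\<in>F. ennreal (\<beta> \<nu> powr q) * mass_ratio (q / p) H \<mu> \<nu>)
          = (\<Sum>\<nu>\<in>F. ennreal (?w \<nu>) * emeasure \<mu> (square 1 \<nu>))"
      proof -
        have "ennreal (N * c0 powr q) * (ennreal (\<beta> \<nu> powr q) * mass_ratio (q / p) H \<mu> \<nu>) = ennreal (?w \<nu>) * emeasure \<mu> (square 1 \<nu>)" for \<nu>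
          using N by (simp add: mass_ratio_eq_mult[of H, OF H_pos] ennreal_mult mult.assoc)
        then show ?thesis by (simp add: sum_distrib_left)
      qed
      also have "\<dots> = (\<integral>\<^sup>+u. (\<Sum>\<nu>\<in>F. ennreal (?w \<nu>) * indicator (square 1 \<nu>) u) \<partial>\<mu>)"
        using sets by (subst nn_integral_sum) (auto simp: nn_integral_cmult_indicator)
      also have "\<dots> \<le> (\<integral>\<^sup>+u. (\<Sum>A\<in>Pow F. ennreal (gauss_abs \<alpha> (x A) u powr q)) \<partial>\<mu>)"
        by (intro nn_integral_mono pt)
      also have "\<dots> = (\<Sum>A\<in>Pow F. ennreal (norm_of ?Y (x A) powr q))"
        by (subst nn_integral_sum) (auto simp: Iq)
      also have "\<dots> = ennreal (\<Sum>A\<in>Pow F. norm_of ?Y (x A) powr q)"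
        by (intro sum_ennreal) simp
      also have "\<dots> \<le> ennreal (N * R powr q)" by (intro ennreal_leI upper)
      also have "N * R powr q = N * c0 powr q * (G * T powr (q / r))"
      proof -
        have "R powr q = (B * K) powr q * T powr (q / r)"
          unfolding R_def using K B0 by (simp add: powr_mult powr_powr)
        then show ?thesis using c0 B0 K by (simp add: G_def powr_divide)
      qed
      also have "ennreal (N * c0 powr q * (G * T powr (q / r))) = ennreal (N * c0 powr q) * ennreal (G * T powr (q / r))"
        using N G0 by (intro ennreal_mult) auto
      finally show ?thesis
        using N c0 unfolding T_def
        by (subst (asm) ennreal_mult_le_mult_iff) (auto simp: powr_gt_zero)
    qed
    have e: "mass_ratio (q / p) H \<mu> \<in> ell_space s" "ell_norm s (mass_ratio (q / p) H \<mu>) \<le> G"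
      using q r G0 s(2) main by (auto intro!: ell_space_duality[of s q r G])
    have "ell_norm s (mass_ratio (q / p) H \<mu>) powr (1 / q) \<le> G powr (1 / q)"
      using e(2) q by (intro powr_mono2) (auto simp: ell_norm_def)
    also have "\<dots> = K / c0 * B" using q B0 K c0 by (simp add: G_def powr_powr mult.commute)
    finally show "mass_ratio (q / p) H \<mu> \<in> ell_space s \<and> ell_norm s (mass_ratio (q / p) H \<mu>) powr (1 / q) \<le> K / c0 * B"
      using e(1) by blast
  qed
qed

end

section \<open>The Berezin transform\<close>

lemma Lebesgue_space_carrier:
  "f \<in> carrier_of (Lebesgue_space k M) \<longleftrightarrow> f \<in> borel_measurable M \<and> (\<integral>\<^sup>+x. ennreal (cmod (f x) powr k) \<partial>M) < \<infinity>"
  by (simp add: Lebesgue_space_def)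

lemma Lebesgue_space_norm:
  "norm_of (Lebesgue_space k M) f = enn2real (\<integral>\<^sup>+x. ennreal (cmod (f x) powr k) \<partial>M) powr (1 / k)"
  by (simp add: Lebesgue_space_def)

lemma id_measurable_lebesgue: "(\<lambda>x. x) \<in> lebesgue \<rightarrow>\<^sub>M borel"
  by (simp add: measurable_completion)

lemma berezin_measurable:
  assumes [measurable]: "f \<in> borel_measurable lebesgue"
  shows "berezin \<alpha> f \<in> borel_measurable borel"
  unfolding berezin_def[abs_def]
proof (rule sigma_finite_measure.borel_measurable_lebesgue_integral[OF sigma_finite_lebesgue])
  have [measurable]: "snd \<in> borel_measurable (borel \<Otimes>\<^sub>M (lebesgue :: complex measure))"
    by (rule measurable_compose[OF measurable_snd id_measurable_lebesgue])
  have [measurable]: "(\<lambda>k. f (snd k)) \<in> borel_measurable (borel \<Otimes>\<^sub>M (lebesgue :: complex measure))"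
    by (rule measurable_compose[OF measurable_snd assms])
  show "(\<lambda>(z, u). f u * of_real (exp (- \<alpha> * (cmod (z - u))\<^sup>2))) \<in> borel_measurable (borel \<Otimes>\<^sub>M lebesgue)"
    unfolding split_beta' by measurable
qed

context fock_weight
begin

text \<open>As 2/(2-p) is 2/p times the exponent p/(2-p), the norm of \<open>f\<close> is the
  unweighted Lebesgue norm of \<open>f\<close> times \<open>H\<close> to the power 2/p.\<close>

abbreviation berezin_source :: "complex fspace" where
  "berezin_source \<equiv> Lebesgue_space (p / (2 - p)) (density lebesgue (\<lambda>z. ennreal (H z powr (2 / (2 - p)))))"

lemma H_measurable_lebesgue [measurable]: "H \<in> borel_measurable lebesgue"
  by (simp add: measurable_completion)

lemma berezin_source_integral:
  assumes [measurable]: "f \<in> borel_measurable lebesgue"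
  shows "(\<integral>\<^sup>+z. ennreal (cmod (f z) powr k) \<partial>density lebesgue (\<lambda>z. ennreal (H z powr e)))
    = (\<integral>\<^sup>+z. ennreal (cmod (f z) powr k * H z powr e) \<partial>lebesgue)"
  by (subst nn_integral_density) (auto simp: ennreal_mult mult.commute)

lemma exp_dist_integral:
  obtains E where "E > 0" "\<And>\<nu>. (\<integral>\<^sup>+u. ennreal (exp (- 2 * cmod (\<nu> - u))) \<partial>(lebesgue :: complex measure)) \<le> ennreal E"
proof -
  obtain S where S: "S > 0" "\<And>F z. finite F \<Longrightarrow> F \<subseteq> lattice \<Longrightarrow> (\<Sum>\<nu>\<in>F. exp (- 2 * cmod (z - \<nu>))) \<le> S"
    by (rule lattice_exp_sum) (rule that; iprover)
  show ?thesis
  proof (rule that[of "exp 2 * S"])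
    show "exp 2 * S > 0" using S by simp
    fix \<nu> :: complex
    have m: "(\<lambda>u. ennreal (exp (- 2 * cmod (\<nu> - u)))) \<in> borel_measurable (lebesgue :: complex measure)"
      by (intro measurable_completion) measurable
    have "(\<integral>\<^sup>+u. ennreal (exp (- 2 * cmod (\<nu> - u))) \<partial>(lebesgue :: complex measure))
        = (\<integral>\<^sup>+\<kappa>. (\<integral>\<^sup>+u\<in>square 1 \<kappa>. ennreal (exp (- 2 * cmod (\<nu> - u))) \<partial>lebesgue) \<partial>count_space lattice)"
      by (intro nn_integral_lattice m) simp
    also have "\<dots> \<le> (\<integral>\<^sup>+\<kappa>. ennreal (exp 2 * exp (- 2 * cmod (\<nu> - \<kappa>))) \<partial>count_space lattice)"
    proof (rule nn_integral_mono)
      fix \<kappa>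
      have "(\<integral>\<^sup>+u\<in>square 1 \<kappa>. ennreal (exp (- 2 * cmod (\<nu> - u))) \<partial>lebesgue)
          \<le> (\<integral>\<^sup>+u. ennreal (exp 2 * exp (- 2 * cmod (\<nu> - \<kappa>))) * indicator (square 1 \<kappa>) u \<partial>lebesgue)"
      proof (rule nn_integral_mono)
        fix u
        have "exp (- 2 * cmod (\<nu> - u)) \<le> exp 2 * exp (- 2 * cmod (\<nu> - \<kappa>))" if u: "u \<in> square 1 \<kappa>"
          unfolding mult_exp_exp exp_le_cancel_iff
          using square_dist_less_1[OF u] norm_triangle_ineq[of "\<nu> - u" "u - \<kappa>"] by simp
        then show "ennreal (exp (- 2 * cmod (\<nu> - u))) * indicator (square 1 \<kappa>) u
            \<le> ennreal (exp 2 * exp (- 2 * cmod (\<nu> - \<kappa>))) * indicator (square 1 \<kappa>) u"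
          by (auto split: split_indicator intro: ennreal_leI)
      qed
      also have "\<dots> = ennreal (exp 2 * exp (- 2 * cmod (\<nu> - \<kappa>)))"
        by (subst nn_integral_cmult_indicator) (auto simp: emeasure_square)
      finally show "(\<integral>\<^sup>+u\<in>square 1 \<kappa>. ennreal (exp (- 2 * cmod (\<nu> - u))) \<partial>lebesgue) \<le> \<dots>" .
    qed
    also have "\<dots> \<le> ennreal (exp 2 * S)"
    proof (rule nn_integral_count_space_le[OF lattice_countable])
      fix F assume F: "finite F" "F \<subseteq> lattice"
      have "(\<Sum>\<kappa>\<in>F. ennreal (exp 2 * exp (- 2 * cmod (\<nu> - \<kappa>)))) = ennreal (exp 2 * (\<Sum>\<kappa>\<in>F. exp (- 2 * cmod (\<nu> - \<kappa>))))"
        unfolding sum_distrib_left by (intro sum_ennreal) auto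
      also have "\<dots> \<le> ennreal (exp 2 * S)" using S(2)[OF F] by (intro ennreal_leI mult_left_mono) auto
      finally show "(\<Sum>\<kappa>\<in>F. ennreal (exp 2 * exp (- 2 * cmod (\<nu> - \<kappa>)))) \<le> ennreal (exp 2 * S)" .
    qed
    finally show "(\<integral>\<^sup>+u. ennreal (exp (- 2 * cmod (\<nu> - u))) \<partial>lebesgue) \<le> ennreal (exp 2 * S)" .
  qed
qed

lemma berezin_kernel_bound:
  obtains M where "M > 0" "\<And>\<nu> z u. z \<in> square 1 \<nu> \<Longrightarrow>
     H u powr (- (2 / p)) * exp (- \<alpha> * (cmod (z - u))\<^sup>2) \<le> M * H \<nu> powr (- (2 / p)) * exp (- 2 * cmod (\<nu> - u))"
proof -
  \<comment> \<open>2D/p compensates the growth of \<open>H\<close> to the power -2/p; the remaining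
    2 is the rate of the lattice sum.\<close>
  define d where "d = 2 * D / p + 2"
  define M where "M = C powr (2 / p) * exp d * exp (d\<^sup>2 / (4 * \<alpha>))"
  have d0: "d \<ge> 0" using D p by (simp add: d_def)
  show ?thesis
  proof (rule that[of M])
    show "M > 0" using C by (simp add: M_def)
    fix \<nu> z u assume z: "z \<in> square 1 \<nu>"
    have "cmod (\<nu> - u) \<le> cmod (z - u) + 1"
      using square_dist_less_1[OF z] norm_triangle_ineq4[of "z - u" "z - \<nu>"] by simp
    then have "d * cmod (\<nu> - u) \<le> d * (cmod (z - u) + 1)" using d0 by (rule mult_left_mono)
    then have "exp (- d * cmod (z - u)) \<le> exp d * exp (- d * cmod (\<nu> - u))"
      unfolding mult_exp_exp exp_le_cancel_iff by (simp add: algebra_simps)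
    then have "exp (d\<^sup>2 / (4 * \<alpha>)) * exp (- d * cmod (z - u)) \<le> exp (d\<^sup>2 / (4 * \<alpha>)) * (exp d * exp (- d * cmod (\<nu> - u)))"
      by (intro mult_left_mono) auto
    then have e: "exp (- \<alpha> * (cmod (z - u))\<^sup>2) \<le> exp (d\<^sup>2 / (4 * \<alpha>)) * (exp d * exp (- d * cmod (\<nu> - u)))"
      using exp_square_le[OF \<alpha>, of "cmod (z - u)" d] by linarith
    have "H \<nu> / (C * exp (D * cmod (\<nu> - u))) \<le> H u" using growth[of \<nu> u] C by (simp add: field_simps)
    then have "H u powr (- (2 / p)) \<le> (H \<nu> / (C * exp (D * cmod (\<nu> - u)))) powr (- (2 / p))"
      using p C H_pos[of \<nu>] by (intro powr_mono2') auto
    also have "\<dots> = H \<nu> powr (- (2 / p)) * (C powr (2 / p) * exp (2 * D / p * cmod (\<nu> - u)))"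
      using C by (simp add: powr_divide powr_mult powr_minus divide_simps) (simp add: powr_def)
    finally have h: "H u powr (- (2 / p)) \<le> H \<nu> powr (- (2 / p)) * (C powr (2 / p) * exp (2 * D / p * cmod (\<nu> - u)))" .
    have "H u powr (- (2 / p)) * exp (- \<alpha> * (cmod (z - u))\<^sup>2)
        \<le> (H \<nu> powr (- (2 / p)) * (C powr (2 / p) * exp (2 * D / p * cmod (\<nu> - u)))) * (exp (d\<^sup>2 / (4 * \<alpha>)) * (exp d * exp (- d * cmod (\<nu> - u))))"
      by (intro mult_mono h e) auto
    also have "\<dots> = M * H \<nu> powr (- (2 / p)) * (exp (2 * D / p * cmod (\<nu> - u)) * exp (- d * cmod (\<nu> - u)))"
      by (simp add: M_def)
    also have "exp (2 * D / p * cmod (\<nu> - u)) * exp (- d * cmod (\<nu> - u)) = exp (- 2 * cmod (\<nu> - u))"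
      unfolding mult_exp_exp d_def by (simp add: algebra_simps)
    finally show "H u powr (- (2 / p)) * exp (- \<alpha> * (cmod (z - u))\<^sup>2) \<le> M * H \<nu> powr (- (2 / p)) * exp (- 2 * cmod (\<nu> - u))" .
  qed
qed

text \<open>Hoelder's inequality in \<open>u\<close>, with the kernel split as in
  \<open>synthesis\<close>, bounds the transform on each square by a power of a local integral
  \<open>G\<close>, whose lattice sum is at most a multiple of the k-th power of the norm. A second
  Hoelder inequality, over the lattice, pairs the sequence of (e) with \<open>G\<close> to the power
  q/(2k) = 1 - 1/s. Powers of norms are kept throughout because q/2 is at most 1.\<close>

lemma berezin_bounded_of_mass_ratio:
  assumes q: "1 \<le> q" "q \<le> 2" and p2: "p < 2" and s: "1 / s = 1 + q / 2 - q / p" "s > 0"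
    and sets: "sets \<mu> = sets borel" and a: "mass_ratio (q / p) H \<mu> \<in> ell_space s"
  shows "berezin_bounded \<alpha> berezin_source (Lebesgue_space (q / 2) \<mu>)"
proof -
  define k where "k = p / (2 - p)"
  have k: "k > 1" using p p2 by (simp add: k_def)
  have e_k: "2 / (2 - p) * (1 / k) = 2 / p" unfolding k_def using p p2 by (simp add: field_simps)
  have qk: "1 - 1 / s = q / (2 * k)" unfolding s(1) using p p2 by (simp add: k_def field_simps)
  have s1: "1 / s \<le> 1" using qk q k by (metis diff_ge_0_iff_ge divide_nonneg_nonneg less_imp_le mult_nonneg_nonneg order_trans zero_le_numeral zero_le_one)
  let ?Y = "Lebesgue_space (q / 2) \<mu>"
  obtain S where S: "S > 0" "\<And>F z. finite F \<Longrightarrow> F \<subseteq> lattice \<Longrightarrow> (\<Sum>\<nu>\<in>F. exp (- 2 * cmod (z - \<nu>))) \<le> S"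
    by (rule lattice_exp_sum) (rule that; iprover)
  obtain E where E: "E > 0" "\<And>\<nu>. (\<integral>\<^sup>+u. ennreal (exp (- 2 * cmod (\<nu> - u))) \<partial>(lebesgue :: complex measure)) \<le> ennreal E"
    by (rule exp_dist_integral) (rule that; iprover)
  obtain M where M: "M > 0" and ker: "\<And>\<nu> z u. z \<in> square 1 \<nu> \<Longrightarrow>
     H u powr (- (2 / p)) * exp (- \<alpha> * (cmod (z - u))\<^sup>2) \<le> M * H \<nu> powr (- (2 / p)) * exp (- 2 * cmod (\<nu> - u))"
    by (rule berezin_kernel_bound) (rule that; iprover)
  define c where "c = M * E powr (1 - 1 / k)"
  have c: "c > 0" using M E by (simp add: c_def)
  define l where "l \<nu> = enn2real (mass_ratio (q / p) H \<mu> \<nu>)" for \<nu>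
  have l0: "0 \<le> l \<nu>" for \<nu> by (simp add: l_def)
  have \<mu>Q: "emeasure \<mu> (square 1 \<nu>) = ennreal (l \<nu> * H \<nu> powr (q / p))" if "\<nu> \<in> lattice" for \<nu>
    unfolding l_def by (intro mass_ratio_eq H_pos ell_space_finite[OF a that])
  define W where "W = enn2real (\<integral>\<^sup>+\<nu>. enn_powr (mass_ratio (q / p) H \<mu> \<nu>) s \<partial>count_space lattice)"
  have lW: "(\<integral>\<^sup>+\<nu>. ennreal (l \<nu> powr s) \<partial>count_space lattice) \<le> ennreal W"
  proof -
    have "(\<integral>\<^sup>+\<nu>. ennreal (l \<nu> powr s) \<partial>count_space lattice) = (\<integral>\<^sup>+\<nu>. enn_powr (mass_ratio (q / p) H \<mu> \<nu>) s \<partial>count_space lattice)"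
    proof (rule nn_integral_cong)
      fix \<nu> assume "\<nu> \<in> space (count_space lattice)"
      then have "mass_ratio (q / p) H \<mu> \<nu> < \<infinity>" using ell_space_finite[OF a] by simp
      then show "ennreal (l \<nu> powr s) = enn_powr (mass_ratio (q / p) H \<mu> \<nu>) s" by (simp add: l_def enn_powr_def)
    qed
    also have "\<dots> = ennreal W" using a by (simp add: W_def ell_space_def)
    finally show ?thesis by simp
  qed
  define G where "G f \<nu> = enn2real (\<integral>\<^sup>+u. ennreal (cmod (f u) powr k * H u powr (2 / (2 - p)) * exp (- 2 * cmod (\<nu> - u))) \<partial>lebesgue)" for f \<nu>
  have G0: "0 \<le> G f \<nu>" for f \<nu> by (simp add: G_def)
  let ?n = "norm_of berezin_source"
  have pt: "(\<integral>\<^sup>+u. ennreal (cmod (f u * of_real (exp (- \<alpha> * (cmod (z - u))\<^sup>2)))) \<partial>lebesgue) \<le> ennreal (c * H \<nu> powr (- (2 / p)) * G f \<nu> powr (1 / k))"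
    and total: "(\<integral>\<^sup>+\<nu>. ennreal (G f \<nu>) \<partial>count_space lattice) \<le> ennreal (S * ?n f powr k)"
    if f: "f \<in> carrier_of berezin_source" and z: "z \<in> square 1 \<nu>" for f \<nu> z
  proof -
    have [measurable]: "f \<in> borel_measurable lebesgue" using f by (simp add: Lebesgue_space_carrier)
    define h where "h u = cmod (f u) powr k * H u powr (2 / (2 - p))" for u
    have h0: "0 \<le> h u" for u by (simp add: h_def)
    have [measurable]: "h \<in> borel_measurable lebesgue" unfolding h_def[abs_def] by measurable
    have hn: "(\<integral>\<^sup>+u. ennreal (h u) \<partial>lebesgue) = ennreal (?n f powr k)"
      using f k unfolding Lebesgue_space_carrier Lebesgue_space_norm h_def k_def[symmetric]
      by (simp add: berezin_source_integral powr_powr)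
    have Gfin: "(\<integral>\<^sup>+u. ennreal (h u * exp (- 2 * cmod (\<nu> - u))) \<partial>lebesgue) = ennreal (G f \<nu>)" for \<nu>
    proof -
      have "(\<integral>\<^sup>+u. ennreal (h u * exp (- 2 * cmod (\<nu> - u))) \<partial>lebesgue) \<le> (\<integral>\<^sup>+u. ennreal (h u) \<partial>lebesgue)"
        using h0 by (intro nn_integral_mono ennreal_leI) (simp add: mult_left_le)
      also have "\<dots> < \<infinity>" by (simp add: hn)
      finally show ?thesis by (simp add: G_def h_def)
    qed
    show "(\<integral>\<^sup>+u. ennreal (cmod (f u * of_real (exp (- \<alpha> * (cmod (z - u))\<^sup>2)))) \<partial>lebesgue) \<le> ennreal (c * H \<nu> powr (- (2 / p)) * G f \<nu> powr (1 / k))"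
    proof -
      let ?e = "\<lambda>u. exp (- 2 * cmod (\<nu> - u))"
      have em [measurable]: "?e \<in> borel_measurable lebesgue" by (intro measurable_completion) measurable
      have "(\<integral>\<^sup>+u. ennreal (cmod (f u * of_real (exp (- \<alpha> * (cmod (z - u))\<^sup>2)))) \<partial>lebesgue)
          \<le> (\<integral>\<^sup>+u. ennreal (M * H \<nu> powr (- (2 / p))) * ennreal ((h u * ?e u) powr (1 / k) * ?e u powr (1 - 1 / k)) \<partial>lebesgue)"
      proof (rule nn_integral_mono)
        fix u
        have "h u powr (1 / k) = cmod (f u) * H u powr (2 / p)"
          using k unfolding h_def powr_mult powr_powr e_k by simp
        then have "cmod (f u) = h u powr (1 / k) * H u powr (- (2 / p))"
          using H_pos[of u] by (simp add: powr_minus)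
        then have "cmod (f u * of_real (exp (- \<alpha> * (cmod (z - u))\<^sup>2))) = h u powr (1 / k) * (H u powr (- (2 / p)) * exp (- \<alpha> * (cmod (z - u))\<^sup>2))"
          by (simp add: norm_mult)
        also have "\<dots> \<le> h u powr (1 / k) * (M * H \<nu> powr (- (2 / p)) * ?e u)"
          by (intro mult_left_mono ker z) auto
        also have "\<dots> = M * H \<nu> powr (- (2 / p)) * ((h u * ?e u) powr (1 / k) * ?e u powr (1 - 1 / k))"
        proof -
          have "?e u powr (1 / k) * ?e u powr (1 - 1 / k) = ?e u" by (subst powr_add[symmetric]) simp
          then have "(h u * ?e u) powr (1 / k) * ?e u powr (1 - 1 / k) = h u powr (1 / k) * ?e u"
            by (simp only: powr_mult mult.assoc)
          then show ?thesis by simp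
        qed
        finally show "ennreal (cmod (f u * of_real (exp (- \<alpha> * (cmod (z - u))\<^sup>2))))
            \<le> ennreal (M * H \<nu> powr (- (2 / p))) * ennreal ((h u * ?e u) powr (1 / k) * ?e u powr (1 - 1 / k))"
          using M by (subst ennreal_mult[symmetric]) (auto intro: ennreal_leI)
      qed
      also have "\<dots> = ennreal (M * H \<nu> powr (- (2 / p))) * (\<integral>\<^sup>+u. ennreal ((h u * ?e u) powr (1 / k) * ?e u powr (1 - 1 / k)) \<partial>lebesgue)"
        by (intro nn_integral_cmult) measurable
      also have "\<dots> \<le> ennreal (M * H \<nu> powr (- (2 / p))) * ennreal (G f \<nu> powr (1 / k) * E powr (1 - 1 / k))"
      proof (rule mult_left_mono[OF nn_integral_Hoelder])
        show "?e \<in> borel_measurable lebesgue" by (rule em)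
        show "(\<lambda>u. h u * ?e u) \<in> borel_measurable lebesgue" by measurable
      qed (use h0 k G0 E Gfin in auto)
      also have "\<dots> = ennreal (c * H \<nu> powr (- (2 / p)) * G f \<nu> powr (1 / k))"
        using M by (subst ennreal_mult[symmetric]) (auto simp: c_def)
      finally show ?thesis .
    qed
    show "(\<integral>\<^sup>+\<nu>. ennreal (G f \<nu>) \<partial>count_space lattice) \<le> ennreal (S * ?n f powr k)"
    proof (rule nn_integral_count_space_le[OF lattice_countable])
      fix F assume F: "finite F" "F \<subseteq> lattice"
      have [measurable]: "(\<lambda>u. exp (- 2 * cmod (\<nu> - u))) \<in> borel_measurable lebesgue" for \<nu>
        by (intro measurable_completion) measurable
      have em: "(\<lambda>u. ennreal (h u * exp (- 2 * cmod (\<nu> - u)))) \<in> borel_measurable lebesgue" for \<nu> by measurable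
      have "(\<Sum>\<nu>\<in>F. ennreal (G f \<nu>)) = (\<integral>\<^sup>+u. (\<Sum>\<nu>\<in>F. ennreal (h u * exp (- 2 * cmod (\<nu> - u)))) \<partial>lebesgue)"
        by (subst nn_integral_sum, rule em) (simp only: Gfin)
      also have "\<dots> \<le> (\<integral>\<^sup>+u. ennreal S * ennreal (h u) \<partial>lebesgue)"
      proof (rule nn_integral_mono)
        fix u
        have "(\<Sum>\<nu>\<in>F. ennreal (h u * exp (- 2 * cmod (\<nu> - u)))) = ennreal (h u * (\<Sum>\<nu>\<in>F. exp (- 2 * cmod (u - \<nu>))))"
          unfolding sum_distrib_left using h0 by (subst sum_ennreal) (auto simp: norm_minus_commute)
        also have "\<dots> \<le> ennreal (h u * S)" using S(2)[OF F] h0 by (intro ennreal_leI mult_left_mono) auto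
        also have "\<dots> = ennreal S * ennreal (h u)" using S h0 by (simp add: ennreal_mult mult.commute)
        finally show "(\<Sum>\<nu>\<in>F. ennreal (h u * exp (- 2 * cmod (\<nu> - u)))) \<le> ennreal S * ennreal (h u)" .
      qed
      also have "\<dots> = ennreal S * ennreal (?n f powr k)" by (subst nn_integral_cmult) (auto simp: hn)
      also have "\<dots> = ennreal (S * ?n f powr k)" using S by (simp add: ennreal_mult)
      finally show "(\<Sum>\<nu>\<in>F. ennreal (G f \<nu>)) \<le> ennreal (S * ?n f powr k)" .
    qed
  qed
  have integ: "integrable lebesgue (\<lambda>u. f u * of_real (exp (- \<alpha> * (cmod (z - u))\<^sup>2)))"
    if f: "f \<in> carrier_of berezin_source" for f z
  proof -
    obtain \<nu> where z: "z \<in> square 1 \<nu>" using lattice_square_exists by blast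
    have [measurable]: "f \<in> borel_measurable lebesgue" using f by (simp add: Lebesgue_space_carrier)
    have [measurable]: "(\<lambda>u. exp (- \<alpha> * (cmod (z - u))\<^sup>2)) \<in> borel_measurable lebesgue"
      by (intro measurable_completion) measurable
    show ?thesis
    proof (rule integrableI_bounded)
      show "(\<lambda>u. f u * of_real (exp (- \<alpha> * (cmod (z - u))\<^sup>2))) \<in> borel_measurable lebesgue" by measurable
      show "(\<integral>\<^sup>+u. ennreal (cmod (f u * of_real (exp (- \<alpha> * (cmod (z - u))\<^sup>2)))) \<partial>lebesgue) < \<infinity>"
        by (rule order_le_less_trans[OF pt[OF f z]]) simp
    qed
  qed
  have Bpt: "cmod (berezin \<alpha> f z) \<le> c * H \<nu> powr (- (2 / p)) * G f \<nu> powr (1 / k)"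
    if f: "f \<in> carrier_of berezin_source" and z: "z \<in> square 1 \<nu>" for f z \<nu>
  proof -
    have "ennreal (cmod (berezin \<alpha> f z)) \<le> (\<integral>\<^sup>+u. ennreal (cmod (f u * of_real (exp (- \<alpha> * (cmod (z - u))\<^sup>2)))) \<partial>lebesgue)"
      unfolding berezin_def by (rule integral_norm_bound_ennreal[OF integ[OF f]])
    also have "\<dots> \<le> ennreal (c * H \<nu> powr (- (2 / p)) * G f \<nu> powr (1 / k))" by (rule pt[OF f z])
    finally show ?thesis using c by (subst (asm) ennreal_le_iff) auto
  qed
  have Bint: "(\<integral>\<^sup>+z. ennreal (cmod (berezin \<alpha> f z) powr (q / 2)) \<partial>\<mu>)
      \<le> ennreal (c powr (q / 2) * (W powr (1 / s) * (S * ?n f powr k) powr (1 - 1 / s)))"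
    and Bmeas: "berezin \<alpha> f \<in> borel_measurable \<mu>"
    if f: "f \<in> carrier_of berezin_source" for f
  proof -
    have "f \<in> borel_measurable lebesgue" using f by (simp add: Lebesgue_space_carrier)
    from berezin_measurable[OF this] show [measurable]: "berezin \<alpha> f \<in> borel_measurable \<mu>"
      using sets by (simp cong: measurable_cong_sets)
    have "(\<integral>\<^sup>+z. ennreal (cmod (berezin \<alpha> f z) powr (q / 2)) \<partial>\<mu>)
        = (\<integral>\<^sup>+\<nu>. (\<integral>\<^sup>+z\<in>square 1 \<nu>. ennreal (cmod (berezin \<alpha> f z) powr (q / 2)) \<partial>\<mu>) \<partial>count_space lattice)"
      using sets by (intro nn_integral_lattice) auto
    also have "\<dots> \<le> (\<integral>\<^sup>+\<nu>. ennreal (c powr (q / 2)) * ennreal ((l \<nu> powr s) powr (1 / s) * G f \<nu> powr (1 - 1 / s)) \<partial>count_space lattice)"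
    proof (rule nn_integral_mono)
      fix \<nu> assume "\<nu> \<in> space (count_space lattice)"
      then have \<nu>: "\<nu> \<in> lattice" by simp
      let ?b = "c * H \<nu> powr (- (2 / p)) * G f \<nu> powr (1 / k)"
      have "(\<integral>\<^sup>+z\<in>square 1 \<nu>. ennreal (cmod (berezin \<alpha> f z) powr (q / 2)) \<partial>\<mu>)
          \<le> (\<integral>\<^sup>+z. ennreal (?b powr (q / 2)) * indicator (square 1 \<nu>) z \<partial>\<mu>)"
        using q Bpt[OF f] by (intro nn_integral_mono) (auto split: split_indicator intro!: ennreal_leI powr_mono2)
      also have "\<dots> = ennreal (?b powr (q / 2)) * emeasure \<mu> (square 1 \<nu>)"
        using sets by (intro nn_integral_cmult_indicator) simp
      also have "\<dots> = ennreal (?b powr (q / 2) * (l \<nu> * H \<nu> powr (q / p)))"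
        unfolding \<mu>Q[OF \<nu>] using l0 by (subst ennreal_mult[symmetric]) auto
      also have "?b powr (q / 2) * (l \<nu> * H \<nu> powr (q / p)) = c powr (q / 2) * ((l \<nu> powr s) powr (1 / s) * G f \<nu> powr (1 - 1 / s))"
      proof -
        have "?b powr (q / 2) = c powr (q / 2) * H \<nu> powr (- (q / p)) * G f \<nu> powr (q / (2 * k))"
          by (simp add: powr_mult powr_powr mult.commute)
        moreover have "H \<nu> powr (- (q / p)) * H \<nu> powr (q / p) = 1"
          using H_pos[of \<nu>] by (simp add: powr_add[symmetric])
        ultimately show ?thesis using l0[of \<nu>] s(2) unfolding qk by (simp add: powr_powr)
      qed
      also have "ennreal \<dots> = ennreal (c powr (q / 2)) * ennreal ((l \<nu> powr s) powr (1 / s) * G f \<nu> powr (1 - 1 / s))"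
        by (intro ennreal_mult) auto
      finally show "(\<integral>\<^sup>+z\<in>square 1 \<nu>. ennreal (cmod (berezin \<alpha> f z) powr (q / 2)) \<partial>\<mu>)
          \<le> ennreal (c powr (q / 2)) * ennreal ((l \<nu> powr s) powr (1 / s) * G f \<nu> powr (1 - 1 / s))" .
    qed
    also have "\<dots> = ennreal (c powr (q / 2)) * (\<integral>\<^sup>+\<nu>. ennreal ((l \<nu> powr s) powr (1 / s) * G f \<nu> powr (1 - 1 / s)) \<partial>count_space lattice)"
      by (intro nn_integral_cmult) auto
    also have "\<dots> \<le> ennreal (c powr (q / 2)) * ennreal (W powr (1 / s) * (S * ?n f powr k) powr (1 - 1 / s))"
    proof (intro mult_left_mono nn_integral_Hoelder)
      show "(\<integral>\<^sup>+\<nu>. ennreal (G f \<nu>) \<partial>count_space lattice) \<le> ennreal (S * ?n f powr k)"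
        \<comment> \<open>\<open>total\<close> was proved together with \<open>pt\<close> and shares
          its premise that \<open>z\<close> lies in a square, so some square has to be
          supplied.\<close>
        using total[OF f] lattice_square_exists by blast
    qed (use G0 s(2) s1 lW S in \<open>auto simp: W_def\<close>)
    also have "\<dots> = ennreal (c powr (q / 2) * (W powr (1 / s) * (S * ?n f powr k) powr (1 - 1 / s)))"
      by (intro ennreal_mult[symmetric]) auto
    finally show "(\<integral>\<^sup>+z. ennreal (cmod (berezin \<alpha> f z) powr (q / 2)) \<partial>\<mu>)
      \<le> ennreal (c powr (q / 2) * (W powr (1 / s) * (S * ?n f powr k) powr (1 - 1 / s)))" .
  qed
  show ?thesis
    unfolding berezin_bounded_def bounded_map_def linear_map_def
  proof (intro conjI ballI allI exI[of _ "c * (W powr (1 / s)) powr (2 / q) * S powr (1 / k)"])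
    fix f assume f: "f \<in> carrier_of berezin_source"
    show "integrable lebesgue (\<lambda>u. f u * of_real (exp (- \<alpha> * (cmod (z - u))\<^sup>2)))" for z by (rule integ[OF f])
    show "berezin \<alpha> f \<in> carrier_of ?Y"
      using Bmeas[OF f] order_le_less_trans[OF Bint[OF f]] by (simp add: Lebesgue_space_carrier)
    show "berezin \<alpha> (\<lambda>x. f x + g x) = (\<lambda>y. berezin \<alpha> f y + berezin \<alpha> g y)" if g: "g \<in> carrier_of berezin_source" for g
      unfolding berezin_def distrib_right
      by (intro ext Bochner_Integration.integral_add integ f g)
    show "berezin \<alpha> (\<lambda>x. a * f x) = (\<lambda>y. a * berezin \<alpha> f y)" for a
      by (rule ext) (simp add: berezin_def mult.assoc)
    have n0: "0 \<le> ?n f" by (simp add: Lebesgue_space_norm)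
    have "norm_of ?Y (berezin \<alpha> f) \<le> (c powr (q / 2) * (W powr (1 / s) * (S * ?n f powr k) powr (1 - 1 / s))) powr (2 / q)"
      unfolding Lebesgue_space_norm[of "q / 2"] using q enn2real_mono[OF Bint[OF f]]
      by (simp add: powr_mono2)
    also have "\<dots> = c * (W powr (1 / s)) powr (2 / q) * S powr (1 / k) * ?n f"
    proof -
      have "(1 - 1 / s) * (2 / q) = 1 / k" unfolding qk using q by simp
      then have "((S * ?n f powr k) powr (1 - 1 / s)) powr (2 / q) = S powr (1 / k) * ?n f"
        unfolding powr_powr using k n0 by (simp add: powr_mult powr_powr)
      moreover have "(c powr (q / 2)) powr (2 / q) = c" using q c by (simp add: powr_powr)
      ultimately show ?thesis unfolding powr_mult[of "c powr (q / 2)"] powr_mult[of "W powr (1 / s)"] by simp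
    qed
    finally show "norm_of ?Y (berezin \<alpha> f) \<le> c * (W powr (1 / s)) powr (2 / q) * S powr (1 / k) * ?n f" .
  qed (use c S in auto)
qed


text \<open>The kernel is positive, so a nonnegative step function contributes on each square at
  least what that square alone gives. With heights \<beta>^2 H^(-2/p), the k-th power of the source
  norm is at most a multiple of the sum of \<beta>^r, while the power q/2 of a height, integrated
  over its square, is \<beta>^q times the term of (e). The duality is thus the one used for
  (a).\<close>

lemma mass_ratio_of_berezin_bounded:
  assumes q: "1 \<le> q" "q \<le> 2" and p2: "p < 2" and s: "1 / s = 1 + q / 2 - q / p" "s > 0"
    and sets: "sets \<mu> = sets borel" and bounded: "berezin_bounded \<alpha> berezin_source (Lebesgue_space (q / 2) \<mu>)"
  shows "mass_ratio (q / p) H \<mu> \<in> ell_space s"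
proof -
  define k where "k = p / (2 - p)"
  have k: "k > 1" using p p2 by (simp add: k_def)
  define e where "e = 2 / (2 - p)"
  have e0: "e > 0" using p2 by (simp add: e_def)
  have ek: "2 / p * k = e" unfolding e_def k_def using p p2 by (simp add: field_simps)
  define r where "r = 2 * k"
  have r: "r > 0" "1 / s = 1 - q / r" unfolding s(1) using p p2 by (auto simp: r_def k_def field_simps)
  let ?Y = "Lebesgue_space (q / 2) \<mu>"
  obtain A where A: "A \<ge> 0" and bd: "\<And>f. f \<in> carrier_of berezin_source \<Longrightarrow> norm_of ?Y (berezin \<alpha> f) \<le> A * norm_of berezin_source f"
    using bounded unfolding berezin_bounded_def bounded_map_def by blast
  have integ: "integrable lebesgue (\<lambda>u. f u * of_real (exp (- \<alpha> * (cmod (z - u))\<^sup>2)))"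
    and mem: "berezin \<alpha> f \<in> carrier_of ?Y" if "f \<in> carrier_of berezin_source" for f z
    using bounded that unfolding berezin_bounded_def bounded_map_def linear_map_def by blast+
  \<comment> \<open>Bounds the change of \<open>H powr e\<close> from the centre of a unit square to
    its points.\<close>
  define N where "N = (C * exp D) powr e"
  have N: "N > 0" using C by (simp add: N_def)
  define G where "G = exp (\<alpha> * q) * (A powr (q / 2) * N powr (q / r))"
  have G0: "0 \<le> G" by (simp add: G_def)
  have main: "(\<Sum>\<nu>\<in>F. ennreal (\<beta> \<nu> powr q) * mass_ratio (q / p) H \<mu> \<nu>) \<le> ennreal (G * (\<Sum>\<nu>\<in>F. \<beta> \<nu> powr r) powr (q / r))"
    if F: "finite F" "F \<subseteq> lattice" and \<beta>: "\<And>\<nu>. 0 \<le> \<beta> \<nu>" for F \<beta>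
  proof -
    define T where "T = (\<Sum>\<nu>\<in>F. \<beta> \<nu> powr r)"
    have T0: "0 \<le> T" by (simp add: T_def sum_nonneg)
    define y where "y \<nu> = (\<beta> \<nu>)\<^sup>2 * H \<nu> powr (- (2 / p))" for \<nu>
    have y0: "0 \<le> y \<nu>" for \<nu> by (simp add: y_def)
    define f :: "complex \<Rightarrow> real" where "f u = (\<Sum>\<nu>\<in>F. y \<nu> * indicator (square 1 \<nu>) u)" for u
    have f_at: "f u = y \<nu>" if "\<nu> \<in> F" "u \<in> square 1 \<nu>" for u \<nu>
      unfolding f_def by (rule sum_indicator_square[OF F that])
    have f_off: "f u = 0" if "\<not> (\<exists>\<nu>\<in>F. u \<in> square 1 \<nu>)" for u
      unfolding f_def using that by (intro sum.neutral) auto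
    have f0: "0 \<le> f u" for u unfolding f_def using y0 by (intro sum_nonneg) auto
    have fm [measurable]: "f \<in> borel_measurable lebesgue" unfolding f_def[abs_def] by measurable
    let ?f = "\<lambda>u. complex_of_real (f u)"
    have int: "(\<integral>\<^sup>+u. ennreal (cmod (?f u) powr k * H u powr e) \<partial>lebesgue) \<le> ennreal (N * T)"
    proof -
      have "(\<integral>\<^sup>+u. ennreal (cmod (?f u) powr k * H u powr e) \<partial>lebesgue)
          \<le> (\<integral>\<^sup>+u. (\<Sum>\<nu>\<in>F. ennreal (N * \<beta> \<nu> powr r) * indicator (square 1 \<nu>) u) \<partial>lebesgue)"
      proof (rule nn_integral_mono)
        fix u
        show "ennreal (cmod (?f u) powr k * H u powr e) \<le> (\<Sum>\<nu>\<in>F. ennreal (N * \<beta> \<nu> powr r) * indicator (square 1 \<nu>) u)"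
        proof (cases "\<exists>\<nu>\<in>F. u \<in> square 1 \<nu>")
          case True
          then obtain \<nu> where \<nu>: "\<nu> \<in> F" "u \<in> square 1 \<nu>" by blast
          have "exp (D * cmod (u - \<nu>)) \<le> exp D"
            using D square_dist_less_1[OF \<nu>(2)] mult_left_le[of "cmod (u - \<nu>)" D] by simp
          then have "C * exp (D * cmod (u - \<nu>)) * H \<nu> \<le> C * exp D * H \<nu>"
            using C by (intro mult_right_mono mult_left_mono) auto
          then have "H u \<le> C * exp D * H \<nu>" using growth[of u \<nu>] by linarith
          then have Hu: "H u powr e \<le> N * H \<nu> powr e"
            unfolding N_def powr_mult[symmetric] using e0 by (intro powr_mono2) auto
          have "cmod (?f u) powr k * H u powr e = y \<nu> powr k * H u powr e"
            using f_at[OF \<nu>] y0[of \<nu>] by simp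
          also have "\<dots> \<le> y \<nu> powr k * (N * H \<nu> powr e)" by (intro mult_left_mono Hu) simp
          also have "y \<nu> powr k = \<beta> \<nu> powr r * H \<nu> powr (- e)"
          proof -
            have "((\<beta> \<nu>)\<^sup>2) powr k = \<beta> \<nu> powr r"
              using square_powr_half[OF \<beta>, of \<nu> r] by (simp add: r_def)
            moreover have "(H \<nu> powr (- (2 / p))) powr k = H \<nu> powr (- e)"
              unfolding powr_powr minus_mult_left[symmetric] ek ..
            ultimately show ?thesis by (simp only: y_def powr_mult)
          qed
          also have "\<beta> \<nu> powr r * H \<nu> powr (- e) * (N * H \<nu> powr e) = N * \<beta> \<nu> powr r"
            using H_pos[of \<nu>] by (simp add: powr_minus)
          finally have "ennreal (cmod (?f u) powr k * H u powr e) \<le> ennreal (N * \<beta> \<nu> powr r) * indicator (square 1 \<nu>) u"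
            using \<nu> by (simp add: ennreal_leI)
          also have "\<dots> \<le> (\<Sum>\<nu>\<in>F. ennreal (N * \<beta> \<nu> powr r) * indicator (square 1 \<nu>) u)"
            using F \<nu> by (intro member_le_sum) auto
          finally show ?thesis .
        next
          case False
          then show ?thesis using k by (simp add: f_off)
        qed
      qed
      also have "\<dots> = (\<Sum>\<nu>\<in>F. ennreal (N * \<beta> \<nu> powr r))"
        by (subst nn_integral_sum) (auto simp: nn_integral_cmult_indicator emeasure_square)
      also have "\<dots> = ennreal (N * T)"
        unfolding T_def sum_distrib_left using N by (intro sum_ennreal) auto
      finally show ?thesis .
    qed
    have src: "?f \<in> carrier_of berezin_source"
    proof -
      have "?f \<in> borel_measurable lebesgue" by measurable
      moreover have "(\<integral>\<^sup>+u. ennreal (cmod (?f u) powr k) \<partial>density lebesgue (\<lambda>z. ennreal (H z powr e))) < \<infinity>"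
        by (subst berezin_source_integral) (measurable, rule order_le_less_trans[OF int], simp)
      ultimately show ?thesis
        unfolding Lebesgue_space_carrier k_def[symmetric] e_def[symmetric] by simp
    qed
    have "norm_of berezin_source ?f = enn2real (\<integral>\<^sup>+u. ennreal (cmod (?f u) powr k * H u powr e) \<partial>lebesgue) powr (1 / k)"
      unfolding Lebesgue_space_norm k_def[symmetric] e_def[symmetric] by (subst berezin_source_integral) auto
    also have "\<dots> \<le> (N * T) powr (1 / k)"
      using enn2real_mono[OF int] N T0 k by (intro powr_mono2) auto
    finally have nX: "norm_of berezin_source ?f \<le> (N * T) powr (1 / k)" .
    have low: "y \<nu> * exp (- 2 * \<alpha>) \<le> cmod (berezin \<alpha> ?f z)" if \<nu>: "\<nu> \<in> F" and z: "z \<in> square 1 \<nu>" for \<nu> z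
    proof -
      have ic: "integrable lebesgue (\<lambda>u. ?f u * of_real (exp (- \<alpha> * (cmod (z - u))\<^sup>2)))" by (rule integ[OF src])
      have ii: "integrable lebesgue (\<lambda>u. indicator (square 1 \<nu>) u :: real)"
        by (rule integrable_real_indicator) (auto simp: emeasure_square)
      have "y \<nu> * exp (- 2 * \<alpha>) = (LINT u|lebesgue. y \<nu> * exp (- 2 * \<alpha>) * indicator (square 1 \<nu>) u)"
        by (simp add: measure_def emeasure_square)
      also have "\<dots> \<le> (LINT u|lebesgue. Re (?f u * of_real (exp (- \<alpha> * (cmod (z - u))\<^sup>2))))"
      proof (rule integral_mono)
        show "integrable lebesgue (\<lambda>u. y \<nu> * exp (- 2 * \<alpha>) * indicator (square 1 \<nu>) u)" using ii by simp
        show "integrable lebesgue (\<lambda>u. Re (?f u * of_real (exp (- \<alpha> * (cmod (z - u))\<^sup>2))))" by (rule integrable_Re[OF ic])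
        fix u
        show "y \<nu> * exp (- 2 * \<alpha>) * indicator (square 1 \<nu>) u \<le> Re (?f u * of_real (exp (- \<alpha> * (cmod (z - u))\<^sup>2)))"
        proof (cases "u \<in> square 1 \<nu>")
          case True
          \<comment> \<open>Two points of a unit square are at most its diagonal apart, so the
            squared distance is at most 2, whence the exponent -2\<alpha>.\<close>
          have "cmod (z - u) \<le> sqrt (1 / 2) + sqrt (1 / 2)"
            using norm_triangle_ineq4[of "z - \<nu>" "u - \<nu>"] square_dist[OF z] square_dist[OF True] by simp
          then have "(cmod (z - u))\<^sup>2 \<le> (2 * sqrt (1 / 2))\<^sup>2" by (intro power_mono) auto
          then have "(cmod (z - u))\<^sup>2 \<le> 2" by (simp add: power_mult_distrib)
          then have "exp (- 2 * \<alpha>) \<le> exp (- \<alpha> * (cmod (z - u))\<^sup>2)" using \<alpha> mult_left_mono[of "(cmod (z - u))\<^sup>2" 2 \<alpha>] by simp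
          then have "y \<nu> * exp (- 2 * \<alpha>) \<le> y \<nu> * exp (- \<alpha> * (cmod (z - u))\<^sup>2)" by (rule mult_left_mono[OF _ y0])
          then show ?thesis using True f_at[OF \<nu> True] by simp
        next
          case False
          then show ?thesis using f0[of u] by simp
        qed
      qed
      also have "\<dots> = Re (berezin \<alpha> ?f z)" unfolding berezin_def by (rule integral_Re[OF ic])
      also have "\<dots> \<le> cmod (berezin \<alpha> ?f z)" by (rule complex_Re_le_cmod)
      finally show ?thesis .
    qed
    let ?w = "\<lambda>\<nu>. exp (- \<alpha> * q) * (\<beta> \<nu> powr q * H \<nu> powr (- (q / p)))"
    have pt: "(\<Sum>\<nu>\<in>F. ennreal (?w \<nu>) * indicator (square 1 \<nu>) z) \<le> ennreal (cmod (berezin \<alpha> ?f z) powr (q / 2))" for z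
    proof (cases "\<exists>\<nu>\<in>F. z \<in> square 1 \<nu>")
      case True
      then obtain \<nu> where \<nu>: "\<nu> \<in> F" "z \<in> square 1 \<nu>" by blast
      have "(\<Sum>\<kappa>\<in>F. ennreal (?w \<kappa>) * indicator (square 1 \<kappa>) z) = ennreal (?w \<nu>)"
        by (rule sum_indicator_square[OF F \<nu>])
      also have "?w \<nu> = (y \<nu> * exp (- 2 * \<alpha>)) powr (q / 2)"
      proof -
        have "((\<beta> \<nu>)\<^sup>2) powr (q / 2) = \<beta> \<nu> powr q"
          by (rule square_powr_half[OF \<beta>])
        moreover have "exp (- 2 * \<alpha>) powr (q / 2) = exp (- \<alpha> * q)" by (simp add: powr_def mult.commute)
        ultimately show ?thesis by (simp add: y_def powr_mult powr_powr mult_ac)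
      qed
      also have "\<dots> \<le> cmod (berezin \<alpha> ?f z) powr (q / 2)"
        using low[OF \<nu>] y0[of \<nu>] q by (intro powr_mono2) auto
      finally show ?thesis by (simp add: ennreal_leI)
    next
      case False
      then show ?thesis by (simp add: sum.neutral)
    qed
    have "ennreal (exp (- \<alpha> * q)) * (\<Sum>\<nu>\<in>F. ennreal (\<beta> \<nu> powr q) * mass_ratio (q / p) H \<mu> \<nu>)
        = (\<Sum>\<nu>\<in>F. ennreal (?w \<nu>) * emeasure \<mu> (square 1 \<nu>))"
    proof -
      have "ennreal (exp (- \<alpha> * q)) * (ennreal (\<beta> \<nu> powr q) * mass_ratio (q / p) H \<mu> \<nu>) = ennreal (?w \<nu>) * emeasure \<mu> (square 1 \<nu>)" for \<nu>
        by (simp add: mass_ratio_eq_mult[of H, OF H_pos] ennreal_mult mult.assoc)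
      then show ?thesis by (simp add: sum_distrib_left)
    qed
    also have "\<dots> = (\<integral>\<^sup>+z. (\<Sum>\<nu>\<in>F. ennreal (?w \<nu>) * indicator (square 1 \<nu>) z) \<partial>\<mu>)"
      using sets by (subst nn_integral_sum) (auto simp: nn_integral_cmult_indicator)
    also have "\<dots> \<le> (\<integral>\<^sup>+z. ennreal (cmod (berezin \<alpha> ?f z) powr (q / 2)) \<partial>\<mu>)"
      by (intro nn_integral_mono pt)
    also have "\<dots> = ennreal (norm_of ?Y (berezin \<alpha> ?f) powr (q / 2))"
      using mem[OF src] q unfolding Lebesgue_space_carrier Lebesgue_space_norm[of "q / 2"] by (simp add: powr_powr)
    also have "\<dots> \<le> ennreal ((A * (N * T) powr (1 / k)) powr (q / 2))"
      using bd[OF src] mult_left_mono[OF nX A] q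
      by (intro ennreal_leI powr_mono2) (auto simp: Lebesgue_space_norm[of "q / 2"])
    also have "(A * (N * T) powr (1 / k)) powr (q / 2) = exp (- \<alpha> * q) * (G * T powr (q / r))"
    proof -
      have "1 / k * (q / 2) = q / r" by (simp add: r_def)
      then have "(A * (N * T) powr (1 / k)) powr (q / 2) = A powr (q / 2) * (N powr (q / r) * T powr (q / r))"
        by (simp only: powr_mult powr_powr)
      moreover have "exp (- \<alpha> * q) * exp (\<alpha> * q) = 1" unfolding mult_exp_exp by simp
      ultimately show ?thesis by (simp add: G_def)
    qed
    also have "ennreal (exp (- \<alpha> * q) * (G * T powr (q / r))) = ennreal (exp (- \<alpha> * q)) * ennreal (G * T powr (q / r))"
      using G0 by (intro ennreal_mult) auto
    finally show ?thesis
      unfolding T_def by (subst (asm) ennreal_mult_le_mult_iff) auto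
  qed
  show ?thesis
    using q r G0 s(2) main by (auto intro!: ell_space_duality(1)[of s q r G])
qed

end

theorem theorem3p4:
  fixes \<alpha> p q s :: real and w :: "complex \<Rightarrow> real"
  assumes "\<alpha> > 0" and "1 < p" and "p < 2" and "1 \<le> q" and "q \<le> 2"
    and "Ap_restricted p w"
    and "s = 2 * p / (2 * p - 2 * q + p * q)"
  shows "\<exists>c>0. \<forall>\<mu> :: complex measure. sets \<mu> = sets borel \<longrightarrow>
    (let a = summing 2 (Fock_space \<alpha> p w) (gauss_Lebesgue_space \<alpha> q \<mu>) (\<lambda>f. f);
         b = summing 2 (Fock_space \<alpha> p (weight_hat w)) (gauss_Lebesgue_space \<alpha> q \<mu>) (\<lambda>f. f);
         c' = (\<forall>r\<ge>1. summing r (Fock_space \<alpha> p w) (gauss_Lebesgue_space \<alpha> q \<mu>) (\<lambda>f. f));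
         d = berezin_bounded \<alpha>
               (Lebesgue_space (p / (2 - p))
                 (density lebesgue (\<lambda>z. ennreal (weight_hat w z powr (2 / (2 - p))))))
               (Lebesgue_space (q / 2) \<mu>);
         e = (lattice_ratio p q w \<mu> \<in> ell_space s);
         \<pi> = summing_norm 2 (Fock_space \<alpha> p w) (gauss_Lebesgue_space \<alpha> q \<mu>) (\<lambda>f. f);
         L = ell_norm s (lattice_ratio p q w \<mu>) powr (1 / q)
     in (a \<longleftrightarrow> b) \<and> (a \<longleftrightarrow> c') \<and> (a \<longleftrightarrow> d) \<and> (a \<longleftrightarrow> e) \<and>
        (a \<or> b \<or> c' \<or> d \<or> e \<longrightarrow> (1 / c) * L \<le> \<pi> \<and> \<pi> \<le> c * L))"
proof -
  note p = \<open>1 < p\<close> and p2 = \<open>p < 2\<close> and q = \<open>1 \<le> q\<close> \<open>q \<le> 2\<close>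
  let ?H = "weight_hat w"
  let ?X = "Fock_space \<alpha> p w" and ?Xh = "Fock_space \<alpha> p (weight_hat w)" and ?Y = "gauss_Lebesgue_space \<alpha> q"
  let ?l = "mass_ratio (q / p) (weight_hat w)"
  let ?B = "\<lambda>\<mu>. berezin_bounded \<alpha> (Lebesgue_space (p / (2 - p)) (density lebesgue (\<lambda>z. ennreal (weight_hat w z powr (2 / (2 - p))))))
       (Lebesgue_space (q / 2) \<mu>)"
  \<comment> \<open>The denominator of \<open>s\<close> is positive because q(2 - p) \<le> 2(2 - p)
    < 2p, the last step by p > 1.\<close>
  have pos: "2 * p - 2 * q + p * q > 0"
  proof -
    have "q * (2 - p) \<le> 2 * (2 - p)" using q p2 by (intro mult_right_mono) auto
    then show ?thesis using p by (simp add: algebra_simps)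
  qed
  have s: "1 / s = 1 + q / 2 - q / p" "s > 0"
    using p pos by (simp_all add: \<open>s = _\<close> field_simps)
  obtain C D where fw: "fock_weight \<alpha> p w ?H C D"
    by (rule fock_weight_original[OF \<open>\<alpha> > 0\<close> p \<open>Ap_restricted p w\<close>])
  obtain C' where fh: "fock_weight \<alpha> p ?H ?H C' D" by (rule fock_weight_hat[OF fw])
  have ratio: "lattice_ratio p q w \<mu> = mass_ratio (q / p) ?H \<mu>" for \<mu>
    by (simp add: fun_eq_iff lattice_ratio_def mass_ratio_def weight_hat_def)
  obtain c1 where c1: "c1 > 0" and up: "\<And>\<mu> r. sets \<mu> = sets borel \<Longrightarrow> ?l \<mu> \<in> ell_space s \<Longrightarrow> 1 \<le> r \<Longrightarrow>
      linear_map ?X (?Y \<mu>) (\<lambda>f. f) \<and>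
      summing_bound r ?X (?Y \<mu>) (\<lambda>f. f)
        (c1 * ell_norm s (?l \<mu>) powr (1 / q))"
    by (rule fock_weight.summing_of_mass_ratio[OF fw q s]) (rule that; iprover)
  obtain c2 where c2: "c2 > 0" and low: "\<And>\<mu> B. sets \<mu> = sets borel \<Longrightarrow>
      linear_map ?X (?Y \<mu>) (\<lambda>f. f) \<Longrightarrow>
      summing_bound 2 ?X (?Y \<mu>) (\<lambda>f. f) B \<Longrightarrow>
      ?l \<mu> \<in> ell_space s \<and> ell_norm s (?l \<mu>) powr (1 / q) \<le> c2 * B"
    by (rule fock_weight.mass_ratio_of_summing[OF fw q p2 s]) (rule that; iprover)
  \<comment> \<open>For (b) the same two lemmas are instantiated with \<open>H\<close> as weight and
    as mass; the sequence \<open>?l \<mu>\<close> does not change.\<close>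
  have up_hat: "summing 2 ?Xh (?Y \<mu>) (\<lambda>f. f)"
    if "sets \<mu> = sets borel" "?l \<mu> \<in> ell_space s" for \<mu>
    by (rule fock_weight.summing_of_mass_ratio[OF fh q s])
      (use that in \<open>unfold summing_def, meson one_le_numeral\<close>)
  have low_hat: "?l \<mu> \<in> ell_space s"
    if "sets \<mu> = sets borel" "summing 2 ?Xh (?Y \<mu>) (\<lambda>f. f)" for \<mu>
    by (rule fock_weight.mass_ratio_of_summing[OF fh q p2 s]) (use that in \<open>auto simp: summing_def\<close>)
  \<comment> \<open>\<open>c1\<close> and \<open>c2\<close> were obtained before any
    \<open>\<mu>\<close> was fixed, so \<open>c\<close> is uniform in \<open>\<mu>\<close>.\<close>
  define c where "c = max c1 c2"
  have c: "c > 0" "c1 \<le> c" "c2 \<le> c" using c1 by (auto simp: c_def)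
  have main: "(summing 2 ?X (?Y \<mu>) (\<lambda>f. f) \<longleftrightarrow> ?l \<mu> \<in> ell_space s)"
    "(summing 2 ?Xh (?Y \<mu>) (\<lambda>f. f) \<longleftrightarrow> ?l \<mu> \<in> ell_space s)"
    "(\<forall>r\<ge>1. summing r ?X (?Y \<mu>) (\<lambda>f. f)) \<longleftrightarrow> ?l \<mu> \<in> ell_space s"
    "?B \<mu> \<longleftrightarrow> ?l \<mu> \<in> ell_space s"
    if \<mu>: "sets \<mu> = sets borel" for \<mu>
  proof -
    show a: "summing 2 ?X (?Y \<mu>) (\<lambda>f. f) \<longleftrightarrow> ?l \<mu> \<in> ell_space s"
      unfolding summing_def using up[OF \<mu>, of 2] low[OF \<mu>] by auto
    show "summing 2 ?Xh (?Y \<mu>) (\<lambda>f. f) \<longleftrightarrow> ?l \<mu> \<in> ell_space s"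
      using up_hat[OF \<mu>] low_hat[OF \<mu>] by blast
    show "(\<forall>r\<ge>1. summing r ?X (?Y \<mu>) (\<lambda>f. f)) \<longleftrightarrow> ?l \<mu> \<in> ell_space s"
    proof
      assume "\<forall>r\<ge>1. summing r ?X (?Y \<mu>) (\<lambda>f. f)"
      then show "?l \<mu> \<in> ell_space s" using a by simp
    next
      assume "?l \<mu> \<in> ell_space s"
      then show "\<forall>r\<ge>1. summing r ?X (?Y \<mu>) (\<lambda>f. f)"
        using up[OF \<mu>] unfolding summing_def by blast
    qed
    show "?B \<mu> \<longleftrightarrow> ?l \<mu> \<in> ell_space s"
      using fock_weight.berezin_bounded_of_mass_ratio[OF fw q p2 s \<mu>]
        fock_weight.mass_ratio_of_berezin_bounded[OF fw q p2 s \<mu>] by blast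
  qed
  have norm: "(1 / c) * ell_norm s (?l \<mu>) powr (1 / q) \<le> summing_norm 2 ?X (?Y \<mu>) (\<lambda>f. f)"
    "summing_norm 2 ?X (?Y \<mu>) (\<lambda>f. f) \<le> c * ell_norm s (?l \<mu>) powr (1 / q)"
    if \<mu>: "sets \<mu> = sets borel" and e: "?l \<mu> \<in> ell_space s" for \<mu>
  proof -
    let ?L = "ell_norm s (?l \<mu>) powr (1 / q)"
    let ?S = "{B. summing_bound 2 ?X (?Y \<mu>) (\<lambda>f. f) B}"
    have lin: "linear_map ?X (?Y \<mu>) (\<lambda>f. f)" and mem: "c1 * ?L \<in> ?S"
      using up[OF \<mu> e, of 2] by auto
    have "bdd_below ?S" by (rule bdd_belowI[of _ 0]) (simp add: summing_bound_def)
    then have "Inf ?S \<le> c1 * ?L" by (rule cInf_lower[OF mem])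
    also have "\<dots> \<le> c * ?L" using c by (intro mult_right_mono) auto
    finally show "summing_norm 2 ?X (?Y \<mu>) (\<lambda>f. f) \<le> c * ?L"
      by (simp add: summing_norm_def)
    \<comment> \<open>The necessity estimate holds for every admissible constant \<open>B\<close>,
      hence for their infimum.\<close>
    have "1 / c * ?L \<le> Inf ?S"
    proof (rule cInf_greatest)
      show "?S \<noteq> {}" using mem by blast
      fix B assume B: "B \<in> ?S"
      then have B0: "0 \<le> B" by (simp add: summing_bound_def)
      have "?L \<le> c2 * B" using low[OF \<mu> lin] B by blast
      also have "\<dots> \<le> c * B" using c B0 by (intro mult_right_mono) auto
      finally show "1 / c * ?L \<le> B" using c by (simp add: field_simps)
    qed
    then show "1 / c * ?L \<le> summing_norm 2 ?X (?Y \<mu>) (\<lambda>f. f)"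
      by (simp add: summing_norm_def)
  qed
  show ?thesis
    unfolding Let_def ratio using c(1) main norm by (intro exI[of _ c]) auto
qed

end
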